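(* Let $H$ be a Hilbert space, $\mathbf{a}=[a_1,\dots,a_\ell]$ a row and $\mathbf{b}=[b_1,\dots,b_\ell]^t$ a column of operators in $\mathcal{B}(H)$, and $Tx=\sum_{j=1}^\ell a_jxb_j$. Let $H_1=\{\xi\in H:\|\xi\|\le1\}$ and define $f_T\colon H_1\times H_1\to\mathbb{C}$ by $f_T(\xi,\eta)=\operatorname{tgm}(Q(\mathbf{a}^*,\xi),Q(\mathbf{b},\eta))$. The following are equivalent: (i) $T\colon\mathcal{B}(H)\to\mathcal{B}(H)$ is compact; (ii) $f_T$ is continuous on $H_1\times H_1$ with respect to the product of the weak topologies; (iii) $f_T$ is continuous, with respect to the product of the weak topologies on $H_1\times H_1$, at each point of $(H_1\times\{0\})\cup(\{0\}\times H_1)$. If moreover $a_1,\dots,a_\ell$ are linearly independent and $b_1,\dots,b_\ell$ are linearly independent, then (i)–(iii) are also equivalent to (iv) $a_j,b_j\in\mathcal{K}(H)$ for $1\le j\le\ell$.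
   Context: $\mathcal{K}(H)$ denotes the compact operators on $H$. For a column $\mathbf{c}=[c_1,\dots,c_\ell]^t$ of operators and $\eta\in H$, $Q(\mathbf{c},\eta)=(\langle c_j\eta,c_i\eta\rangle)_{i,j=1}^\ell$; $\mathbf{a}^*=[a_1^*,\dots,a_\ell^*]^t$. For positive semidefinite $X,Y\in M_\ell(\mathbb{C})$, $\operatorname{tgm}(X,Y)=\operatorname{trace}\sqrt{\sqrt{X}Y\sqrt{X}}$. *)

theory Defs
  imports "HOL-Analysis.Analysis"
begin

class complex_inner = real_normed_vector +
  fixes scaleC :: "complex \<Rightarrow> 'a \<Rightarrow> 'a"
    and cinner :: "'a \<Rightarrow> 'a \<Rightarrow> complex"
  assumes scaleC_add_right: "scaleC c (x + y) = scaleC c x + scaleC c y"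
    and scaleC_add_left: "scaleC (c + d) x = scaleC c x + scaleC d x"
    and scaleC_scaleC: "scaleC c (scaleC d x) = scaleC (c * d) x"
    and scaleC_one: "scaleC 1 x = x"
    and scaleR_scaleC: "scaleR r x = scaleC (complex_of_real r) x"
    and cinner_add_left: "cinner (x + y) z = cinner x z + cinner y z"
    and cinner_scaleC_left: "cinner (scaleC c x) y = c * cinner x y"
    and cinner_commute: "cinner y x = cnj (cinner x y)"
    and cinner_norm: "cinner x x = complex_of_real ((norm x)\<^sup>2)"

text \<open>B(H): bounded complex-linear operators, as elements of the Banach space of
  bounded (real-)linear maps with the operator norm.\<close>

definition BH :: "('h::complex_inner \<Rightarrow>\<^sub>L 'h) set" where
  "BH = {x. \<forall>c v. blinfun_apply x (scaleC c v) = scaleC c (blinfun_apply x v)}"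

definition compact_operator :: "('h::complex_inner \<Rightarrow>\<^sub>L 'h) \<Rightarrow> bool" where
  "compact_operator a \<longleftrightarrow> compact (closure (blinfun_apply a ` cball 0 1))"

definition compact_map_BH ::
  "(('h::complex_inner \<Rightarrow>\<^sub>L 'h) \<Rightarrow> ('h \<Rightarrow>\<^sub>L 'h)) \<Rightarrow> bool" where
  "compact_map_BH T \<longleftrightarrow> compact (closure (T ` {x \<in> BH. norm x \<le> 1}))"

definition cadjoint :: "('h::complex_inner \<Rightarrow>\<^sub>L 'h) \<Rightarrow> 'h \<Rightarrow> 'h" where
  "cadjoint a = (THE b. \<forall>x y. cinner (blinfun_apply a x) y = cinner x (b y))"

definition clin_indep :: "('l::finite \<Rightarrow> ('h::complex_inner \<Rightarrow>\<^sub>L 'h)) \<Rightarrow> bool" where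
  "clin_indep a \<longleftrightarrow>
     (\<forall>c :: 'l \<Rightarrow> complex.
        (\<forall>v. (\<Sum>j\<in>UNIV. scaleC (c j) (blinfun_apply (a j) v)) = 0) \<longrightarrow> (\<forall>j. c j = 0))"

definition Qmat :: "('l::finite \<Rightarrow> 'h::complex_inner \<Rightarrow> 'h) \<Rightarrow> 'h \<Rightarrow> complex^'l^'l" where
  "Qmat c \<eta> = (\<chi> i j. cinner (c j \<eta>) (c i \<eta>))"

definition psd_mat :: "complex^'l^'l \<Rightarrow> bool" where
  "psd_mat M \<longleftrightarrow> (\<forall>i j. M $ i $ j = cnj (M $ j $ i)) \<and>
     (\<forall>v :: complex^'l. let q = (\<Sum>i\<in>UNIV. \<Sum>j\<in>UNIV. cnj (v $ i) * M $ i $ j * v $ j)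
        in Im q = 0 \<and> Re q \<ge> 0)"

definition msqrt :: "complex^'l^'l \<Rightarrow> complex^'l^'l" where
  "msqrt M = (THE P. psd_mat P \<and> P ** P = M)"

definition tgm :: "complex^'l^'l \<Rightarrow> complex^'l^'l \<Rightarrow> complex" where
  "tgm X Y = trace (msqrt (msqrt X ** Y ** msqrt X))"

definition weak_topology :: "('h::complex_inner) topology" where
  "weak_topology = topology_generated_by
     {{x. cinner x y \<in> V} | y V. open (V :: complex set)}"

definition continuous_at_in :: "'a topology \<Rightarrow> 'b topology \<Rightarrow> ('a \<Rightarrow> 'b) \<Rightarrow> 'a \<Rightarrow> bool" where
  "continuous_at_in X Y f p \<longleftrightarrow> p \<in> topspace X \<and>
     (\<forall>V. openin Y V \<and> f p \<in> V \<longrightarrow> (\<exists>U. openin X U \<and> p \<in> U \<and> f ` U \<subseteq> V))"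

end

theory Submission
  imports Defs
begin

text \<open>
  By duality for the trace norm, \<open>f (\<xi>, \<eta>)\<close> is the maximum of \<open>|\<langle>T x \<eta>, \<xi>\<rangle>|\<close> over contractions \<open>x\<close>.
  All conditions are equivalent to tightness of the image under \<open>T\<close> of the unit ball: for every
  \<open>\<epsilon> > 0\<close> there is a finite set \<open>F\<close> such that \<open>|\<langle>T x v, w\<rangle>| \<le> \<epsilon> \<parallel>v\<parallel> \<parallel>w\<parallel>\<close> for all contractions \<open>x\<close> as soon as
  \<open>v\<close> or \<open>w\<close> is orthogonal to \<open>F\<close>. If \<open>T\<close> is compact, each \<open>T x\<close> is a norm limit of finite rank
  operators \<open>T (q x)\<close> with \<open>q\<close> a finite rank projection, which gives tightness; conversely a tight
  bounded family of operators is totally bounded. Tightness makes the forms \<open>\<langle>T x \<eta>, \<xi>\<rangle>\<close> weakly continuous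
  uniformly in \<open>x\<close>, and continuity of \<open>f\<close> at \<open>(0, 0)\<close> and then at \<open>(e, 0)\<close> and \<open>(0, e)\<close>, for the finitely
  many vectors \<open>e\<close> of an orthonormal basis of the span of the set found at \<open>(0, 0)\<close>, gives
  tightness back. Under linear independence, testing \<open>T\<close> on rank one operators recovers the
  tails of the individual coefficients.
\<close>

section \<open>Complex inner product spaces\<close>

text \<open>Tightness is imposed on the whole image of the ball because no coefficientwise argument
  is available: with dependent coefficients \<open>T\<close> can vanish while no \<open>a j\<close>
  or \<open>b j\<close> is compact. A finite rank projection \<open>q\<close> matches
  \<open>x\<close> only on finitely many vectors, so \<open>T (q x)\<close> and \<open>T x\<close> a
  priori agree only at finitely many vectors; relative compactness of the image is what upgrades
  this to closeness in norm. The duality replaces a nonlinear expression in \<xi> and \<eta> by a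
  maximum of sesquilinear forms over one fixed index set, so increments of \<open>f\<close> are
  bounded by increments of the forms, uniformly in \<open>x\<close>. Continuity at the origin
  controls a form only if both vectors are orthogonal to a finite set, whereas tightness asks this
  of one vector. The missing mixed terms pair a tail vector with one of finitely many unit vectors,
  and this is exactly what the remaining points of the axes provide. Since \<open>complex^'n\<close>
  is made an instance of the same class as \<open>H\<close>, one theory of orthonormal systems
  serves both the operators and the matrices.\<close>

lemma cinner_add_right: "cinner x (y + z) = cinner x y + cinner x z"
  by (metis cinner_add_left cinner_commute complex_cnj_add)

lemma cinner_scaleC_right: "cinner x (scaleC c y) = cnj c * cinner x y"
  by (metis cinner_commute cinner_scaleC_left complex_cnj_mult)

lemma cinner_zero_left: "cinner 0 y = 0"
  using cinner_add_left[of 0 0 y] by simp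

lemma cinner_zero_right: "cinner x 0 = 0"
  using cinner_add_right[of x 0 0] by simp

lemma cinner_minus_left: "cinner (- x) y = - cinner x y"
  using cinner_add_left[of x "- x" y] by (simp add: cinner_zero_left eq_neg_iff_add_eq_0 add.commute)

lemma cinner_minus_right: "cinner x (- y) = - cinner x y"
  by (metis cinner_commute cinner_minus_left complex_cnj_minus)

lemma cinner_diff_left: "cinner (x - y) z = cinner x z - cinner y z"
  by (metis cinner_add_left cinner_minus_left diff_conv_add_uminus)

lemma cinner_diff_right: "cinner x (y - z) = cinner x y - cinner x z"
  by (metis cinner_add_right cinner_minus_right diff_conv_add_uminus)

lemma Re_cinner_commute: "Re (cinner y x) = Re (cinner x y)"
  using cinner_commute[of y x] by simp

lemma norm_add_square:
  fixes x y :: "'a::complex_inner"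
  shows "(norm (x + y))\<^sup>2 = (norm x)\<^sup>2 + (norm y)\<^sup>2 + 2 * Re (cinner x y)"
proof -
  have "complex_of_real ((norm (x + y))\<^sup>2) = cinner (x + y) (x + y)"
    by (rule cinner_norm[symmetric])
  also have "\<dots> = cinner x x + cinner y y + (cinner x y + cinner y x)"
    by (simp add: cinner_add_left cinner_add_right)
  finally have "Re (complex_of_real ((norm (x + y))\<^sup>2)) = Re \<dots>"
    by (rule arg_cong)
  then show ?thesis
    by (simp add: cinner_norm Re_cinner_commute)
qed

lemma norm_diff_square:
  fixes x y :: "'a::complex_inner"
  shows "(norm (x - y))\<^sup>2 = (norm x)\<^sup>2 + (norm y)\<^sup>2 - 2 * Re (cinner x y)"
  using norm_add_square[of x "- y"] by (simp add: cinner_minus_right)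

lemma norm_scaleC:
  fixes x :: "'a::complex_inner"
  shows "norm (scaleC c x) = cmod c * norm x"
proof -
  have "complex_of_real ((norm (scaleC c x))\<^sup>2) = c * cnj c * cinner x x"
    by (simp only: cinner_norm[symmetric] cinner_scaleC_left cinner_scaleC_right mult.commute mult.left_commute)
  also have "\<dots> = complex_of_real ((cmod c * norm x)\<^sup>2)"
    by (simp add: cinner_norm complex_norm_square[symmetric] power_mult_distrib)
  finally have "(norm (scaleC c x))\<^sup>2 = (cmod c * norm x)\<^sup>2"
    using of_real_eq_iff by blast
  then show ?thesis
    by (simp add: power2_eq_iff_nonneg)
qed

lemma scaleC_zero_left: "scaleC 0 x = 0"
  using norm_scaleC[of 0 x] by simp

lemma cinner_self_eq_0: "cinner x x = 0 \<longleftrightarrow> x = 0"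
  by (simp add: cinner_norm)

lemma Cauchy_Schwarz_cinner:
  fixes x y :: "'a::complex_inner"
  shows "cmod (cinner x y) \<le> norm x * norm y"
proof (cases "y = 0")
  case True
  then show ?thesis by (simp add: cinner_zero_right)
next
  case False
  define n where "n = (norm y)\<^sup>2"
  have n: "n > 0" using False by (simp add: n_def)
  define c where "c = cinner x y / of_real n"
  have "0 \<le> (norm (x - scaleC c y))\<^sup>2" by simp
  also have "\<dots> = (norm x)\<^sup>2 + (cmod c)\<^sup>2 * n - 2 * Re (cnj c * cinner x y)"
    by (simp add: norm_diff_square norm_scaleC power_mult_distrib n_def cinner_scaleC_right)
  also have "cnj c * cinner x y = of_real ((cmod (cinner x y))\<^sup>2 / n)"
    by (simp only: c_def of_real_divide complex_norm_square complex_cnj_divide complex_cnj_complex_of_real)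
      (simp add: mult.commute)
  also have "(cmod c)\<^sup>2 * n = (cmod (cinner x y))\<^sup>2 / n"
    using n by (simp add: c_def norm_divide power_divide power2_eq_square)
  finally have "(cmod (cinner x y))\<^sup>2 / n \<le> (norm x)\<^sup>2" by simp
  then have "(cmod (cinner x y))\<^sup>2 \<le> (norm x * norm y)\<^sup>2"
    using n by (simp add: field_simps n_def power_mult_distrib)
  then show ?thesis
    by (rule power2_le_imp_le) simp
qed

text \<open>Real scalars do not see the conjugation in the second slot, so real bilinearity holds
  and supplies the rules for sums, real multiples and limits.\<close>

interpretation cinner: bounded_bilinear "cinner :: 'a::complex_inner \<Rightarrow> 'a \<Rightarrow> complex"
proof
  show "\<exists>K. \<forall>a b :: 'a. norm (cinner a b) \<le> norm a * norm b * K"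
    by (rule exI[of _ 1]) (simp add: Cauchy_Schwarz_cinner)
qed (auto simp: cinner_add_left cinner_add_right scaleR_scaleC cinner_scaleC_left
    cinner_scaleC_right scaleR_conv_of_real)

interpretation scaleC: bounded_bilinear "scaleC :: complex \<Rightarrow> 'a::complex_inner \<Rightarrow> 'a"
proof
  show "\<exists>K. \<forall>a (b :: 'a). norm (scaleC a b) \<le> norm a * norm b * K"
    by (rule exI[of _ 1]) (simp add: norm_scaleC)
qed (auto simp: scaleC_add_left scaleC_add_right scaleR_scaleC scaleC_scaleC
    scaleR_conv_of_real mult.commute)

lemma norm_le_if_cinner_le:
  fixes x :: "'a::complex_inner"
  assumes "c \<ge> 0" and "\<And>w. cmod (cinner x w) \<le> c * norm w"
  shows "norm x \<le> c"
proof (cases "x = 0")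
  case False
  have "norm x * norm x \<le> c * norm x"
    using assms(2)[of x] by (simp add: cinner_norm power2_eq_square norm_mult)
  then show ?thesis using False by simp
qed (use assms in simp)

lemma cinner_eqI:
  fixes x y :: "'a::complex_inner"
  assumes "\<And>w. cinner x w = cinner y w"
  shows "x = y"
proof -
  have "cinner (x - y) (x - y) = 0"
    using assms[of "x - y"] by (simp add: cinner_diff_left)
  then show ?thesis by (simp add: cinner_self_eq_0)
qed

subsection \<open>Orthonormal systems\<close>

text \<open>Indexed, because \<open>tgm_gram\<close> needs an orthonormal family of rescaled images;
  a set of vectors is the case of the identity function. Finiteness is built in, so every expansion
  is a finite sum.\<close>

definition orthonormal :: "'i set \<Rightarrow> ('i \<Rightarrow> 'a::complex_inner) \<Rightarrow> bool" where
  "orthonormal I g \<longleftrightarrow>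
     finite I \<and> (\<forall>i\<in>I. \<forall>j\<in>I. cinner (g i) (g j) = (if i = j then 1 else 0))"

definition oproj :: "'a::complex_inner set \<Rightarrow> 'a \<Rightarrow> 'a" where
  "oproj E v = (\<Sum>e\<in>E. scaleC (cinner v e) e)"

lemma norm_sum_orthogonal_square:
  fixes g :: "'i \<Rightarrow> 'a::complex_inner"
  assumes "finite I" and "\<And>i j. i \<in> I \<Longrightarrow> j \<in> I \<Longrightarrow> i \<noteq> j \<Longrightarrow> cinner (g i) (g j) = 0"
  shows "(norm (\<Sum>i\<in>I. scaleC (c i) (g i)))\<^sup>2 = (\<Sum>i\<in>I. (cmod (c i))\<^sup>2 * (norm (g i))\<^sup>2)"
  using assms
proof (induction I rule: finite_induct)
  case (insert k I)
  have "cinner (scaleC (c k) (g k)) (\<Sum>i\<in>I. scaleC (c i) (g i)) = 0"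
    unfolding cinner.sum_right cinner_scaleC_left cinner_scaleC_right
    using insert.hyps insert.prems[of k] by (intro sum.neutral) auto
  then show ?case
    using insert by (simp add: norm_add_square norm_scaleC power_mult_distrib)
qed simp

lemma Bessel_inequality:
  assumes "orthonormal I g"
  shows "(\<Sum>i\<in>I. (cmod (cinner v (g i)))\<^sup>2) \<le> (norm v)\<^sup>2"
proof -
  define p where "p = (\<Sum>i\<in>I. scaleC (cinner v (g i)) (g i))"
  have fin: "finite I" and on: "\<And>i j. i \<in> I \<Longrightarrow> j \<in> I \<Longrightarrow> cinner (g i) (g j) = (if i = j then 1 else 0)"
    using assms by (auto simp: orthonormal_def)
  have g1: "(norm (g i))\<^sup>2 = 1" if "i \<in> I" for i
  proof -
    have "complex_of_real ((norm (g i))\<^sup>2) = 1"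
      using on[OF that that] by (simp only: cinner_norm) simp
    then show ?thesis by (simp only: of_real_eq_1_iff)
  qed
  have "cinner v p = of_real (\<Sum>i\<in>I. (cmod (cinner v (g i)))\<^sup>2)"
    unfolding p_def cinner.sum_right cinner_scaleC_right of_real_sum complex_norm_square
    by (simp add: mult.commute)
  moreover have "(norm p)\<^sup>2 = (\<Sum>i\<in>I. (cmod (cinner v (g i)))\<^sup>2)"
    unfolding p_def by (subst norm_sum_orthogonal_square[OF fin]) (auto simp: on g1)
  ultimately have "(norm (v - p))\<^sup>2 = (norm v)\<^sup>2 - (\<Sum>i\<in>I. (cmod (cinner v (g i)))\<^sup>2)"
    by (simp add: norm_diff_square)
  then show ?thesis
    by (metis diff_ge_0_iff_ge zero_le_power2)
qed

context
  fixes E :: "'a::complex_inner set"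
  assumes E: "orthonormal E (\<lambda>e. e)"
begin

lemma orthonormal_finite: "finite E"
  using E by (simp add: orthonormal_def)

lemma orthonormal_norm: "e \<in> E \<Longrightarrow> norm e = 1"
proof -
  assume "e \<in> E"
  then have "complex_of_real ((norm e)\<^sup>2) = 1"
    using E by (simp only: cinner_norm[symmetric]) (simp add: orthonormal_def)
  then show ?thesis
    by (metis norm_ge_zero of_real_eq_1_iff power2_eq_1_iff abs_of_nonneg abs_minus_cancel abs_1)
qed

lemma cinner_oproj: "f \<in> E \<Longrightarrow> cinner (oproj E v) f = cinner v f"
proof -
  assume f: "f \<in> E"
  have "cinner (oproj E v) f = (\<Sum>e\<in>E. cinner v e * cinner e f)"
    by (simp add: oproj_def cinner.sum_left cinner_scaleC_left)
  also have "\<dots> = (\<Sum>e\<in>E. if e = f then cinner v e else 0)"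
    using E f by (intro sum.cong) (auto simp: orthonormal_def)
  finally show ?thesis
    using f orthonormal_finite by simp
qed

lemma cinner_diff_oproj: "f \<in> E \<Longrightarrow> cinner (v - oproj E v) f = 0"
  by (simp add: cinner_diff_left cinner_oproj)

lemma norm_oproj_square_add: "(norm (v - oproj E v))\<^sup>2 + (norm (oproj E v))\<^sup>2 = (norm v)\<^sup>2"
proof -
  have "cinner (v - oproj E v) (oproj E v) = 0"
    by (subst (2) oproj_def)
      (auto simp: cinner.sum_right cinner_scaleC_right cinner_diff_oproj intro!: sum.neutral)
  then have "(norm (v - oproj E v + oproj E v))\<^sup>2 = (norm (v - oproj E v))\<^sup>2 + (norm (oproj E v))\<^sup>2"
    by (subst norm_add_square) simp
  then show ?thesis by simp
qed

lemma norm_diff_oproj_le: "norm (v - oproj E v) \<le> norm v"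
  by (rule power2_le_imp_le) (simp_all add: norm_oproj_square_add[of v, symmetric])

lemma norm_oproj_le: "norm (oproj E v) \<le> norm v"
  by (rule power2_le_imp_le) (simp_all add: norm_oproj_square_add[of v, symmetric])

text \<open>Turns smallness of finitely many coordinates, which is all that a weak neighbourhood
  controls, into smallness in norm, at the cost of a factor \<open>card E\<close>.\<close>

lemma norm_oproj_le_sum: "norm (oproj E v) \<le> (\<Sum>e\<in>E. cmod (cinner v e))"
  unfolding oproj_def
  by (rule order_trans[OF norm_sum]) (auto simp: norm_scaleC orthonormal_norm intro!: sum_mono)

end

text \<open>Being fixed by \<open>oproj E\<close> expresses membership in the complex span of
  \<open>E\<close>, whereas \<open>span\<close> would be taken over the reals.\<close>

lemma Gram_Schmidt:
  assumes "finite (F :: 'a::complex_inner set)"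
  obtains E where "orthonormal E (\<lambda>e. e)" and "\<And>f. f \<in> F \<Longrightarrow> oproj E f = f"
proof -
  have "\<exists>E. orthonormal E (\<lambda>e. e) \<and> (\<forall>f\<in>F. oproj E f = f)"
    using assms
  proof (induction F rule: finite_induct)
    case empty
    show ?case by (rule exI[of _ "{}"]) (simp add: orthonormal_def)
  next
    case (insert g F)
    then obtain E where E: "orthonormal E (\<lambda>e. e)" and F: "\<And>f. f \<in> F \<Longrightarrow> oproj E f = f"
      by auto
    define r where "r = g - oproj E g"
    show ?case
    proof (cases "r = 0")
      case True
      then show ?thesis using E F by (auto simp: r_def)
    next
      case False
      define e where "e = scaleC (of_real (inverse (norm r))) r"
      have rE: "cinner r f = 0" if "f \<in> E" for f
        using cinner_diff_oproj[OF E that] by (simp add: r_def)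
      have eE: "cinner e f = 0" "cinner f e = 0" if "f \<in> E" for f
        using rE[OF that] cinner_commute[of f r]
        by (auto simp: e_def cinner_scaleC_left cinner_scaleC_right)
      have ne: "norm e = 1"
        using False by (simp add: e_def norm_scaleC norm_inverse)
      then have ee: "cinner e e = 1"
        by (simp add: cinner_norm)
      then have enE: "e \<notin> E"
        using eE by force
      have on: "orthonormal (insert e E) (\<lambda>e. e)"
        using E enE eE ee by (auto simp: orthonormal_def)
      have step: "oproj (insert e E) v = scaleC (cinner v e) e + oproj E v" for v
        using enE orthonormal_finite[OF E] by (simp add: oproj_def)
      have orth: "cinner (oproj E v) e = 0" for v
        by (auto simp: oproj_def cinner.sum_left cinner_scaleC_left eE intro!: sum.neutral)
      have re: "r = scaleC (of_real (norm r)) e"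
        using False by (simp add: e_def scaleC_scaleC scaleC_one flip: of_real_mult)
      have "cinner g e = cinner r e"
        using orth[of g] by (simp add: r_def cinner_diff_left)
      also have "\<dots> = of_real (norm r)"
        by (subst re) (simp add: cinner_scaleC_left ee)
      finally have "oproj (insert e E) g = g"
        by (simp add: step re[symmetric]) (simp add: r_def)
      moreover have "oproj (insert e E) f = f" if "f \<in> F" for f
        using orth[of f] F[OF that] by (simp add: step scaleC_zero_left)
      ultimately show ?thesis
        using on by auto
    qed
  qed
  then show ?thesis using that by blast
qed

subsection \<open>Riesz representation and adjoints\<close>

lemma Riesz_representation:
  fixes \<phi> :: "'h::{complex_inner, complete_space} \<Rightarrow> complex"
  assumes lin: "bounded_linear \<phi>" and hom: "\<And>c x. \<phi> (scaleC c x) = c * \<phi> x"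
  obtains z where "\<And>x. \<phi> x = cinner x z"
proof -
  interpret \<phi>: bounded_linear \<phi> by fact
  obtain K where K: "\<And>x. norm (\<phi> x) \<le> norm x * K"
    using \<phi>.bounded by blast
  \<comment> \<open>The representing vector is the minimiser of \<open>J\<close>; minimising sequences are Cauchy by the
    parallelogram law.\<close>
  define J where "J x = (norm x)\<^sup>2 - 2 * Re (\<phi> x)" for x
  have Jbound: "- K\<^sup>2 \<le> J x" for x
  proof -
    have "Re (\<phi> x) \<le> norm x * K"
      using K[of x] complex_Re_le_cmod[of "\<phi> x"] by linarith
    then show ?thesis
      using zero_le_power2[of "norm x - K"] unfolding J_def power2_diff by linarith
  qed
  define m where "m = Inf (range J)"
  have bdd: "bdd_below (range J)"
    by (rule bdd_belowI2[OF Jbound])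
  have m_le: "m \<le> J x" for x
    unfolding m_def by (rule cInf_lower[OF _ bdd]) simp
  have par: "(norm (x - y))\<^sup>2 \<le> 2 * (J x - m) + 2 * (J y - m)" for x y
  proof -
    define h where "h = (1/2) *\<^sub>R (x + y)"
    have "norm h = norm (x + y) / 2" and "\<phi> h = (1/2) *\<^sub>R (\<phi> x + \<phi> y)"
      by (simp_all add: h_def \<phi>.scaleR \<phi>.add del: scaleR_add_right)
    then have "4 * J h = (norm (x + y))\<^sup>2 - 4 * Re (\<phi> x) - 4 * Re (\<phi> y)"
      unfolding J_def by (simp only:) (simp add: power_divide field_simps)
    moreover have "(norm (x + y))\<^sup>2 + (norm (x - y))\<^sup>2 = 2 * (norm x)\<^sup>2 + 2 * (norm y)\<^sup>2"
      by (simp add: norm_add_square norm_diff_square)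
    ultimately show ?thesis
      using m_le[of h] unfolding J_def by (simp add: algebra_simps)
  qed
  have "\<exists>x. J x < m + inverse (real (Suc n))" for n
    using cInf_lessD[of "range J" "m + inverse (real (Suc n))"] by (force simp: m_def)
  then obtain X where X: "\<And>n. J (X n) < m + inverse (real (Suc n))"
    by metis
  have "Cauchy X"
  proof (rule metric_CauchyI)
    fix e :: real assume e: "e > 0"
    then obtain N where N: "inverse (real (Suc N)) < e\<^sup>2 / 4"
      using reals_Archimedean[of "e\<^sup>2 / 4"] by auto
    have close: "J (X k) - m < e\<^sup>2 / 4" if "k \<ge> N" for k
    proof -
      have "inverse (real (Suc k)) \<le> inverse (real (Suc N))"
        using that by (intro le_imp_inverse_le) auto
      then show ?thesis using X[of k] N by linarith
    qed
    have "dist (X i) (X j) < e" if "i \<ge> N" "j \<ge> N" for i j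
    proof -
      have "(norm (X i - X j))\<^sup>2 < e\<^sup>2"
        using par[of "X i" "X j"] close[OF that(1)] close[OF that(2)] by argo
      then show ?thesis
        using e by (simp add: dist_norm power2_less_imp_less)
    qed
    then show "\<exists>N. \<forall>i\<ge>N. \<forall>j\<ge>N. dist (X i) (X j) < e" by blast
  qed
  then obtain z where z: "X \<longlonglongrightarrow> z"
    using Cauchy_convergent convergent_def by blast
  have "(\<lambda>n. J (X n)) \<longlonglongrightarrow> J z"
    unfolding J_def by (intro tendsto_intros z \<phi>.tendsto)
  moreover have "(\<lambda>n. m + inverse (real (Suc n))) \<longlonglongrightarrow> m + 0"
    by (intro tendsto_intros LIMSEQ_inverse_real_of_nat)
  ultimately have "J z \<le> m + 0"
    using X by (intro LIMSEQ_le[of "\<lambda>n. J (X n)"]) (auto intro: less_imp_le)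
  then have min: "J z \<le> J y" for y
    using m_le[of y] by simp
  have Re_eq: "Re (\<phi> w) = Re (cinner z w)" for w
  proof -
    define d where "d = Re (cinner z w) - Re (\<phi> w)"
    have quad: "0 \<le> t\<^sup>2 * (norm w)\<^sup>2 + 2 * t * d" for t :: real
      using min[of "z + t *\<^sub>R w"] unfolding J_def d_def
      by (simp add: norm_add_square \<phi>.add \<phi>.scaleR cinner.scaleR_right power_mult_distrib algebra_simps)
    \<comment> \<open>The step t = - d / N brings the quadratic polynomial down to at most - d^2 /
      N; the summand 1 keeps N positive when w = 0.\<close>
    define N where "N = (norm w)\<^sup>2 + 1"
    have N: "N > 0" by (simp add: N_def add_nonneg_pos)
    have "0 \<le> (- d / N)\<^sup>2 * (norm w)\<^sup>2 + 2 * (- d / N) * d" by (rule quad)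
    also have "\<dots> \<le> (- d / N)\<^sup>2 * N + 2 * (- d / N) * d"
      by (simp add: N_def mult_left_mono)
    also have "\<dots> = - (d\<^sup>2 / N)"
      using N by (simp add: field_simps power2_eq_square)
    finally have "d\<^sup>2 / N \<le> 0" by simp
    then have "d = 0"
      using N by (simp add: divide_le_0_iff)
    then show ?thesis by (simp add: d_def)
  qed
  have "\<phi> x = cinner x z" for x
  proof (rule complex_eqI)
    show "Re (\<phi> x) = Re (cinner x z)"
      by (simp add: Re_eq Re_cinner_commute)
    \<comment> \<open>Replacing x by i x turns real parts into negated imaginary parts, so equality
      of real parts for all vectors gives full equality.\<close>
    have "Re (\<phi> (scaleC \<i> x)) = Re (cinner (scaleC \<i> x) z)"
      using Re_eq[of "scaleC \<i> x"] Re_cinner_commute[of z "scaleC \<i> x"] by simp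
    then show "Im (\<phi> x) = Im (cinner x z)"
      by (simp add: hom cinner_scaleC_left)
  qed
  then show ?thesis by (rule that)
qed

lemma BH_scaleC: "x \<in> BH \<Longrightarrow> blinfun_apply x (scaleC c v) = scaleC c (blinfun_apply x v)"
  by (simp add: BH_def)

text \<open>\<open>cadjoint\<close> is a definite description: Riesz representation of the
  functionals <a x, y> in x gives existence, nondegeneracy of the inner product gives
  uniqueness.\<close>

lemma cinner_cadjoint:
  fixes a :: "'h::{complex_inner, complete_space} \<Rightarrow>\<^sub>L 'h"
  assumes "a \<in> BH"
  shows "cinner (blinfun_apply a x) y = cinner x (cadjoint a y)"
proof -
  have "\<exists>z. \<forall>x. cinner (blinfun_apply a x) y = cinner x z" for y
  proof -
    obtain z where "\<And>x. cinner (blinfun_apply a x) y = cinner x z"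
      by (rule Riesz_representation[of "\<lambda>x. cinner (blinfun_apply a x) y"])
        (auto simp: BH_scaleC[OF assms] cinner_scaleC_left
          intro: bounded_linear_compose[OF cinner.bounded_linear_left blinfun.bounded_linear_right])
    then show ?thesis by blast
  qed
  then obtain d where d: "\<forall>x y. cinner (blinfun_apply a x) y = cinner x (d y)"
    by metis
  have "\<forall>x y. cinner (blinfun_apply a x) y = cinner x (cadjoint a y)"
    unfolding cadjoint_def
  proof (rule theI[of _ d])
    fix d' assume d': "\<forall>x y. cinner (blinfun_apply a x) y = cinner x (d' y)"
    have "d' y = d y" for y
    proof (rule cinner_eqI)
      show "cinner (d' y) w = cinner (d y) w" for w
        using d d' cinner_commute by metis
    qed
    then show "d' = d" by blast
  qed (fact d)
  then show ?thesis by blast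
qed

section \<open>Positive semidefinite matrices\<close>

text \<open>The inner products on \<open>complex\<close> and on vectors must reproduce the library
  norms, as \<open>complex_inner\<close> extends \<open>real_normed_vector\<close>; the lemmas on
  orthonormal systems then apply verbatim to \<open>complex^'n\<close>.\<close>

instantiation complex :: complex_inner
begin

definition scaleC_complex :: "complex \<Rightarrow> complex \<Rightarrow> complex" where
  "scaleC_complex c z = c * z"

definition cinner_complex :: "complex \<Rightarrow> complex \<Rightarrow> complex" where
  "cinner_complex x y = x * cnj y"

instance
  by standard (simp_all add: scaleC_complex_def cinner_complex_def algebra_simps
      scaleR_conv_of_real complex_norm_square del: of_real_power)

end

instantiation vec :: (complex_inner, finite) complex_inner
begin

definition scaleC_vec :: "complex \<Rightarrow> 'a^'b \<Rightarrow> 'a^'b" where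
  "scaleC_vec c x = (\<chi> i. scaleC c (x $ i))"

definition cinner_vec :: "'a^'b \<Rightarrow> 'a^'b \<Rightarrow> complex" where
  "cinner_vec x y = (\<Sum>i\<in>UNIV. cinner (x $ i) (y $ i))"

instance
proof
  fix x y :: "'a^'b"
  show "cinner y x = cnj (cinner x y)"
    unfolding cinner_vec_def cnj_sum by (rule sum.cong[OF refl]) (rule cinner_commute)
  show "cinner x x = complex_of_real ((norm x)\<^sup>2)"
    by (simp add: cinner_vec_def norm_vec_def L2_set_def cinner_norm sum_nonneg flip: of_real_power)
qed (simp_all add: vec_eq_iff scaleC_vec_def cinner_vec_def scaleC_add_right scaleC_add_left
    scaleC_scaleC scaleC_one scaleR_scaleC cinner_add_left cinner_scaleC_left sum.distrib
    sum_distrib_left)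

end

lemma scaleC_vec_nth [simp]: "scaleC c x $ i = scaleC c (x $ i)"
  by (simp add: scaleC_vec_def)

text \<open>The passage to the real inner product, through which continuity, independence of
  orthogonal sets and orthogonal complements are imported.\<close>

lemma inner_eq_Re_cinner:
  fixes x y :: "complex^'n"
  shows "x \<bullet> y = Re (cinner x y)"
  by (simp add: inner_vec_def cinner_vec_def cinner_complex_def inner_complex_def)

definition clinear :: "('a::complex_inner \<Rightarrow> 'b::complex_inner) \<Rightarrow> bool" where
  "clinear L \<longleftrightarrow> (\<forall>x y. L (x + y) = L x + L y) \<and> (\<forall>c x. L (scaleC c x) = scaleC c (L x))"

lemma clinear_id: "clinear (\<lambda>x. x)"
  by (simp add: clinear_def)

lemma clinear_scaleC: "clinear L \<Longrightarrow> L (scaleC c x) = scaleC c (L x)"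
  by (simp add: clinear_def)

lemma clinear_zero: "clinear L \<Longrightarrow> L 0 = 0"
  using clinear_scaleC[of L 0 0] by (simp add: scaleC_zero_left)

lemma clinear_sum:
  assumes "clinear L"
  shows "L (\<Sum>i\<in>I. scaleC (c i) (g i)) = (\<Sum>i\<in>I. scaleC (c i) (L (g i)))"
proof (induction I rule: infinite_finite_induct)
  case (insert i I)
  then show ?case using assms by (simp add: clinear_def)
qed (simp_all add: clinear_zero[OF assms])

lemma clinear_matrix_vector_mult: "clinear ((*v) (M :: complex^'n^'m))"
  by (simp add: clinear_def vec_eq_iff matrix_vector_mult_def scaleC_complex_def
      sum_distrib_left algebra_simps sum.distrib)

lemma vec_eq_sum_axis:
  fixes x :: "complex^'n"
  shows "x = (\<Sum>j\<in>UNIV. scaleC (x $ j) (axis j 1))"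
  by (simp add: vec_eq_iff scaleC_complex_def axis_def if_distrib cong: if_cong)

lemma cinner_axis_right:
  fixes x :: "complex^'n"
  shows "cinner x (axis j 1) = x $ j"
proof -
  have "cinner x (axis j 1) = (\<Sum>i\<in>UNIV. if i = j then x $ i else 0)"
    unfolding cinner_vec_def by (rule sum.cong) (auto simp: axis_def cinner_complex_def)
  then show ?thesis by simp
qed

lemma cinner_axis_left:
  fixes x :: "complex^'n"
  shows "cinner (axis j 1) x = cnj (x $ j)"
  by (subst cinner_commute) (simp add: cinner_axis_right)

lemma matrix_vector_mult_axis_nth:
  fixes M :: "complex^'n^'m"
  shows "(M *v axis j 1) $ i = M $ i $ j"
  by (simp add: matrix_vector_mult_def axis_def if_distrib cong: if_cong)

definition selfadjoint_mat :: "complex^'n^'n \<Rightarrow> bool" where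
  "selfadjoint_mat M \<longleftrightarrow> (\<forall>x y. cinner (M *v x) y = cinner x (M *v y))"

lemma selfadjoint_matD: "selfadjoint_mat M \<Longrightarrow> cinner (M *v x) y = cinner x (M *v y)"
  by (simp add: selfadjoint_mat_def)

lemma selfadjoint_mat_iff: "selfadjoint_mat M \<longleftrightarrow> (\<forall>i j. M $ i $ j = cnj (M $ j $ i))"
proof
  assume M: "selfadjoint_mat M"
  show "\<forall>i j. M $ i $ j = cnj (M $ j $ i)"
  proof (intro allI)
    fix i j
    show "M $ i $ j = cnj (M $ j $ i)"
      using selfadjoint_matD[OF M, of "axis j 1" "axis i 1"]
      by (simp add: cinner_axis_right cinner_axis_left matrix_vector_mult_axis_nth)
  qed
next
  assume M: "\<forall>i j. M $ i $ j = cnj (M $ j $ i)"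
  have "cinner (M *v x) y = cinner x (M *v y)" for x y
  proof -
    have "cinner (M *v x) y = (\<Sum>i\<in>UNIV. \<Sum>j\<in>UNIV. M $ i $ j * x $ j * cnj (y $ i))"
      by (simp add: cinner_vec_def cinner_complex_def matrix_vector_mult_def sum_distrib_right)
    also have "\<dots> = (\<Sum>j\<in>UNIV. \<Sum>i\<in>UNIV. x $ j * cnj (M $ j $ i * y $ i))"
    proof (subst sum.swap, intro sum.cong refl)
      fix i j
      show "M $ i $ j * x $ j * cnj (y $ i) = x $ j * cnj (M $ j $ i * y $ i)"
        using M[rule_format, of i j] by (simp only: complex_cnj_mult mult.commute mult.left_commute)
    qed
    also have "\<dots> = cinner x (M *v y)"
      by (simp add: cinner_vec_def cinner_complex_def matrix_vector_mult_def sum_distrib_left)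
    finally show ?thesis .
  qed
  then show "selfadjoint_mat M" by (simp add: selfadjoint_mat_def)
qed

text \<open>The double sum in \<open>psd_mat\<close> is the form <M v, v>, and for self-adjoint M
  its value equals its own conjugate, hence is real. Later arguments use only forms, never
  entries.\<close>

lemma psd_mat_iff:
  "psd_mat M \<longleftrightarrow> selfadjoint_mat M \<and> (\<forall>x. 0 \<le> Re (cinner (M *v x) x))"
proof -
  have q: "(\<Sum>i\<in>UNIV. \<Sum>j\<in>UNIV. cnj (v $ i) * M $ i $ j * v $ j) = cinner (M *v v) v" for v
    by (simp add: cinner_vec_def cinner_complex_def matrix_vector_mult_def sum_distrib_left
        sum_distrib_right mult.commute mult.left_commute)
  have Im: "Im (cinner (M *v x) x) = 0" if "selfadjoint_mat M" for x
  proof -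
    have "cinner (M *v x) x = cnj (cinner (M *v x) x)"
      using cinner_commute[of "M *v x" x] selfadjoint_matD[OF that, of x x] by simp
    then show ?thesis
      by (metis complex_cnj_cancel_iff complex_is_Real_iff Reals_cnj_iff)
  qed
  show ?thesis
    unfolding psd_mat_def q Let_def selfadjoint_mat_iff[symmetric] using Im by blast
qed

lemma psd_mat_selfadjoint: "psd_mat M \<Longrightarrow> selfadjoint_mat M"
  by (simp add: psd_mat_iff)

subsection \<open>The spectral theorem\<close>

text \<open>Completeness is encoded as \<open>oproj E v = v\<close>. The eigenvalue is a function of
  the vector, so multiplicities need no bookkeeping.\<close>

definition eigenbasis :: "complex^'n^'n \<Rightarrow> (complex^'n) set \<Rightarrow> (complex^'n \<Rightarrow> real) \<Rightarrow> bool" where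
  "eigenbasis M E \<sigma> \<longleftrightarrow> orthonormal E (\<lambda>e. e) \<and> (\<forall>v. oproj E v = v) \<and>
     (\<forall>e\<in>E. M *v e = scaleC (of_real (\<sigma> e)) e)"

text \<open>A maximiser w of the Rayleigh quotient on the unit sphere of C is an eigenvector:
  otherwise moving from w in the direction of the residual M w - \<mu> w would increase the
  quotient. The maximum \<mu> is real, so a real subspace C contains the residual and the whole
  line.\<close>

lemma eigenvector_in_invariant_subspace:
  fixes M :: "complex^'n^'n" and C :: "(complex^'n) set"
  assumes M: "selfadjoint_mat M" and C: "subspace C" and inv: "\<And>w. w \<in> C \<Longrightarrow> M *v w \<in> C"
    and x: "x \<in> C" "x \<noteq> 0"
  obtains w \<mu> where "w \<in> C" "norm w = 1" "M *v w = scaleC (of_real \<mu>) w"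
proof -
  define K where "K = C \<inter> sphere 0 1"
  have "compact K"
    unfolding K_def by (intro closed_Int_compact closed_subspace C) simp
  moreover have "(1 / norm x) *\<^sub>R x \<in> K"
    using x C by (simp add: K_def subspace_scale)
  moreover have cont: "continuous_on K (\<lambda>w. Re (cinner (M *v w) w))"
    unfolding inner_eq_Re_cinner[symmetric]
    by (intro continuous_intros matrix_vector_mult_linear_continuous_on)
  ultimately obtain w where w: "w \<in> K"
    and max: "\<And>v. v \<in> K \<Longrightarrow> Re (cinner (M *v v) v) \<le> Re (cinner (M *v w) w)"
    using continuous_attains_sup[of K "\<lambda>w. Re (cinner (M *v w) w)"] by blast
  define \<mu> where "\<mu> = Re (cinner (M *v w) w)"
  have w1: "w \<in> C" "norm w = 1" using w by (auto simp: K_def)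
  define q where "q v = Re (cinner (M *v v) v) - \<mu> * (norm v)\<^sup>2" for v
  have Mr: "M *v (r *\<^sub>R v) = r *\<^sub>R (M *v v)" for r v
    by (simp add: scaleR_scaleC clinear_scaleC[OF clinear_matrix_vector_mult])
  have q_le: "q v \<le> 0" if "v \<in> C" for v
  proof (cases "v = 0")
    case False
    define n where "n = norm v"
    have n: "n > 0" using False by (simp add: n_def)
    have "(1 / n) *\<^sub>R v \<in> K"
      using that False C by (simp add: K_def n_def subspace_scale)
    then have "(1 / n) * ((1 / n) * Re (cinner (M *v v) v)) \<le> \<mu>"
      using max unfolding \<mu>_def by (fastforce simp: Mr cinner.scaleR_left cinner.scaleR_right)
    then show ?thesis
      using n by (simp add: q_def n_def[symmetric] field_simps power2_eq_square)
  qed (simp add: q_def cinner_zero_right)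
  define h where "h = M *v w - scaleC (of_real \<mu>) w"
  have hC: "h \<in> C"
    unfolding h_def scaleR_scaleC[symmetric] using inv w1 C by (simp add: subspace_diff subspace_scale)
  have "Re (cinner (M *v w) h) - \<mu> * Re (cinner w h) = Re (cinner h h)"
    by (subst (3) h_def) (simp add: cinner_diff_left cinner_scaleC_left)
  then have q_line: "q (w + t *\<^sub>R h) = 2 * t * (norm h)\<^sup>2 + t\<^sup>2 * q h" for t
  proof -
    assume *: "Re (cinner (M *v w) h) - \<mu> * Re (cinner w h) = Re (cinner h h)"
    have "Re (cinner (M *v h) w) = Re (cinner (M *v w) h)"
      using selfadjoint_matD[OF M, of h w] Re_cinner_commute[of h "M *v w"] by simp
    then have "q (w + t *\<^sub>R h) = q w + 2 * t * (Re (cinner (M *v w) h) - \<mu> * Re (cinner w h)) + t\<^sup>2 * q h"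
      unfolding q_def norm_add_square
      by (simp add: matrix_vector_right_distrib Mr cinner_add_left cinner_add_right
          cinner.scaleR_left cinner.scaleR_right power_mult_distrib algebra_simps power2_eq_square)
    moreover have "q w = 0"
      using w1 by (simp add: q_def \<mu>_def)
    ultimately show ?thesis
      unfolding * by (simp add: cinner_norm)
  qed
  \<comment> \<open>For t = s / N the quadratic term is at least - s^2 / N, while the linear term is
    2 s^2 / N; since q is nonpositive on C, s must vanish.\<close>
  define N where "N = \<bar>q h\<bar> + 1"
  have N: "N > 0" by (simp add: N_def add_nonneg_pos)
  define s where "s = (norm h)\<^sup>2"
  have "2 * (s / N) * s + (s / N)\<^sup>2 * q h \<le> 0"
    using q_le[of "w + (s / N) *\<^sub>R h"] q_line[of "s / N"] w1 hC C
    by (simp add: s_def subspace_add subspace_scale)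
  moreover have "(s / N)\<^sup>2 * (- N) \<le> (s / N)\<^sup>2 * q h"
    by (rule mult_left_mono) (auto simp: N_def)
  ultimately have "2 * (s / N) * s - (s / N)\<^sup>2 * N \<le> 0" by simp
  moreover have "2 * (s / N) * s - (s / N)\<^sup>2 * N = s\<^sup>2 / N"
    using N by (simp add: field_simps power2_eq_square)
  ultimately have "s\<^sup>2 / N \<le> 0" by linarith
  then have "s = 0"
    using N by (simp add: divide_le_0_iff)
  then have "M *v w = scaleC (of_real \<mu>) w"
    by (simp add: s_def h_def)
  then show ?thesis using that w1 by blast
qed

text \<open>Takes an orthonormal set of eigenvectors of greatest cardinality. If it were incomplete,
  its orthogonal complement would be a nonzero invariant subspace and contribute one more
  eigenvector.\<close>

lemma spectral_theorem:
  fixes M :: "complex^'n^'n"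
  assumes M: "selfadjoint_mat M"
  obtains E \<sigma> where "eigenbasis M E \<sigma>"
proof -
  define P where "P E \<longleftrightarrow> orthonormal E (\<lambda>e. e) \<and> (\<forall>e\<in>E. \<exists>\<sigma>::real. M *v e = scaleC (of_real \<sigma>) e)"
    for E :: "(complex^'n) set"
  have card: "card E < Suc (DIM(complex^'n))" if "P E" for E
  proof -
    \<comment> \<open>Complex orthogonality implies real orthogonality, so the real dimension bounds
      the cardinality; any finite bound is enough for a maximum to exist.\<close>
    have "pairwise orthogonal E"
      using that by (simp add: P_def orthonormal_def pairwise_def orthogonal_def inner_eq_Re_cinner)
    moreover have "0 \<notin> E"
      using that orthonormal_norm unfolding P_def by fastforce
    ultimately have "independent E"
      by (rule pairwise_orthogonal_independent)
    then show ?thesis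
      using independent_bound[of E] by (simp add: less_Suc_eq_le)
  qed
  have "P {}" by (simp add: P_def orthonormal_def)
  then obtain E where E: "P E" and max: "\<And>E'. P E' \<Longrightarrow> card E' \<le> card E"
    using ex_has_greatest_nat[of P "{}" card "Suc (DIM(complex^'n))"] card by blast
  have on: "orthonormal E (\<lambda>e. e)" using E by (simp add: P_def)
  have "oproj E v = v" for v
  proof (rule ccontr)
    assume v: "oproj E v \<noteq> v"
    define C where "C = {w. \<forall>e\<in>E. cinner w e = 0}"
    have "subspace C"
      by (simp add: C_def subspace_def cinner_add_left cinner.scaleR_left cinner_zero_left)
    moreover have "M *v w \<in> C" if "w \<in> C" for w
      using that E by (force simp: C_def P_def selfadjoint_matD[OF M] cinner_scaleC_right)
    moreover have "v - oproj E v \<in> C"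
      by (simp add: C_def cinner_diff_oproj[OF on])
    ultimately obtain w \<mu> where w: "w \<in> C" "norm w = 1" "M *v w = scaleC (of_real \<mu>) w"
      using eigenvector_in_invariant_subspace[OF M, of C "v - oproj E v"] v by auto
    have "cinner w w = 1"
      using w(2) by (simp add: cinner_norm)
    moreover have "cinner e w = 0" if "e \<in> E" for e
      using w(1) that cinner_commute[of e w] by (simp add: C_def)
    ultimately have "P (insert w E)" and "w \<notin> E"
      using E w by (auto simp: P_def orthonormal_def C_def)
    then show False
      using max[of "insert w E"] orthonormal_finite[OF on] by simp
  qed
  moreover obtain \<sigma> where "\<forall>e\<in>E. M *v e = scaleC (of_real (\<sigma> e)) e"
    using E unfolding P_def by metis
  ultimately show ?thesis
    using that[of E \<sigma>] on by (simp add: eigenbasis_def)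
qed

lemma eigenbasis_nonneg:
  assumes "psd_mat M" and "eigenbasis M E \<sigma>" and "e \<in> E"
  shows "0 \<le> \<sigma> e"
proof -
  have "cinner e e = 1"
    using assms by (simp add: eigenbasis_def orthonormal_def)
  then have "cinner (M *v e) e = of_real (\<sigma> e)"
    using assms by (simp add: eigenbasis_def cinner_scaleC_left)
  then show ?thesis
    using assms(1) by (metis psd_mat_iff Re_complex_of_real)
qed

lemma clinear_eq_on_eigenbasis:
  assumes "eigenbasis M E \<sigma>" and "clinear L" and "clinear L'" and "\<And>e. e \<in> E \<Longrightarrow> L e = L' e"
  shows "L v = L' v"
proof -
  have v: "v = (\<Sum>e\<in>E. scaleC (cinner v e) e)"
    using assms(1) by (simp add: eigenbasis_def oproj_def)
  show ?thesis
    by (subst (1 2) v) (simp add: clinear_sum[OF assms(2)] clinear_sum[OF assms(3)] assms(4))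
qed

lemma matrix_eq_on_eigenbasis:
  assumes "eigenbasis M E \<sigma>" and "\<And>e. e \<in> E \<Longrightarrow> A *v e = B *v e"
  shows "A = (B :: complex^'n^'n)"
  unfolding matrix_eq
  using clinear_eq_on_eigenbasis[OF assms(1) clinear_matrix_vector_mult clinear_matrix_vector_mult]
    assms(2) by blast

lemma psd_sqrt_exists:
  assumes M: "psd_mat (M :: complex^'n^'n)"
  obtains P where "psd_mat P" "P ** P = M"
proof -
  obtain E \<sigma> where E: "eigenbasis M E \<sigma>"
    using spectral_theorem[OF psd_mat_selfadjoint[OF M]] by blast
  have on: "orthonormal E (\<lambda>e. e)" using E by (simp add: eigenbasis_def)
  define P :: "complex^'n^'n"
    where "P = (\<chi> i j. \<Sum>e\<in>E. of_real (sqrt (\<sigma> e)) * e $ i * cnj (e $ j))"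
  have Pv: "P *v v = (\<Sum>e\<in>E. scaleC (of_real (sqrt (\<sigma> e)) * cinner v e) e)" for v
    unfolding vec_eq_iff
  proof
    fix i
    have "(P *v v) $ i = (\<Sum>j\<in>UNIV. \<Sum>e\<in>E. of_real (sqrt (\<sigma> e)) * e $ i * cnj (e $ j) * v $ j)"
      by (simp add: P_def matrix_vector_mult_def sum_distrib_right)
    also have "\<dots> = (\<Sum>e\<in>E. of_real (sqrt (\<sigma> e)) * cinner v e * e $ i)"
      by (subst sum.swap) (simp add: cinner_vec_def cinner_complex_def sum_distrib_left
          sum_distrib_right mult.commute mult.left_commute)
    finally show "(P *v v) $ i = (\<Sum>e\<in>E. scaleC (of_real (sqrt (\<sigma> e)) * cinner v e) e) $ i"
      by (simp add: scaleC_complex_def)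
  qed
  have form: "cinner (P *v v) w = (\<Sum>e\<in>E. of_real (sqrt (\<sigma> e)) * (cinner v e * cnj (cinner w e)))" for v w
    unfolding Pv cinner.sum_left cinner_scaleC_left
    by (intro sum.cong refl) (metis cinner_commute mult.assoc)
  have "psd_mat P"
    unfolding psd_mat_iff
  proof (intro conjI allI)
    have "cinner (P *v v) w = cinner v (P *v w)" for v w
      by (subst cinner_commute[of v "P *v w"]) (simp add: form mult.commute)
    then show "selfadjoint_mat P" by (simp add: selfadjoint_mat_def)
    show "0 \<le> Re (cinner (P *v x) x)" for x
      unfolding form using eigenbasis_nonneg[OF M E]
      by (auto intro!: sum_nonneg simp: complex_norm_square[symmetric])
  qed
  moreover have "P ** P = M"
  proof (rule matrix_eq_on_eigenbasis[OF E])
    fix e assume e: "e \<in> E"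
    have "P *v e = (\<Sum>f\<in>E. if f = e then scaleC (of_real (sqrt (\<sigma> e))) e else 0)"
      unfolding Pv using on e
      by (intro sum.cong) (auto simp: orthonormal_def scaleC_zero_left)
    then have Pe: "P *v e = scaleC (of_real (sqrt (\<sigma> e))) e"
      using e orthonormal_finite[OF on] by simp
    have "(P ** P) *v e = P *v (P *v e)"
      by (simp add: matrix_vector_mul_assoc)
    also have "\<dots> = scaleC (of_real (sqrt (\<sigma> e)) * of_real (sqrt (\<sigma> e))) e"
      by (simp add: Pe clinear_scaleC[OF clinear_matrix_vector_mult] scaleC_scaleC)
    also have "\<dots> = M *v e"
      using E e eigenbasis_nonneg[OF M E e] by (simp add: eigenbasis_def flip: of_real_mult)
    finally show "(P ** P) *v e = M *v e" .
  qed
  ultimately show ?thesis by (rule that)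
qed

text \<open>Every positive semidefinite root R is determined on an eigenvector e of M: with r the
  root of the eigenvalue and w = R e - r e one has R w = - r w, and positivity forces r = 0 or w =
  0.\<close>

lemma psd_sqrt_unique:
  assumes M: "psd_mat M" and P: "psd_mat P" "P ** P = M" and Q: "psd_mat Q" "Q ** Q = M"
  shows "P = (Q :: complex^'n^'n)"
proof -
  obtain E \<sigma> where E: "eigenbasis M E \<sigma>"
    using spectral_theorem[OF psd_mat_selfadjoint[OF M]] by blast
  have eig: "R *v e = scaleC (of_real (sqrt (\<sigma> e))) e"
    if R: "psd_mat R" "R ** R = M" and e: "e \<in> E" for R e
  proof -
    define r where "r = sqrt (\<sigma> e)"
    have r: "r \<ge> 0" "\<sigma> e = r * r"
      using eigenbasis_nonneg[OF M E e] by (simp_all add: r_def)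
    have RR: "R *v (R *v e) = scaleC (of_real (r * r)) e"
      using E e R(2) r(2) by (simp add: matrix_vector_mul_assoc eigenbasis_def)
    note sc = clinear_scaleC[OF clinear_matrix_vector_mult]
    define w where "w = R *v e - scaleC (of_real r) e"
    have "R *v w = scaleC (- of_real r) w"
      by (simp add: w_def matrix_vector_mult_diff_distrib sc RR scaleC.diff_right scaleC_scaleC
          scaleC.minus_left)
    then have "cinner (R *v w) w = - of_real (r * (norm w)\<^sup>2)"
      by (simp add: cinner_scaleC_left cinner_norm)
    then have "r * (norm w)\<^sup>2 \<le> 0"
      using R(1) by (metis psd_mat_iff Re_complex_of_real neg_0_le_iff_le of_real_minus)
    moreover have "r * (norm w)\<^sup>2 \<ge> 0" using r by simp
    ultimately have "r = 0 \<or> w = 0" by auto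
    \<comment> \<open>For r = 0 the sign argument says nothing; self-adjointness gives ||R e||^2 =
      <R R e, e> = 0 instead.\<close>
    moreover have "w = 0" if "r = 0"
    proof -
      have "cinner (R *v e) (R *v e) = cinner (R *v (R *v e)) e"
        using selfadjoint_matD[OF psd_mat_selfadjoint[OF R(1)]] by metis
      then show ?thesis
        using that RR by (simp add: w_def scaleC_zero_left cinner_zero_left cinner_self_eq_0)
    qed
    ultimately show ?thesis by (auto simp: w_def r_def)
  qed
  show ?thesis
    by (rule matrix_eq_on_eigenbasis[OF E]) (simp add: eig P Q)
qed

lemma msqrt:
  assumes "psd_mat (M :: complex^'n^'n)"
  shows "psd_mat (msqrt M)" and "msqrt M ** msqrt M = M"
proof -
  obtain P where P: "psd_mat P" "P ** P = M"
    using psd_sqrt_exists[OF assms] by blast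
  have "psd_mat (msqrt M) \<and> msqrt M ** msqrt M = M"
    unfolding msqrt_def
  proof (rule theI[of _ P])
    show "Q = P" if "psd_mat Q \<and> Q ** Q = M" for Q
      using psd_sqrt_unique[OF assms] that P by blast
  qed (use P in blast)
  then show "psd_mat (msqrt M)" and "msqrt M ** msqrt M = M" by auto
qed

subsection \<open>The geometric mean of two Gram matrices\<close>

text \<open>Basis independence and cyclicity of the trace in one identity: with V' the adjoint of V,
  the left side is tr (S V' L) in the standard basis and the right side is tr (V' L S) in the basis
  W.\<close>

lemma sum_cinner_axis_eq:
  fixes S :: "complex^'n^'n" and L V :: "complex^'n \<Rightarrow> 'a::complex_inner"
  assumes S: "selfadjoint_mat S" and W: "eigenbasis R W \<rho>" and L: "clinear L" and V: "clinear V"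
  shows "(\<Sum>j\<in>UNIV. cinner (L (axis j 1)) (V (S *v axis j 1))) = (\<Sum>w\<in>W. cinner (L (S *v w)) (V w))"
proof -
  have "cinner (L (axis j 1)) (V (S *v axis j 1))
      = (\<Sum>w\<in>W. (S *v w) $ j * cinner (L (axis j 1)) (V w))" for j
  proof -
    have "S *v axis j 1 = (\<Sum>w\<in>W. scaleC (cinner (S *v axis j 1) w) w)"
      using W by (simp add: eigenbasis_def oproj_def)
    also have "\<dots> = (\<Sum>w\<in>W. scaleC (cnj ((S *v w) $ j)) w)"
      by (simp add: selfadjoint_matD[OF S] cinner_axis_left)
    finally have e: "S *v axis j 1 = (\<Sum>w\<in>W. scaleC (cnj ((S *v w) $ j)) w)" .
    show ?thesis
      unfolding e clinear_sum[OF V] by (simp add: cinner.sum_right cinner_scaleC_right)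
  qed
  then have "(\<Sum>j\<in>UNIV. cinner (L (axis j 1)) (V (S *v axis j 1)))
      = (\<Sum>w\<in>W. \<Sum>j\<in>UNIV. (S *v w) $ j * cinner (L (axis j 1)) (V w))"
    by (subst sum.swap) simp
  also have "\<dots> = (\<Sum>w\<in>W. cinner (\<Sum>j\<in>UNIV. scaleC ((S *v w) $ j) (L (axis j 1))) (V w))"
    by (simp add: cinner.sum_left cinner_scaleC_left)
  also have "\<dots> = (\<Sum>w\<in>W. cinner (L (S *v w)) (V w))"
    by (simp add: clinear_sum[OF L, symmetric] vec_eq_sum_axis[symmetric])
  finally show ?thesis .
qed

lemma trace_eq_sum_eigenvalues:
  fixes R :: "complex^'n^'n"
  assumes R: "selfadjoint_mat R" and W: "eigenbasis R W \<rho>"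
  shows "trace R = of_real (\<Sum>w\<in>W. \<rho> w)"
proof -
  have "trace R = (\<Sum>j\<in>UNIV. cinner (R *v axis j 1) (axis j 1))"
    by (simp add: trace_def cinner_axis_right matrix_vector_mult_axis_nth)
  also have "\<dots> = (\<Sum>j\<in>UNIV. cinner (axis j 1) (R *v axis j 1))"
    by (simp add: selfadjoint_matD[OF R])
  also have "\<dots> = (\<Sum>w\<in>W. cinner (R *v w) w)"
    by (rule sum_cinner_axis_eq[OF R W clinear_id clinear_id])
  also have "\<dots> = of_real (\<Sum>w\<in>W. \<rho> w)"
    using W by (simp add: eigenbasis_def orthonormal_def cinner_scaleC_left)
  finally show ?thesis .
qed

text \<open>Polar decomposition A = V S. On an eigenvector e of S with eigenvalue \<sigma> e, V must
  be A e / \<sigma> e; equality of the Gram forms makes these vectors orthogonal with norm at most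
  1.\<close>

lemma partial_isometry_of_equal_Gram:
  fixes S :: "complex^'n^'n" and A :: "complex^'n \<Rightarrow> 'a::complex_inner"
  assumes S: "psd_mat S" and A: "clinear A" and SA: "\<And>c d. cinner (A c) (A d) = cinner (S *v c) (S *v d)"
  obtains V where "clinear V" "\<And>c. V (S *v c) = A c" "\<And>d. norm (V d) \<le> norm d"
proof -
  obtain E \<sigma> where E: "eigenbasis S E \<sigma>"
    using spectral_theorem[OF psd_mat_selfadjoint[OF S]] by blast
  have on: "orthonormal E (\<lambda>e. e)" using E by (simp add: eigenbasis_def)
  note fin = orthonormal_finite[OF on]
  \<comment> \<open>Where \<sigma> e = 0, \<open>inverse 0 = 0\<close> makes V vanish; this is
    consistent with V S = A because A e = 0 there.\<close>
  define g where "g e = scaleC (of_real (inverse (\<sigma> e))) (A e)" for e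
  define V where "V d = (\<Sum>e\<in>E. scaleC (cinner d e) (g e))" for d
  have V: "clinear V"
    by (simp add: clinear_def V_def cinner_add_left scaleC_add_left sum.distrib
        cinner_scaleC_left scaleC.sum_right scaleC_scaleC)
  have inner_A: "cinner (A e) (A f) = of_real (\<sigma> e * \<sigma> f) * cinner e f" if "e \<in> E" "f \<in> E" for e f
    using E that by (simp add: SA eigenbasis_def cinner_scaleC_left cinner_scaleC_right)
  have VS: "V (S *v c) = A c" for c
  proof (rule clinear_eq_on_eigenbasis[OF E])
    show "clinear (\<lambda>c. V (S *v c))"
      using V clinear_matrix_vector_mult[of S] by (simp add: clinear_def)
    fix e assume e: "e \<in> E"
    have "V e = (\<Sum>f\<in>E. if f = e then g e else 0)"
      unfolding V_def using on e
      by (intro sum.cong) (auto simp: orthonormal_def scaleC_zero_left scaleC_one)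
    then have "V (S *v e) = scaleC (of_real (\<sigma> e * inverse (\<sigma> e))) (A e)"
      using E e fin by (simp add: eigenbasis_def clinear_scaleC[OF V] g_def scaleC_scaleC)
    also have "\<dots> = A e"
    proof (cases "\<sigma> e = 0")
      case True
      then have "A e = 0"
        using inner_A[OF e e] by (simp add: cinner_self_eq_0)
      then show ?thesis by (simp add: scaleC.zero_right)
    qed (simp add: scaleC_one)
    finally show "V (S *v e) = A e" .
  qed (fact A)
  have inner_g: "cinner (g e) (g f) = 0" if "e \<in> E" "f \<in> E" "e \<noteq> f" for e f
    using on that by (simp add: g_def cinner_scaleC_left cinner_scaleC_right inner_A orthonormal_def)
  have norm_g: "(norm (g e))\<^sup>2 \<le> 1" if "e \<in> E" for e
  proof -
    have "cinner (A e) (A e) = of_real (\<sigma> e * \<sigma> e)"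
      using on that by (simp add: inner_A orthonormal_def)
    then have "(norm (A e))\<^sup>2 = \<sigma> e * \<sigma> e"
      unfolding cinner_norm of_real_eq_iff .
    moreover have "(norm (g e))\<^sup>2 = (norm (A e))\<^sup>2 / (\<sigma> e)\<^sup>2"
      by (simp add: g_def norm_scaleC power_mult_distrib norm_inverse power_inverse divide_inverse)
    ultimately show ?thesis
      by (simp add: power2_eq_square)
  qed
  have "norm (V d) \<le> norm d" for d
  proof -
    have "(norm (V d))\<^sup>2 = (\<Sum>e\<in>E. (cmod (cinner d e))\<^sup>2 * (norm (g e))\<^sup>2)"
      unfolding V_def by (rule norm_sum_orthogonal_square[OF fin inner_g])
    also have "\<dots> \<le> (\<Sum>e\<in>E. (cmod (cinner d e))\<^sup>2)"
      using norm_g by (intro sum_mono mult_left_le) auto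
    also have "\<dots> \<le> (norm d)\<^sup>2"
      by (rule Bessel_inequality[OF on])
    finally show ?thesis by (rule power2_le_imp_le) simp
  qed
  then show ?thesis using that V VS by blast
qed

section \<open>Gram matrices and the duality formula for the geometric mean\<close>

definition lincomb :: "('n::finite \<Rightarrow> 'a::complex_inner) \<Rightarrow> complex^'n \<Rightarrow> 'a" where
  "lincomb u c = (\<Sum>j\<in>UNIV. scaleC (c $ j) (u j))"

text \<open>With \<open>cinner\<close> linear in its first slot, this order of indices makes
  \<open>gram u\<close> the product of the adjoint of \<open>lincomb u\<close> with
  \<open>lincomb u\<close>, see \<open>cinner_gram\<close>; it is also the order used in
  \<open>Qmat\<close>.\<close>

definition gram :: "('n::finite \<Rightarrow> 'a::complex_inner) \<Rightarrow> complex^'n^'n" where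
  "gram u = (\<chi> i j. cinner (u j) (u i))"

lemma clinear_lincomb: "clinear (lincomb u)"
  by (simp add: clinear_def lincomb_def scaleC_add_left sum.distrib scaleC_complex_def
      scaleC_scaleC scaleC.sum_right)

lemma lincomb_axis: "lincomb u (axis j 1) = u j"
proof -
  have "lincomb u (axis j 1) = (\<Sum>i\<in>UNIV. if i = j then u j else 0)"
    unfolding lincomb_def by (rule sum.cong) (auto simp: axis_def scaleC_zero_left scaleC_one)
  then show ?thesis by simp
qed

lemma cinner_gram: "cinner (gram u *v c) d = cinner (lincomb u c) (lincomb u d)"
  by (simp add: cinner_vec_def cinner_complex_def gram_def matrix_vector_mult_def lincomb_def
      cinner.sum_left cinner.sum_right cinner_scaleC_left cinner_scaleC_right
      sum_distrib_left sum_distrib_right mult.commute mult.left_commute)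

lemma psd_gram: "psd_mat (gram u)"
  unfolding psd_mat_iff selfadjoint_mat_def
proof (intro conjI allI)
  fix x y
  show "cinner (gram u *v x) y = cinner x (gram u *v y)"
    using cinner_commute[of x "gram u *v y"] cinner_commute[of "lincomb u x" "lincomb u y"]
    by (simp add: cinner_gram)
  show "0 \<le> Re (cinner (gram u *v x) x)"
    by (simp add: cinner_gram cinner_norm)
qed

text \<open>With \<open>A = lincomb u\<close>, \<open>B = lincomb v\<close> and \<open>S\<close> the square root of the Gram matrix of \<open>u\<close>,
  write \<open>A = V S\<close>. Then \<open>\<Sum>\<^sub>j \<langle>x v\<^sub>j, u\<^sub>j\<rangle> = tr (V\<^sup>* x B S)\<close>, whose supremum over contractions \<open>x\<close> is the
  trace norm of \<open>B S\<close>.\<close>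

lemma tgm_gram:
  fixes u v :: "'n::finite \<Rightarrow> 'h::complex_inner"
  obtains r where "tgm (gram u) (gram v) = of_real r"
    and "\<And>x. x \<in> BH \<Longrightarrow> norm x \<le> 1 \<Longrightarrow> cmod (\<Sum>j\<in>UNIV. cinner (blinfun_apply x (v j)) (u j)) \<le> r"
    and "\<exists>x\<in>BH. norm x \<le> 1 \<and> cmod (\<Sum>j\<in>UNIV. cinner (blinfun_apply x (v j)) (u j)) = r"
proof -
  define S where "S = msqrt (gram u)"
  have S: "psd_mat S" "S ** S = gram u"
    using msqrt[OF psd_gram] by (simp_all add: S_def)
  have Ssa: "cinner (S *v c) d = cinner c (S *v d)" for c d
    by (rule selfadjoint_matD[OF psd_mat_selfadjoint[OF S(1)]])
  define M where "M = S ** gram v ** S"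
  \<comment> \<open>This \<open>B\<close> is the product written \<open>B S\<close> in the
    explanation above; by \<open>inner_M\<close>, M is the adjoint of \<open>B\<close> times
    \<open>B\<close>.\<close>
  define B where "B c = lincomb v (S *v c)" for c
  have Mv: "M *v c = S *v (gram v *v (S *v c))" for c
    by (simp add: M_def matrix_vector_mul_assoc matrix_mul_assoc)
  have inner_M: "cinner (M *v c) d = cinner (B c) (B d)" for c d
    by (simp add: Mv Ssa cinner_gram B_def)
  have "psd_mat M"
    unfolding psd_mat_iff selfadjoint_mat_def
  proof (intro conjI allI)
    fix x y
    show "cinner (M *v x) y = cinner x (M *v y)"
      using cinner_commute[of x "M *v y"] cinner_commute[of "B x" "B y"] by (simp add: inner_M)
    show "0 \<le> Re (cinner (M *v x) x)"
      by (simp add: inner_M cinner_norm)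
  qed
  define R where "R = msqrt M"
  have R: "psd_mat R" "R ** R = M"
    using msqrt[OF \<open>psd_mat M\<close>] by (simp_all add: R_def)
  \<comment> \<open>R is the absolute value of \<open>B\<close>, so W and \<rho> are its right
    singular vectors and its singular values.\<close>
  obtain W \<rho> where W: "eigenbasis R W \<rho>"
    using spectral_theorem[OF psd_mat_selfadjoint[OF R(1)]] by blast
  have on: "orthonormal W (\<lambda>w. w)" using W by (simp add: eigenbasis_def)
  note fin = orthonormal_finite[OF on]
  have \<rho>: "\<rho> w \<ge> 0" if "w \<in> W" for w
    using eigenbasis_nonneg[OF R(1) W that] .
  have Mw: "M *v w = scaleC (of_real (\<rho> w * \<rho> w)) w" if "w \<in> W" for w
    using W that unfolding R(2)[symmetric] matrix_vector_mul_assoc[symmetric]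
    by (simp add: eigenbasis_def clinear_scaleC[OF clinear_matrix_vector_mult] scaleC_scaleC)
  have inner_B: "cinner (B w) (B w') = (if w = w' then of_real (\<rho> w * \<rho> w) else 0)"
    if "w \<in> W" "w' \<in> W" for w w'
    using on that by (simp add: inner_M[symmetric] Mw cinner_scaleC_left orthonormal_def)
  have norm_B: "norm (B w) = \<rho> w" if "w \<in> W" for w
  proof -
    have "complex_of_real ((norm (B w))\<^sup>2) = of_real ((\<rho> w)\<^sup>2)"
      using inner_B[OF that that] unfolding cinner_norm by (simp add: power2_eq_square)
    then have "(norm (B w))\<^sup>2 = (\<rho> w)\<^sup>2" unfolding of_real_eq_iff .
    then show ?thesis using \<rho>[OF that] by (simp add: power2_eq_iff_nonneg)
  qed
  have AS: "cinner (lincomb u c) (lincomb u d) = cinner (S *v c) (S *v d)" for c d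
    by (simp add: Ssa matrix_vector_mul_assoc S(2) cinner_gram[symmetric])
       (metis Ssa S(2) matrix_vector_mul_assoc)
  obtain V where V: "clinear V" "\<And>c. V (S *v c) = lincomb u c" "\<And>d. norm (V d) \<le> norm d"
    using partial_isometry_of_equal_Gram[OF S(1) clinear_lincomb AS] by blast
  \<comment> \<open>The basis change moves S from the V side to the x side, turning
    \<open>lincomb v\<close> into \<open>B\<close>; on the left, V S recovers the vectors
    \<open>u j\<close>.\<close>
  have key: "(\<Sum>j\<in>UNIV. cinner (blinfun_apply x (v j)) (u j)) = (\<Sum>w\<in>W. cinner (blinfun_apply x (B w)) (V w))"
    if "x \<in> BH" for x
  proof -
    have L: "clinear (\<lambda>c. blinfun_apply x (lincomb v c))"
      using clinear_lincomb[of v] by (simp add: clinear_def blinfun.add_right BH_scaleC[OF that])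
    show ?thesis
      using sum_cinner_axis_eq[OF psd_mat_selfadjoint[OF S(1)] W L V(1)]
      by (simp add: lincomb_axis V(2) B_def)
  qed
  have V_le: "norm (V w) \<le> 1" if "w \<in> W" for w
    using V(3)[of w] orthonormal_norm[OF on that] by simp
  define r where "r = (\<Sum>w\<in>W. \<rho> w)"
  have upper: "cmod (\<Sum>j\<in>UNIV. cinner (blinfun_apply x (v j)) (u j)) \<le> r"
    if x: "x \<in> BH" "norm x \<le> 1" for x
    unfolding key[OF x(1)] r_def
  proof (rule sum_norm_le)
    fix w assume w: "w \<in> W"
    have "cmod (cinner (blinfun_apply x (B w)) (V w)) \<le> norm (blinfun_apply x (B w)) * norm (V w)"
      by (rule Cauchy_Schwarz_cinner)
    also have "\<dots> \<le> norm (blinfun_apply x (B w)) * 1"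
      by (rule mult_left_mono[OF V_le[OF w]]) simp
    also have "\<dots> \<le> norm x * norm (B w)"
      using norm_blinfun by simp
    also have "\<dots> \<le> \<rho> w"
      using x(2) \<rho>[OF w] by (simp add: norm_B[OF w] mult_left_le_one_le)
    finally show "cmod (cinner (blinfun_apply x (B w)) (V w)) \<le> \<rho> w" .
  qed
  \<comment> \<open>Only nonzero singular values allow \<open>B w\<close> to be normalised; for the
    others \<open>B w\<close> is 0.\<close>
  define K where "K = {w \<in> W. \<rho> w \<noteq> 0}"
  have fK: "finite K" using fin by (simp add: K_def)
  define h where "h w = scaleC (of_real (inverse (\<rho> w))) (B w)" for w
  have h: "orthonormal K h"
    unfolding orthonormal_def using fK
    by (auto simp: K_def h_def cinner_scaleC_left cinner_scaleC_right inner_B field_simps)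
  have inner_V: "cinner (V w) (V w') = (if w = w' then 1 else 0)" if wK: "w \<in> K" "w' \<in> K" for w w'
  proof -
    \<comment> \<open>A singular vector with nonzero singular value lies in the range of S because M
      w does; on that range V is isometric by \<open>AS\<close>.\<close>
    have range: "\<exists>c. w = S *v c" if "w \<in> K" for w
    proof
      define c where "c = scaleC (of_real (inverse (\<rho> w * \<rho> w))) (gram v *v (S *v w))"
      have "S *v c = scaleC (of_real (inverse (\<rho> w * \<rho> w))) (M *v w)"
        by (simp only: c_def clinear_scaleC[OF clinear_matrix_vector_mult] Mv)
      also have "\<dots> = w"
      proof -
        have "\<rho> w * \<rho> w \<noteq> 0" and "w \<in> W"
          using that by (auto simp: K_def)
        then have "inverse (\<rho> w * \<rho> w) * (\<rho> w * \<rho> w) = 1" and "w \<in> W"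
          using left_inverse by blast+
        then show ?thesis
          by (simp only: Mw scaleC_scaleC of_real_mult[symmetric] of_real_1 scaleC_one)
      qed
      finally show "w = S *v c" ..
    qed
    obtain c where c: "w = S *v c" using range[OF wK(1)] by blast
    obtain d where d: "w' = S *v d" using range[OF wK(2)] by blast
    have "cinner (V w) (V w') = cinner w w'"
      unfolding c d V(2) by (rule AS)
    then show ?thesis
      using on that by (simp add: orthonormal_def K_def)
  qed
  \<comment> \<open>The partial isometry taking the left singular vectors \<open>h w\<close> to
    \<open>V w\<close> attains the bound: it makes the summand at w equal to \<rho> w.\<close>
  define X where "X z = (\<Sum>w\<in>K. scaleC (cinner z (h w)) (V w))" for z
  have X_le: "norm (X z) \<le> norm z" for z
  proof -
    have "norm (V w) ^ 2 = 1" if "w \<in> K" for w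
    proof -
      have "complex_of_real (norm (V w) ^ 2) = 1"
        using inner_V[OF that that] unfolding cinner_norm by simp
      then show ?thesis unfolding of_real_eq_1_iff .
    qed
    then have "(norm (X z))\<^sup>2 = (\<Sum>w\<in>K. (cmod (cinner z (h w)))\<^sup>2)"
      unfolding X_def by (subst norm_sum_orthogonal_square[OF fK]) (auto simp: inner_V)
    also have "\<dots> \<le> (norm z)\<^sup>2"
      by (rule Bessel_inequality[OF h])
    finally show ?thesis by (rule power2_le_imp_le) simp
  qed
  have "bounded_linear X"
  proof (rule bounded_linear_intro[where K = 1])
    show "norm (X z) \<le> norm z * 1" for z using X_le by simp
  qed (simp_all add: X_def cinner_add_left scaleC_add_left sum.distrib cinner.scaleR_left
      scaleC.scaleR_left scaleR_sum_right)
  define x where "x = Blinfun X"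
  have xX: "blinfun_apply x z = X z" for z
    using \<open>bounded_linear X\<close> by (simp add: x_def bounded_linear_Blinfun_apply)
  have xBH: "x \<in> BH"
    by (simp add: BH_def xX X_def cinner_scaleC_left scaleC.sum_right scaleC_scaleC)
  have x1: "norm x \<le> 1"
    by (rule norm_blinfun_bound) (simp_all add: xX X_le)
  have "cinner (X (B w)) (V w) = of_real (\<rho> w)" if w: "w \<in> W" for w
  proof (cases "\<rho> w = 0")
    case True
    then have "B w = 0" using norm_B[OF w] by simp
    then show ?thesis
      using True by (simp add: X_def cinner_zero_left scaleC_zero_left)
  next
    case False
    then have wK: "w \<in> K" using w by (simp add: K_def)
    have "cinner (B w) (h w') = (if w' = w then of_real (\<rho> w) else 0)" if "w' \<in> K" for w'
      using that w by (auto simp: h_def cinner_scaleC_right inner_B K_def)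
    then have "X (B w) = (\<Sum>w'\<in>K. if w' = w then scaleC (of_real (\<rho> w)) (V w) else 0)"
      unfolding X_def by (intro sum.cong) (auto simp: scaleC_zero_left)
    also have "\<dots> = scaleC (of_real (\<rho> w)) (V w)"
      using wK fK by simp
    finally show ?thesis
      by (simp add: cinner_scaleC_left inner_V[OF wK wK])
  qed
  then have "(\<Sum>j\<in>UNIV. cinner (blinfun_apply x (v j)) (u j)) = of_real r"
    unfolding key[OF xBH] by (simp add: xX r_def)
  moreover have "r \<ge> 0"
    unfolding r_def using \<rho> by (rule sum_nonneg)
  ultimately have "\<exists>x\<in>BH. norm x \<le> 1 \<and> cmod (\<Sum>j\<in>UNIV. cinner (blinfun_apply x (v j)) (u j)) = r"
    using xBH x1 by (intro bexI[of _ x]) auto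
  moreover have "tgm (gram u) (gram v) = of_real r"
    unfolding tgm_def S_def[symmetric] M_def[symmetric] R_def[symmetric] r_def
    by (rule trace_eq_sum_eigenvalues[OF psd_mat_selfadjoint[OF R(1)] W])
  ultimately show ?thesis using that upper by blast
qed

section \<open>Tight families of operators\<close>

definition perp :: "'a::complex_inner set \<Rightarrow> 'a \<Rightarrow> bool" where
  "perp F v \<longleftrightarrow> (\<forall>f\<in>F. cinner v f = 0)"

text \<open>For nonnegative \<epsilon> and P the orthogonal projection onto the complement of F,
  this says that both y P and P y have norm at most \<epsilon>; the disjunction encodes the two
  sides.\<close>

definition tail :: "'h::complex_inner set \<Rightarrow> real \<Rightarrow> ('h \<Rightarrow>\<^sub>L 'h) \<Rightarrow> bool" where
  "tail F \<epsilon> y \<longleftrightarrow> (\<forall>v w. perp F v \<or> perp F w \<longrightarrow>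
     cmod (cinner (blinfun_apply y v) w) \<le> \<epsilon> * norm v * norm w)"

text \<open>Collective compactness, measured by the sesquilinear forms \<open>\<langle>y v, w\<rangle>\<close> so that an operator and
  its adjoint enter symmetrically.\<close>

definition tight :: "('h::complex_inner \<Rightarrow>\<^sub>L 'h) set \<Rightarrow> bool" where
  "tight K \<longleftrightarrow> (\<forall>\<epsilon>>0. \<exists>F. finite F \<and> (\<forall>y\<in>K. tail F \<epsilon> y))"

lemma perp_mono: "F \<subseteq> G \<Longrightarrow> perp G v \<Longrightarrow> perp F v"
  by (auto simp: perp_def)

lemma tail_mono: "tail F \<epsilon> y \<Longrightarrow> F \<subseteq> G \<Longrightarrow> tail G \<epsilon> y"
  unfolding tail_def using perp_mono by blast

lemma perp_decomposition:
  assumes "finite (F :: 'a::complex_inner set)"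
  obtains E where "orthonormal E (\<lambda>e. e)" and "\<And>v. perp F (v - oproj E v)"
proof -
  obtain E where E: "orthonormal E (\<lambda>e. e)" "\<And>f. f \<in> F \<Longrightarrow> oproj E f = f"
    using Gram_Schmidt[OF assms] by blast
  have "perp F (v - oproj E v)" for v
    unfolding perp_def
  proof
    fix f assume f: "f \<in> F"
    have "cinner (v - oproj E v) (oproj E f) = 0"
      by (subst (2) oproj_def)
        (auto simp: cinner.sum_right cinner_scaleC_right cinner_diff_oproj[OF E(1)] intro!: sum.neutral)
    then show "cinner (v - oproj E v) f = 0"
      using E(2)[OF f] by simp
  qed
  then show ?thesis using that E(1) by blast
qed

lemma cmod_cinner_blinfun_le:
  "cmod (cinner (blinfun_apply y v) w) \<le> norm y * norm v * norm w"
  by (rule order_trans[OF Cauchy_Schwarz_cinner]) (simp add: mult_right_mono norm_blinfun)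

lemma tail_perturb:
  assumes "tail F \<epsilon> z" and "norm (y - z) \<le> \<delta>"
  shows "tail F (\<epsilon> + \<delta>) y"
  unfolding tail_def
proof (intro allI impI)
  fix v w assume "perp F v \<or> perp F w"
  then have "cmod (cinner (blinfun_apply z v) w) \<le> \<epsilon> * norm v * norm w"
    using assms(1) unfolding tail_def by blast
  moreover have "cmod (cinner (blinfun_apply (y - z) v) w) \<le> norm (y - z) * norm v * norm w"
    by (rule cmod_cinner_blinfun_le)
  moreover have "norm (y - z) * norm v * norm w \<le> \<delta> * norm v * norm w"
    using assms(2) by (intro mult_right_mono) auto
  moreover have "cinner (blinfun_apply y v) w = cinner (blinfun_apply z v) w + cinner (blinfun_apply (y - z) v) w"
    by (simp add: blinfun.diff_left cinner_diff_left)
  ultimately show "cmod (cinner (blinfun_apply y v) w) \<le> (\<epsilon> + \<delta>) * norm v * norm w"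
    using norm_triangle_ineq[of "cinner (blinfun_apply z v) w" "cinner (blinfun_apply (y - z) v) w"]
    by (simp add: distrib_right)
qed

lemma BH_oproj:
  assumes "x \<in> BH"
  shows "blinfun_apply x (oproj E v) = (\<Sum>e\<in>E. scaleC (cinner v e) (blinfun_apply x e))"
  by (simp add: oproj_def blinfun.sum_right BH_scaleC[OF assms])

subsection \<open>Total boundedness\<close>

text \<open>Pigeonhole: each coordinate is rounded to a point of a finite net, so there are finitely
  many codes, and two points with the same code have coordinates within \<delta>. One representative
  per code gives the centres.\<close>

lemma totally_bounded_by_coordinates:
  fixes g :: "'d \<Rightarrow> 'm::metric_space" and \<phi> :: "'i \<Rightarrow> 'd \<Rightarrow> complex"
  assumes I: "finite I" and B: "\<And>i x. i \<in> I \<Longrightarrow> x \<in> D \<Longrightarrow> cmod (\<phi> i x) \<le> B" and \<delta>: "\<delta> > 0"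
    and close: "\<And>x y. x \<in> D \<Longrightarrow> y \<in> D \<Longrightarrow> (\<And>i. i \<in> I \<Longrightarrow> cmod (\<phi> i x - \<phi> i y) < \<delta>) \<Longrightarrow> dist (g x) (g y) < \<epsilon>"
  shows "\<exists>k. finite k \<and> g ` D \<subseteq> (\<Union>c\<in>k. ball c \<epsilon>)"
proof -
  obtain N where N: "finite N" "cball (0::complex) B \<subseteq> (\<Union>c\<in>N. ball c (\<delta> / 2))"
    using conjunct2[OF iffD1[OF compact_eq_totally_bounded compact_cball[of 0 B]], rule_format, of "\<delta> / 2"] \<delta>
    by (metis half_gt_zero)
  have "\<exists>c\<in>N. dist c z < \<delta> / 2" if "cmod z \<le> B" for z
    using subsetD[OF N(2), of z] that by auto
  then obtain n where n: "\<And>z. cmod z \<le> B \<Longrightarrow> n z \<in> N \<and> dist (n z) z < \<delta> / 2"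
    by metis
  \<comment> \<open>The restriction fixes the values outside I, which places all codes in a finite
    product.\<close>
  define code where "code x = restrict (\<lambda>i. n (\<phi> i x)) I" for x
  have fin: "finite (code ` D)"
  proof (rule finite_subset)
    show "code ` D \<subseteq> PiE I (\<lambda>_. N)"
    proof
      fix y assume "y \<in> code ` D"
      then obtain x where "x \<in> D" "y = code x" by blast
      then show "y \<in> PiE I (\<lambda>_. N)"
        using n[OF B[of _ x]] by (simp add: code_def)
    qed
    show "finite (PiE I (\<lambda>_. N))"
      using I N(1) by (simp add: finite_PiE)
  qed
  define rep where "rep z = (SOME x. x \<in> D \<and> code x = z)" for z
  have rep: "rep (code x) \<in> D \<and> code (rep (code x)) = code x" if "x \<in> D" for x
  proof -
    have "\<exists>x'. x' \<in> D \<and> code x' = code x" using that by blast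
    from someI_ex[OF this] show ?thesis unfolding rep_def .
  qed
  have "dist (g (rep (code x))) (g x) < \<epsilon>" if x: "x \<in> D" for x
  proof (rule close)
    fix i assume i: "i \<in> I"
    have "n (\<phi> i (rep (code x))) = n (\<phi> i x)"
      using fun_cong[OF conjunct2[OF rep[OF x]], of i] i by (simp add: code_def)
    moreover have "rep (code x) \<in> D" using rep[OF x] by blast
    ultimately have "dist (n (\<phi> i x)) (\<phi> i (rep (code x))) < \<delta> / 2"
      using n[OF B[OF i, of "rep (code x)"]] by metis
    moreover have "dist (n (\<phi> i x)) (\<phi> i x) < \<delta> / 2"
      using n[OF B[OF i x]] by blast
    ultimately have "dist (\<phi> i (rep (code x))) (\<phi> i x) < \<delta>"
      by (rule dist_triangle_half_r)
    then show "cmod (\<phi> i (rep (code x)) - \<phi> i x) < \<delta>"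
      by (simp add: dist_norm)
  next
    show "rep (code x) \<in> D" using rep[OF x] by blast
  qed (fact x)
  then have "g ` D \<subseteq> (\<Union>c\<in>(\<lambda>z. g (rep z)) ` code ` D. ball c \<epsilon>)"
    unfolding UN_simps image_subset_iff UN_iff mem_ball by blast
  then show ?thesis
    using finite_imageI[OF fin] by (intro exI conjI)
qed

text \<open>Completeness enters as a statement about \<open>UNIV\<close>, so the criterion serves
  both for vectors and for operators.\<close>

lemma compact_closure_if_totally_bounded:
  fixes K :: "'m::metric_space set"
  assumes "complete (UNIV :: 'm set)"
    and tb: "\<And>\<epsilon>. \<epsilon> > 0 \<Longrightarrow> \<exists>k. finite k \<and> K \<subseteq> (\<Union>c\<in>k. ball c \<epsilon>)"
  shows "compact (closure K)"
  unfolding compact_eq_totally_bounded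
proof (intro conjI allI impI)
  show "complete (closure K)"
    using complete_Int_closed[OF assms(1) closed_closure, of K] by simp
  fix \<epsilon> :: real assume "\<epsilon> > 0"
  then obtain k where k: "finite k" "K \<subseteq> (\<Union>c\<in>k. ball c (\<epsilon> / 2))"
    \<comment> \<open>Half the radius, because the closure is only caught by the closed
      balls.\<close>
    using tb[of "\<epsilon> / 2"] by auto
  have "closure K \<subseteq> (\<Union>c\<in>k. cball c (\<epsilon> / 2))"
  proof (rule closure_minimal)
    show "K \<subseteq> (\<Union>c\<in>k. cball c (\<epsilon> / 2))"
      using k(2) by (rule order_trans) (intro UN_mono order_refl ball_subset_cball)
    show "closed (\<Union>c\<in>k. cball c (\<epsilon> / 2))"
      using k(1) by (intro closed_UN) auto
  qed
  also have "\<dots> \<subseteq> (\<Union>c\<in>k. ball c \<epsilon>)"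
    using \<open>\<epsilon> > 0\<close> by (intro UN_mono) auto
  finally show "\<exists>k. finite k \<and> closure K \<subseteq> (\<Union>c\<in>k. ball c \<epsilon>)"
    using k(1) by blast
qed

lemma compact_closure_net:
  fixes K :: "'m::metric_space set"
  assumes "compact (closure K)" and "\<epsilon> > 0"
  obtains k where "finite k" "k \<subseteq> closure K" "\<forall>y\<in>K. \<exists>c\<in>k. dist c y < \<epsilon>"
proof -
  obtain k where k: "finite k" "k \<subseteq> closure K" "closure K \<subseteq> (\<Union>c\<in>k. ball c \<epsilon>)"
    using seq_compact_imp_totally_bounded[OF compact_imp_seq_compact[OF assms(1)], rule_format, OF assms(2)]
    by (elim exE conjE)
  show ?thesis
  proof (rule that[OF k(1,2)], rule ballI)
    fix y assume "y \<in> K"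
    then have "y \<in> (\<Union>c\<in>k. ball c \<epsilon>)"
      using k(3) closure_subset by blast
    then show "\<exists>c\<in>k. dist c y < \<epsilon>" by simp
  qed
qed

text \<open>The class \<open>banach\<close> is not inferred from \<open>real_normed_vector\<close> and \<open>complete_space\<close>, so the
  library instance for bounded linear maps does not apply.\<close>

lemma complete_blinfun:
  "complete (UNIV :: ('a::real_normed_vector \<Rightarrow>\<^sub>L 'h::{real_normed_vector, complete_space}) set)"
proof (rule completeI)
  fix X :: "nat \<Rightarrow> ('a \<Rightarrow>\<^sub>L 'h)" assume X: "Cauchy X"
  have "Cauchy (\<lambda>n. blinfun_apply (X n) v)" for v
    by (rule bounded_linear.Cauchy[OF blinfun.bounded_linear_left X])
  then have "\<exists>l. (\<lambda>n. blinfun_apply (X n) v) \<longlonglongrightarrow> l" for v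
    using Cauchy_convergent convergent_def by blast
  then obtain L where L: "\<And>v. (\<lambda>n. blinfun_apply (X n) v) \<longlonglongrightarrow> L v"
    by metis
  obtain B where B: "\<And>n. norm (X n) \<le> B"
    using Cauchy_Bseq[OF X] by (auto simp: Bseq_def)
  have bl: "bounded_linear L"
  proof (rule bounded_linear_intro[where K = B])
    show "L (x + y) = L x + L y" for x y
    proof (rule LIMSEQ_unique[OF L])
      show "(\<lambda>n. blinfun_apply (X n) (x + y)) \<longlonglongrightarrow> L x + L y"
        unfolding blinfun.add_right by (intro tendsto_add L)
    qed
    show "L (r *\<^sub>R x) = r *\<^sub>R L x" for r x
    proof (rule LIMSEQ_unique[OF L])
      show "(\<lambda>n. blinfun_apply (X n) (r *\<^sub>R x)) \<longlonglongrightarrow> r *\<^sub>R L x"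
        unfolding blinfun.scaleR_right by (intro tendsto_scaleR tendsto_const L)
    qed
    show "norm (L x) \<le> norm x * B" for x
    proof (rule LIMSEQ_le_const2[OF tendsto_norm[OF L[of x]]])
      have "norm (blinfun_apply (X n) x) \<le> norm x * B" for n
        using norm_blinfun[of "X n" x] mult_right_mono[OF B[of n], of "norm x"]
        by (simp add: mult.commute)
      then show "\<exists>N. \<forall>n\<ge>N. norm (blinfun_apply (X n) x) \<le> norm x * B" by blast
    qed
  qed
  have "X \<longlonglongrightarrow> Blinfun L"
  proof (rule metric_LIMSEQ_I)
    fix e :: real assume e: "e > 0"
    then obtain N where N: "\<And>m n. m \<ge> N \<Longrightarrow> n \<ge> N \<Longrightarrow> dist (X m) (X n) < e / 2"
      using metric_CauchyD[OF X, of "e / 2"] by auto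
    have "dist (X n) (Blinfun L) < e" if n: "n \<ge> N" for n
    proof -
      have "norm (blinfun_apply (X n - Blinfun L) v) \<le> (e / 2) * norm v" for v
      proof (rule LIMSEQ_le_const2)
        show "(\<lambda>m. norm (blinfun_apply (X n) v - blinfun_apply (X m) v))
            \<longlonglongrightarrow> norm (blinfun_apply (X n - Blinfun L) v)"
          unfolding blinfun.diff_left bounded_linear_Blinfun_apply[OF bl]
          by (intro tendsto_intros L)
        have "norm (blinfun_apply (X n) v - blinfun_apply (X m) v) \<le> (e / 2) * norm v" if "m \<ge> N" for m
        proof -
          have "norm (blinfun_apply (X n - X m) v) \<le> norm (X n - X m) * norm v"
            by (rule norm_blinfun)
          also have "\<dots> \<le> (e / 2) * norm v"
            using N[OF n that] by (intro mult_right_mono) (auto simp: dist_norm)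
          finally show ?thesis by (simp add: blinfun.diff_left)
        qed
        then show "\<exists>M. \<forall>m\<ge>M. norm (blinfun_apply (X n) v - blinfun_apply (X m) v) \<le> (e / 2) * norm v"
          by blast
      qed
      then have "norm (X n - Blinfun L) \<le> e / 2"
        using e by (intro norm_blinfun_bound) auto
      then show ?thesis using e by (simp add: dist_norm)
    qed
    then show "\<exists>N. \<forall>n\<ge>N. dist (X n) (Blinfun L) < e" by blast
  qed
  then show "\<exists>l\<in>UNIV. X \<longlonglongrightarrow> l" by blast
qed

text \<open>Used with n the number of basis vectors or pairs in a finite sum and c a bound for the
  operator; adding 1 to the denominator covers \<open>c * n = 0\<close>.\<close>

lemma small_multiple:
  fixes n c \<epsilon> :: real
  assumes "\<epsilon> > 0" and "n \<ge> 0" and "c \<ge> 0"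
  obtains \<delta> where "\<delta> > 0" "c * (n * \<delta>) \<le> \<epsilon>"
proof
  have cn: "c * n + 1 > 0" using assms by (simp add: add_nonneg_pos)
  show "\<epsilon> / (c * n + 1) > 0" using assms cn by simp
  have "c * n * \<epsilon> \<le> (c * n + 1) * \<epsilon>"
    using assms by (intro mult_right_mono) auto
  then show "c * (n * (\<epsilon> / (c * n + 1))) \<le> \<epsilon>"
    using cn by (simp add: field_simps)
qed

text \<open>Up to the tails, an operator of the family is its matrix over a finite orthonormal set
  E. These matrices have bounded entries, so the family is totally bounded in norm.\<close>

lemma compact_closure_tight:
  fixes K :: "('h::{complex_inner, complete_space} \<Rightarrow>\<^sub>L 'h) set"
  assumes K: "tight K" and BH: "K \<subseteq> BH" and B: "\<And>y. y \<in> K \<Longrightarrow> norm y \<le> B"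
  shows "compact (closure K)"
proof (rule compact_closure_if_totally_bounded[OF complete_blinfun])
  fix \<epsilon> :: real assume \<epsilon>: "\<epsilon> > 0"
  \<comment> \<open>Two tail terms of size 2 \<epsilon>1 and \<epsilon> / 4 from the matrix entries
    add up to \<epsilon> / 2, strictly below \<epsilon>.\<close>
  define \<epsilon>1 where "\<epsilon>1 = \<epsilon> / 16"
  have \<epsilon>1: "\<epsilon>1 > 0" using \<epsilon> by (simp add: \<epsilon>1_def)
  obtain F where "finite F" and "\<forall>y\<in>K. tail F \<epsilon>1 y"
    using K[unfolded tight_def, rule_format, OF \<epsilon>1] by (elim exE conjE)
  note F = \<open>finite F\<close> \<open>\<forall>y\<in>K. tail F \<epsilon>1 y\<close>[rule_format]
  obtain E where E: "orthonormal E (\<lambda>e. e)" and perp: "\<And>v. perp F (v - oproj E v)"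
    using perp_decomposition[OF F(1)] by blast
  note fin = orthonormal_finite[OF E]
  define n where "n = real (card E)"
  have n: "n \<ge> 0" by (simp add: n_def)
  obtain \<delta> where \<delta>: "\<delta> > 0" and n\<delta>: "n * (n * \<delta>) \<le> \<epsilon> / 4"
    using small_multiple[of "\<epsilon> / 4" n n] \<epsilon> n by auto
  have E_le: "cmod (cinner v e) \<le> norm v" if "e \<in> E" for v e
    using Cauchy_Schwarz_cinner[of v e] orthonormal_norm[OF E that] by simp
  have "\<exists>k. finite k \<and> (\<lambda>y. y) ` K \<subseteq> (\<Union>c\<in>k. ball c \<epsilon>)"
  proof (rule totally_bounded_by_coordinates[where
        \<phi> = "\<lambda>p y. cinner (blinfun_apply y (fst p)) (snd p)" and I = "E \<times> E" and B = B and \<delta> = \<delta>])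
    fix p y assume p: "p \<in> E \<times> E" and y: "y \<in> K"
    show "cmod (cinner (blinfun_apply y (fst p)) (snd p)) \<le> B"
      using cmod_cinner_blinfun_le[of y "fst p" "snd p"] B[OF y] p orthonormal_norm[OF E]
      by (auto simp: mem_Times_iff)
  next
    fix y z assume y: "y \<in> K" and z: "z \<in> K"
      and c: "\<And>p. p \<in> E \<times> E \<Longrightarrow> cmod (cinner (blinfun_apply y (fst p)) (snd p) - cinner (blinfun_apply z (fst p)) (snd p)) < \<delta>"
    define d where "d = y - z"
    \<comment> \<open>Complex homogeneity of the difference is what allows its values on projections
      to be expanded over E.\<close>
    have dBH: "d \<in> BH"
      using y z BH by (auto simp: d_def BH_def blinfun.diff_left scaleC.diff_right subset_iff)
    have dE: "cmod (cinner (blinfun_apply d e) e') \<le> \<delta>" if "e \<in> E" "e' \<in> E" for e e'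
      using c[of "(e, e')"] that by (simp add: d_def blinfun.diff_left cinner_diff_left)
    have dF: "cmod (cinner (blinfun_apply d v) w) \<le> 2 * \<epsilon>1 * norm v * norm w"
      if "perp F v \<or> perp F w" for v w
    proof -
      have "cmod (cinner (blinfun_apply y v) w) \<le> \<epsilon>1 * norm v * norm w"
        and "cmod (cinner (blinfun_apply z v) w) \<le> \<epsilon>1 * norm v * norm w"
        using F(2)[OF y] F(2)[OF z] that unfolding tail_def by blast+
      then show ?thesis
        using norm_triangle_ineq4[of "cinner (blinfun_apply y v) w" "cinner (blinfun_apply z v) w"]
        by (simp add: d_def blinfun.diff_left cinner_diff_left)
    qed
    have main: "cmod (cinner (blinfun_apply d v) w) \<le> (\<epsilon> / 2) * norm v * norm w" for v w
    proof -
      define v1 v2 w1 w2 where "v1 = oproj E v" and "v2 = v - oproj E v"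
        and "w1 = oproj E w" and "w2 = w - oproj E w"
      have v: "v = v1 + v2" and w: "w = w1 + w2" by (simp_all add: v1_def v2_def w1_def w2_def)
      have eq: "cinner (blinfun_apply d v) w
          = cinner (blinfun_apply d v2) w + cinner (blinfun_apply d v1) w2 + cinner (blinfun_apply d v1) w1"
        by (simp add: v w blinfun.add_right cinner_add_left cinner_add_right)
      have 0: "cmod (cinner (blinfun_apply d v) w)
          \<le> cmod (cinner (blinfun_apply d v2) w) + cmod (cinner (blinfun_apply d v1) w2)
            + cmod (cinner (blinfun_apply d v1) w1)"
        unfolding eq
        using norm_triangle_ineq[of "cinner (blinfun_apply d v2) w + cinner (blinfun_apply d v1) w2"
            "cinner (blinfun_apply d v1) w1"]
          norm_triangle_ineq[of "cinner (blinfun_apply d v2) w" "cinner (blinfun_apply d v1) w2"]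
        by linarith
      have "cmod (cinner (blinfun_apply d v2) w) \<le> 2 * \<epsilon>1 * norm v2 * norm w"
        using dF perp by (simp add: v2_def)
      also have "\<dots> \<le> 2 * \<epsilon>1 * norm v * norm w"
        using \<epsilon>1 norm_diff_oproj_le[OF E, of v] by (intro mult_right_mono mult_left_mono) (auto simp: v2_def)
      finally have 1: "cmod (cinner (blinfun_apply d v2) w) \<le> 2 * \<epsilon>1 * norm v * norm w" .
      have "cmod (cinner (blinfun_apply d v1) w2) \<le> 2 * \<epsilon>1 * norm v1 * norm w2"
        using dF perp by (simp add: w2_def)
      also have "\<dots> \<le> 2 * \<epsilon>1 * norm v * norm w"
        using \<epsilon>1 norm_diff_oproj_le[OF E, of w] norm_oproj_le[OF E, of v]
        by (intro mult_mono) (auto simp: v1_def w2_def)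
      finally have 2: "cmod (cinner (blinfun_apply d v1) w2) \<le> 2 * \<epsilon>1 * norm v * norm w" .
      have "cinner (blinfun_apply d v1) w1
          = (\<Sum>e'\<in>E. \<Sum>e\<in>E. cnj (cinner w e') * (cinner v e * cinner (blinfun_apply d e) e'))"
        unfolding v1_def BH_oproj[OF dBH]
        by (simp add: w1_def oproj_def cinner.sum_left cinner.sum_right cinner_scaleC_left
            cinner_scaleC_right sum_distrib_left)
      also have "cmod \<dots> \<le> (\<Sum>e'\<in>E. \<Sum>e\<in>E. norm w * (norm v * \<delta>))"
        using dE E_le \<delta>
        by (intro sum_norm_le) (auto simp: norm_mult intro!: mult_mono)
      also have "\<dots> = (n * (n * \<delta>)) * (norm v * norm w)"
        by (simp add: n_def)
      also have "\<dots> \<le> \<epsilon> / 4 * (norm v * norm w)"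
        using n\<delta> by (intro mult_right_mono) auto
      finally have 3: "cmod (cinner (blinfun_apply d v1) w1) \<le> \<epsilon> / 4 * (norm v * norm w)" .
      show ?thesis
        using 0 1 2 3 unfolding \<epsilon>1_def by argo
    qed
    have "norm (blinfun_apply d v) \<le> (\<epsilon> / 2) * norm v" for v
      by (rule norm_le_if_cinner_le) (use main \<epsilon> in auto)
    then have "norm d \<le> \<epsilon> / 2"
      using \<epsilon> by (intro norm_blinfun_bound) auto
    then show "dist y z < \<epsilon>"
      using \<epsilon> by (simp add: d_def dist_norm)
  qed (use fin \<delta> in auto)
  then show "\<exists>k. finite k \<and> K \<subseteq> (\<Union>c\<in>k. ball c \<epsilon>)" by simp
qed

text \<open>Up to a small error, \<open>a v\<close> depends only on the coordinates of v along
  finitely many vectors. Differences in the ball have norm at most 2, so tail and head contribute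
  \<epsilon> / 4 each.\<close>

lemma compact_operator_if_right_tail:
  fixes a :: "'h::{complex_inner, complete_space} \<Rightarrow>\<^sub>L 'h"
  assumes "\<And>\<epsilon>. \<epsilon> > 0 \<Longrightarrow> \<exists>F. finite F \<and> (\<forall>v. perp F v \<longrightarrow> norm (blinfun_apply a v) \<le> \<epsilon> * norm v)"
  shows "compact_operator a"
  unfolding compact_operator_def
proof (rule compact_closure_if_totally_bounded)
  show "complete (UNIV :: 'h set)"
    by (simp add: complete_eq_closed)
  fix \<epsilon> :: real assume \<epsilon>: "\<epsilon> > 0"
  obtain F where F: "finite F" "\<And>v. perp F v \<Longrightarrow> norm (blinfun_apply a v) \<le> \<epsilon> / 8 * norm v"
    using assms[of "\<epsilon> / 8"] \<epsilon> by (metis half_gt_zero zero_less_divide_iff zero_less_numeral)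
  obtain E where E: "orthonormal E (\<lambda>e. e)" and perp: "\<And>v. perp F (v - oproj E v)"
    using perp_decomposition[OF F(1)] by blast
  obtain \<delta> where \<delta>: "\<delta> > 0" "norm a * (real (card E) * \<delta>) \<le> \<epsilon> / 4"
    using small_multiple[of "\<epsilon> / 4" "real (card E)" "norm a"] \<epsilon> by auto
  show "\<exists>k. finite k \<and> blinfun_apply a ` cball 0 1 \<subseteq> (\<Union>c\<in>k. ball c \<epsilon>)"
  proof (rule totally_bounded_by_coordinates[where \<phi> = "\<lambda>e v. cinner v e" and I = E and B = 1 and \<delta> = \<delta>])
    fix e v assume "e \<in> E" "v \<in> cball (0::'h) 1"
    then show "cmod (cinner v e) \<le> 1"
      using Cauchy_Schwarz_cinner[of v e] orthonormal_norm[OF E, of e] by simp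
  next
    fix v w assume vw: "v \<in> cball (0::'h) 1" "w \<in> cball (0::'h) 1"
      and c: "\<And>e. e \<in> E \<Longrightarrow> cmod (cinner v e - cinner w e) < \<delta>"
    define d where "d = v - w"
    have "norm d \<le> 2"
      using vw norm_triangle_ineq4[of v w] by (simp add: d_def)
    then have "\<epsilon> / 8 * norm (d - oproj E d) \<le> \<epsilon> / 8 * 2"
      using norm_diff_oproj_le[OF E, of d] \<epsilon> by (intro mult_left_mono) auto
    then have 1: "norm (blinfun_apply a (d - oproj E d)) \<le> \<epsilon> / 4"
      using F(2)[OF perp, of d] by simp
    have "norm (oproj E d) \<le> (\<Sum>e\<in>E. cmod (cinner d e))"
      by (rule norm_oproj_le_sum[OF E])
    also have "\<dots> \<le> (\<Sum>e\<in>E. \<delta>)"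
      using c by (intro sum_mono) (auto simp: d_def cinner_diff_left less_imp_le)
    finally have "norm a * norm (oproj E d) \<le> norm a * (real (card E) * \<delta>)"
      by (intro mult_left_mono) auto
    then have 2: "norm (blinfun_apply a (oproj E d)) \<le> \<epsilon> / 4"
      using norm_blinfun[of a "oproj E d"] \<delta>(2) by linarith
    have "blinfun_apply a v - blinfun_apply a w = blinfun_apply a (d - oproj E d) + blinfun_apply a (oproj E d)"
      by (simp add: d_def blinfun.diff_right)
    then show "dist (blinfun_apply a v) (blinfun_apply a w) < \<epsilon>"
      using 1 2 \<epsilon> norm_triangle_ineq[of "blinfun_apply a (d - oproj E d)" "blinfun_apply a (oproj E d)"]
      by (simp add: dist_norm)
  qed (use orthonormal_finite[OF E] \<delta> in auto)
qed

text \<open>Here the image of the ball is close to a finite-dimensional space, so the coordinates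
  are those of \<open>a v\<close> instead of v.\<close>

lemma compact_operator_if_left_tail:
  fixes a :: "'h::{complex_inner, complete_space} \<Rightarrow>\<^sub>L 'h"
  assumes "\<And>\<epsilon>. \<epsilon> > 0 \<Longrightarrow> \<exists>F. finite F \<and>
    (\<forall>v w. perp F w \<longrightarrow> cmod (cinner (blinfun_apply a v) w) \<le> \<epsilon> * norm v * norm w)"
  shows "compact_operator a"
  unfolding compact_operator_def
proof (rule compact_closure_if_totally_bounded)
  show "complete (UNIV :: 'h set)"
    by (simp add: complete_eq_closed)
  fix \<epsilon> :: real assume \<epsilon>: "\<epsilon> > 0"
  obtain F where F: "finite F"
    "\<And>v w. perp F w \<Longrightarrow> cmod (cinner (blinfun_apply a v) w) \<le> \<epsilon> / 8 * norm v * norm w"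
    using assms[of "\<epsilon> / 8"] \<epsilon> by (metis half_gt_zero zero_less_divide_iff zero_less_numeral)
  obtain E where E: "orthonormal E (\<lambda>e. e)" and perp: "\<And>v. perp F (v - oproj E v)"
    using perp_decomposition[OF F(1)] by blast
  obtain \<delta> where \<delta>: "\<delta> > 0" "1 * (real (card E) * \<delta>) \<le> \<epsilon> / 4"
    using small_multiple[of "\<epsilon> / 4" "real (card E)" 1] \<epsilon> by auto
  show "\<exists>k. finite k \<and> blinfun_apply a ` cball 0 1 \<subseteq> (\<Union>c\<in>k. ball c \<epsilon>)"
  proof (rule totally_bounded_by_coordinates[where \<phi> = "\<lambda>e v. cinner (blinfun_apply a v) e"
        and I = E and B = "norm a" and \<delta> = \<delta>])
    fix e v assume e: "e \<in> E" and v: "v \<in> cball (0::'h) 1"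
    have "norm a * norm v * norm e \<le> norm a * 1 * 1"
      using v orthonormal_norm[OF E e] by (intro mult_mono) auto
    then show "cmod (cinner (blinfun_apply a v) e) \<le> norm a"
      using cmod_cinner_blinfun_le[of a v e] by simp
  next
    fix v w assume vw: "v \<in> cball (0::'h) 1" "w \<in> cball (0::'h) 1"
      and c: "\<And>e. e \<in> E \<Longrightarrow> cmod (cinner (blinfun_apply a v) e - cinner (blinfun_apply a w) e) < \<delta>"
    define d where "d = v - w"
    have d2: "norm d \<le> 2"
      using vw norm_triangle_ineq4[of v w] by (simp add: d_def)
    have "norm (blinfun_apply a d) \<le> \<epsilon> / 2"
    proof (rule norm_le_if_cinner_le)
      fix z
      have "\<epsilon> / 8 * norm d * norm (z - oproj E z) \<le> \<epsilon> / 8 * 2 * norm z"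
        using norm_diff_oproj_le[OF E, of z] d2 \<epsilon> by (intro mult_mono) auto
      then have 1: "cmod (cinner (blinfun_apply a d) (z - oproj E z)) \<le> \<epsilon> / 4 * norm z"
        using F(2)[OF perp, of d z] by simp
      have "cmod (cinner (blinfun_apply a d) (oproj E z)) \<le> (\<Sum>e\<in>E. norm z * \<delta>)"
        unfolding oproj_def cinner.sum_right cinner_scaleC_right
      proof (rule sum_norm_le)
        fix e assume e: "e \<in> E"
        have "cmod (cinner z e) \<le> norm z"
          using Cauchy_Schwarz_cinner[of z e] orthonormal_norm[OF E e] by simp
        moreover have "cmod (cinner (blinfun_apply a d) e) \<le> \<delta>"
          using c[OF e] by (simp add: d_def blinfun.diff_right cinner_diff_left)
        ultimately show "cmod (cnj (cinner z e) * cinner (blinfun_apply a d) e) \<le> norm z * \<delta>"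
          by (simp add: norm_mult mult_mono)
      qed
      also have "\<dots> = (1 * (real (card E) * \<delta>)) * norm z" by simp
      also have "\<dots> \<le> \<epsilon> / 4 * norm z"
        using \<delta>(2) by (intro mult_right_mono) auto
      finally have 2: "cmod (cinner (blinfun_apply a d) (oproj E z)) \<le> \<epsilon> / 4 * norm z" .
      have "cinner (blinfun_apply a d) z
          = cinner (blinfun_apply a d) (z - oproj E z) + cinner (blinfun_apply a d) (oproj E z)"
        by (simp add: cinner_diff_right)
      then show "cmod (cinner (blinfun_apply a d) z) \<le> \<epsilon> / 2 * norm z"
        using 1 2 norm_triangle_ineq[of "cinner (blinfun_apply a d) (z - oproj E z)"
            "cinner (blinfun_apply a d) (oproj E z)"] by simp
    qed (use \<epsilon> in simp)
    then show "dist (blinfun_apply a v) (blinfun_apply a w) < \<epsilon>"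
      using \<epsilon> by (simp add: d_def dist_norm blinfun.diff_right)
  qed (use orthonormal_finite[OF E] \<delta> in auto)
qed

text \<open>F is a finite net for the image of the ball: a vector orthogonal to every centre pairs
  with \<open>a u\<close> as it does with the small difference from the nearest centre.\<close>

lemma compact_operator_left_tail:
  fixes a :: "'h::complex_inner \<Rightarrow>\<^sub>L 'h"
  assumes a: "compact_operator a" and \<epsilon>: "\<epsilon> > 0"
  obtains F where "finite F"
    "\<And>v w. perp F w \<Longrightarrow> cmod (cinner (blinfun_apply a v) w) \<le> \<epsilon> * norm v * norm w"
proof -
  obtain k where "finite k" "k \<subseteq> closure (blinfun_apply a ` cball 0 1)"
    and net: "\<forall>y\<in>blinfun_apply a ` cball 0 1. \<exists>c\<in>k. dist c y < \<epsilon>"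
    by (rule compact_closure_net[OF a[unfolded compact_operator_def] \<epsilon>])
  note k = \<open>finite k\<close> net[rule_format]
  have "cmod (cinner (blinfun_apply a v) w) \<le> \<epsilon> * norm v * norm w" if w: "perp k w" for v w
  proof (cases "v = 0")
    case True
    then show ?thesis by (simp add: cinner_zero_left)
  next
    case False
    define u where "u = (1 / norm v) *\<^sub>R v"
    have vu: "v = norm v *\<^sub>R u" and "norm u = 1" using False by (simp_all add: u_def)
    then obtain c where c: "c \<in> k" "dist c (blinfun_apply a u) < \<epsilon>"
      using k(2)[of "blinfun_apply a u"] by auto
    have "cinner c w = 0"
      using w c(1) cinner_commute[of c w] by (simp add: perp_def)
    then have "cmod (cinner (blinfun_apply a u) w) = cmod (cinner (blinfun_apply a u - c) w)"
      by (simp add: cinner_diff_left)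
    also have "\<dots> \<le> norm (blinfun_apply a u - c) * norm w"
      by (rule Cauchy_Schwarz_cinner)
    also have "\<dots> \<le> \<epsilon> * norm w"
      using c(2) by (intro mult_right_mono) (auto simp: dist_norm norm_minus_commute)
    finally have "norm v * cmod (cinner (blinfun_apply a u) w) \<le> norm v * (\<epsilon> * norm w)"
      by (rule mult_left_mono) simp
    moreover have "cinner (blinfun_apply a v) w = norm v *\<^sub>R cinner (blinfun_apply a u) w"
      by (subst vu) (simp only: blinfun.scaleR_right cinner.scaleR_left)
    ultimately show ?thesis
      by (simp add: mult.commute mult.left_commute)
  qed
  then show ?thesis using that k(1) by blast
qed

text \<open>Orthogonality of v to the adjoint images of the net centres c means that
  \<open>b v\<close> is orthogonal to each c. For a unit vector u and y = \<open>b u\<close>,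
  ||y||^2 = <y, y - c> with c the nearest centre bounds ||y|| by \<epsilon>.\<close>

lemma compact_operator_right_tail:
  fixes b :: "'h::{complex_inner, complete_space} \<Rightarrow>\<^sub>L 'h"
  assumes b: "compact_operator b" "b \<in> BH" and \<epsilon>: "\<epsilon> > 0"
  obtains F where "finite F" "\<And>v. perp F v \<Longrightarrow> norm (blinfun_apply b v) \<le> \<epsilon> * norm v"
proof -
  obtain k where "finite k" "k \<subseteq> closure (blinfun_apply b ` cball 0 1)"
    and net: "\<forall>y\<in>blinfun_apply b ` cball 0 1. \<exists>c\<in>k. dist c y < \<epsilon>"
    by (rule compact_closure_net[OF b(1)[unfolded compact_operator_def] \<epsilon>])
  note k = \<open>finite k\<close> net[rule_format]
  have "norm (blinfun_apply b v) \<le> \<epsilon> * norm v" if v: "perp (cadjoint b ` k) v" for v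
  proof (cases "v = 0")
    case False
    define u where "u = (1 / norm v) *\<^sub>R v"
    have vu: "v = norm v *\<^sub>R u" and "norm u = 1" using False by (simp_all add: u_def)
    then obtain c where c: "c \<in> k" "dist c (blinfun_apply b u) < \<epsilon>"
      using k(2)[of "blinfun_apply b u"] by auto
    define y where "y = blinfun_apply b u"
    have "cinner y c = 0"
      using v c(1) by (simp add: y_def cinner_cadjoint[OF b(2)] u_def perp_def cinner.scaleR_left)
    then have "cinner y y = cinner y (y - c)"
      by (simp add: cinner_diff_right)
    then have "(norm y)\<^sup>2 = cmod (cinner y (y - c))"
      by (metis cinner_norm norm_of_real abs_of_nonneg zero_le_power2)
    also have "\<dots> \<le> norm y * norm (y - c)"
      by (rule Cauchy_Schwarz_cinner)
    also have "\<dots> \<le> norm y * \<epsilon>"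
      using c(2) by (intro mult_left_mono) (auto simp: dist_norm y_def norm_minus_commute)
    finally have "norm y \<le> \<epsilon>"
      using \<epsilon> by (cases "y = 0") (simp_all add: power2_eq_square)
    then have "norm v * norm y \<le> norm v * \<epsilon>"
      by (rule mult_left_mono) simp
    moreover have "norm (blinfun_apply b v) = norm v * norm y"
      by (subst vu) (simp add: blinfun.scaleR_right y_def)
    ultimately show ?thesis by (simp add: mult.commute)
  qed simp
  then show ?thesis using that[of "cadjoint b ` k"] k(1) by blast
qed

subsection \<open>Weak neighbourhoods\<close>

lemma topspace_weak_topology: "topspace weak_topology = (UNIV :: 'h::complex_inner set)"
proof -
  have "(UNIV :: 'h set) \<in> {{x. cinner x y \<in> V} | y V. open (V :: complex set)}"
    by (rule CollectI, rule exI[of _ 0], rule exI[of _ UNIV]) simp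
  then show ?thesis
    unfolding weak_topology_def topology_generated_by_topspace by blast
qed

text \<open>One radius for all test vectors keeps intersections simple: unite the finite sets and
  take the smaller radius.\<close>

lemma weak_open_contains_nbhd:
  fixes U :: "'h::complex_inner set"
  assumes "openin weak_topology U" and "x \<in> U"
  shows "\<exists>F \<delta>. finite F \<and> \<delta> > 0 \<and> (\<forall>y. (\<forall>f\<in>F. cmod (cinner (y - x) f) < \<delta>) \<longrightarrow> y \<in> U)"
proof -
  have "generate_topology_on {{x :: 'h. cinner x y \<in> V} | y V. open (V :: complex set)} U"
    using assms(1) by (simp add: weak_topology_def openin_topology_generated_by_iff)
  then show ?thesis
    using assms(2)
  proof induction
    case (Int A B)
    obtain F \<delta> where F: "finite F" "\<delta> > 0" "\<forall>y. (\<forall>f\<in>F. cmod (cinner (y - x) f) < \<delta>) \<longrightarrow> y \<in> A"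
      using Int.IH(1) Int.prems by blast
    obtain G \<epsilon> where G: "finite G" "\<epsilon> > 0" "\<forall>y. (\<forall>f\<in>G. cmod (cinner (y - x) f) < \<epsilon>) \<longrightarrow> y \<in> B"
      using Int.IH(2) Int.prems by blast
    show ?case using F G
      by (intro exI[of _ "F \<union> G"] exI[of _ "min \<delta> \<epsilon>"]) auto
  next
    case (UN k)
    then obtain A where "A \<in> k" "x \<in> A" by blast
    then obtain F \<delta> where "finite F" "\<delta> > 0" "\<forall>y. (\<forall>f\<in>F. cmod (cinner (y - x) f) < \<delta>) \<longrightarrow> y \<in> A"
      using UN.IH[of A] by blast
    then show ?case
      using \<open>A \<in> k\<close> by (intro exI[of _ F] exI[of _ \<delta>]) blast
  next
    case (Basis s)
    then obtain y V where s: "s = {x. cinner x y \<in> V}" "open V" by blast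
    then obtain e where e: "e > 0" "\<And>z. dist z (cinner x y) < e \<Longrightarrow> z \<in> V"
      using Basis.prems unfolding open_dist by blast
    show ?case
    proof (intro exI[of _ "{y}"] exI[of _ e] conjI allI impI)
      fix z assume "\<forall>f\<in>{y}. cmod (cinner (z - x) f) < e"
      then show "z \<in> s"
        using e(2)[of "cinner z y"] by (simp add: s dist_norm cinner_diff_left)
    qed (use e in auto)
  qed simp
qed

lemma weak_nbhd_open:
  fixes x :: "'h::complex_inner"
  assumes "finite F"
  shows "openin weak_topology {y. \<forall>f\<in>F. cmod (cinner (y - x) f) < \<delta>}"
  using assms
proof (induction F rule: finite_induct)
  case empty
  show ?case
    using openin_topspace[of "weak_topology :: 'h topology"] by (simp add: topspace_weak_topology)
next
  case (insert g F)
  have "openin weak_topology {y. cinner y g \<in> ball (cinner x g) \<delta>}"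
    unfolding weak_topology_def by (rule topology_generated_by_Basis, rule CollectI, intro exI conjI, rule refl, rule open_ball)
  from openin_Int[OF this insert.IH] show ?case
    by (rule back_subst[of "openin weak_topology"])
      (auto simp: dist_norm cinner_diff_left norm_minus_commute)
qed

context
  fixes H1 :: "'h::complex_inner set" and W
  defines "H1 \<equiv> cball 0 1"
  defines "W \<equiv> prod_topology (subtopology weak_topology H1) (subtopology weak_topology H1)"
begin

lemma topspace_weak_prod: "topspace W = H1 \<times> H1"
  by (simp add: W_def topspace_weak_topology)

lemma weak_prod_nbhd:
  assumes "openin W U" and "(x0, y0) \<in> U"
  obtains F \<delta> where "finite F" "\<delta> > 0"
    "\<And>x y. x \<in> H1 \<Longrightarrow> y \<in> H1 \<Longrightarrow> (\<And>f. f \<in> F \<Longrightarrow> cmod (cinner (x - x0) f) < \<delta> \<and> cmod (cinner (y - y0) f) < \<delta>)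
      \<Longrightarrow> (x, y) \<in> U"
proof -
  obtain A' B' where AB': "openin (subtopology weak_topology H1) A'" "openin (subtopology weak_topology H1) B'"
    "x0 \<in> A'" "y0 \<in> B'" "A' \<times> B' \<subseteq> U"
    using assms(1)[unfolded W_def openin_prod_topology_alt, rule_format, OF assms(2)]
    by (elim exE conjE)
  obtain A where A: "openin weak_topology A" "A' = A \<inter> H1"
    using AB'(1) unfolding openin_subtopology by blast
  obtain B where B: "openin weak_topology B" "B' = B \<inter> H1"
    using AB'(2) unfolding openin_subtopology by blast
  have sub: "(A \<inter> H1) \<times> (B \<inter> H1) \<subseteq> U"
    using AB'(5) A(2) B(2) by simp
  have "x0 \<in> A" using AB'(3) A(2) by simp
  from weak_open_contains_nbhd[OF A(1) this]
  obtain F \<delta> where "finite F" "\<delta> > 0" and F: "\<forall>y. (\<forall>f\<in>F. cmod (cinner (y - x0) f) < \<delta>) \<longrightarrow> y \<in> A"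
    by (elim exE conjE)
  have "y0 \<in> B" using AB'(4) B(2) by simp
  from weak_open_contains_nbhd[OF B(1) this]
  obtain G \<epsilon> where "finite G" "\<epsilon> > 0" and G: "\<forall>y. (\<forall>f\<in>G. cmod (cinner (y - y0) f) < \<epsilon>) \<longrightarrow> y \<in> B"
    by (elim exE conjE)
  show ?thesis
  proof (rule that[of "F \<union> G" "min \<delta> \<epsilon>"])
    fix x y assume "x \<in> H1" "y \<in> H1"
      and c: "\<And>f. f \<in> F \<union> G \<Longrightarrow> cmod (cinner (x - x0) f) < min \<delta> \<epsilon> \<and> cmod (cinner (y - y0) f) < min \<delta> \<epsilon>"
    moreover have "x \<in> A" by (rule F[rule_format]) (use c in auto)
    moreover have "y \<in> B" by (rule G[rule_format]) (use c in auto)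
    ultimately show "(x, y) \<in> U" using sub by auto
  qed (use \<open>finite F\<close> \<open>finite G\<close> \<open>\<delta> > 0\<close> \<open>\<epsilon> > 0\<close> in auto)
qed

lemma weak_prod_open:
  assumes "finite F"
  shows "openin W ((H1 \<inter> {x. \<forall>f\<in>F. cmod (cinner (x - x0) f) < \<delta>})
      \<times> (H1 \<inter> {y. \<forall>f\<in>F. cmod (cinner (y - y0) f) < \<delta>}))"
  unfolding W_def using weak_nbhd_open[OF assms]
  by (simp add: openin_prod_Times_iff openin_subtopology_Int2 Int_commute)

end

section \<open>Elementary operators\<close>

lemma Qmat_eq_gram: "Qmat c \<eta> = gram (\<lambda>j. c j \<eta>)"
  by (simp add: Qmat_def gram_def)

lemma rank_one_operator:
  fixes z p :: "'h::complex_inner"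
  obtains x where "x \<in> BH" "norm x \<le> norm z * norm p" "blinfun_apply x = (\<lambda>v. scaleC (cinner v p) z)"
proof -
  define X where "X v = scaleC (cinner v p) z" for v
  have X_le: "norm (X v) \<le> norm z * norm p * norm v" for v
    using mult_right_mono[OF Cauchy_Schwarz_cinner[of v p], of "norm z"]
    by (simp add: X_def norm_scaleC mult.commute mult.left_commute)
  have bl: "bounded_linear X"
  proof (rule bounded_linear_intro[where K = "norm z * norm p"])
    show "norm (X v) \<le> norm v * (norm z * norm p)" for v
      using X_le[of v] by (simp add: mult.commute)
  qed (simp_all add: X_def cinner_add_left scaleC_add_left cinner.scaleR_left scaleC.scaleR_left)
  have ap: "blinfun_apply (Blinfun X) v = X v" for v
    using bl by (simp add: bounded_linear_Blinfun_apply)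
  show ?thesis
  proof (rule that[of "Blinfun X"])
    show "Blinfun X \<in> BH"
      by (simp add: BH_def ap X_def cinner_scaleC_left scaleC_scaleC)
    show "norm (Blinfun X) \<le> norm z * norm p"
      by (rule norm_blinfun_bound) (simp_all add: ap X_le)
    show "blinfun_apply (Blinfun X) = (\<lambda>v. scaleC (cinner v p) z)"
      by (simp add: fun_eq_iff ap X_def)
  qed
qed

lemma oproj_operator:
  fixes E :: "'h::complex_inner set"
  assumes E: "orthonormal E (\<lambda>e. e)"
  obtains q where "q \<in> BH" "norm q \<le> 1" "blinfun_apply q = oproj E"
proof -
  have bl: "bounded_linear (oproj E)"
  proof (rule bounded_linear_intro[where K = 1])
    show "norm (oproj E v) \<le> norm v * 1" for v
      using norm_oproj_le[OF E] by simp
  qed (simp_all add: oproj_def cinner_add_left scaleC_add_left sum.distrib cinner.scaleR_left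
      scaleC.scaleR_left scaleR_sum_right)
  have ap: "blinfun_apply (Blinfun (oproj E)) = oproj E"
    using bl by (simp add: bounded_linear_Blinfun_apply)
  show ?thesis
  proof (rule that[of "Blinfun (oproj E)"])
    show "Blinfun (oproj E) \<in> BH"
      by (simp add: BH_def ap oproj_def cinner_scaleC_left scaleC_scaleC scaleC.sum_right)
    show "norm (Blinfun (oproj E)) \<le> 1"
      by (rule norm_blinfun_bound) (simp_all add: ap norm_oproj_le[OF E])
  qed (rule ap)
qed

text \<open>A real-orthogonal complement suffices because the set of vectors is stable under \<open>\<i>\<close>.\<close>

lemma span_matrix_coefficients:
  fixes a :: "'l::finite \<Rightarrow> ('h::complex_inner \<Rightarrow>\<^sub>L 'h)"
  assumes "clin_indep a"
  shows "span {(\<chi> j. cinner (blinfun_apply (a j) z) w) | z w. True} = (UNIV :: (complex^'l) set)"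
proof (rule ccontr)
  let ?S = "{(\<chi> j. cinner (blinfun_apply (a j) z) w) | z w. True} :: (complex^'l) set"
  assume "span ?S \<noteq> UNIV"
  then obtain c where c: "c \<noteq> 0" "\<forall>x\<in>span ?S. c \<bullet> x = 0"
    using span_not_UNIV_orthogonal[of ?S] by blast
  have Re0: "Re (cinner (\<chi> j. cinner (blinfun_apply (a j) z) w) c) = 0" for z w
  proof -
    have "c \<bullet> (\<chi> j. cinner (blinfun_apply (a j) z) w) = 0"
      by (rule c(2)[rule_format], rule span_base) blast
    then show ?thesis
      by (simp add: inner_eq_Re_cinner Re_cinner_commute)
  qed
  have "cinner (\<chi> j. cinner (blinfun_apply (a j) z) w) c = 0" for z w
  proof (rule complex_eqI)
    have "(\<chi> j. cinner (blinfun_apply (a j) z) (scaleC \<i> w))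
        = scaleC (- \<i>) (\<chi> j. cinner (blinfun_apply (a j) z) w)"
      by (simp add: vec_eq_iff cinner_scaleC_right scaleC_complex_def)
    then show "Im (cinner (\<chi> j. cinner (blinfun_apply (a j) z) w) c) = Im 0"
      using Re0[of z "scaleC \<i> w"] by (simp add: cinner_scaleC_left)
  qed (simp add: Re0)
  then have sum0: "(\<Sum>j\<in>UNIV. cnj (c $ j) * cinner (blinfun_apply (a j) z) w) = 0" for z w
    by (simp add: cinner_vec_def cinner_complex_def mult.commute)
  have "(\<Sum>j\<in>UNIV. scaleC (cnj (c $ j)) (blinfun_apply (a j) z)) = 0" for z
    by (rule cinner_eqI) (simp add: cinner.sum_left cinner_scaleC_left sum0 cinner_zero_left)
  then have "\<forall>j. cnj (c $ j) = 0"
    using assms[unfolded clin_indep_def, rule_format, of "\<lambda>j. cnj (c $ j)"] by blast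
  then show False
    using c(1) by (simp add: vec_eq_iff)
qed

text \<open>The k-th unit vector is a finite real combination of the coefficient vectors <a j z, w>,
  so the bound transfers to the single term \<open>h p k\<close>. The combination depends only on
  \<open>a\<close> and k, hence so does C. P, h and N are abstract because the roles of the two
  coefficient families are later exchanged.\<close>

lemma coefficient_functional_bound:
  fixes a :: "'l::finite \<Rightarrow> ('h::complex_inner \<Rightarrow>\<^sub>L 'h)"
  assumes a: "clin_indep a"
    and bound: "\<And>z w p \<epsilon>. P \<epsilon> p \<Longrightarrow>
      cmod (\<Sum>j\<in>UNIV. cinner (blinfun_apply (a j) z) w * h p j) \<le> \<epsilon> * norm z * norm w * N p"
  shows "\<exists>C\<ge>0. \<forall>\<epsilon> p. P \<epsilon> p \<longrightarrow> cmod (h p k) \<le> C * \<epsilon> * N p"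
proof -
  \<comment> \<open>C is quantified before \<epsilon> and p, and the vectors with this property form
    a real subspace, as induction over \<open>span\<close> requires.\<close>
  define good where "good c \<longleftrightarrow> (\<exists>C\<ge>0. \<forall>\<epsilon> p. P \<epsilon> p \<longrightarrow> cmod (\<Sum>j\<in>UNIV. c $ j * h p j) \<le> C * \<epsilon> * N p)"
    for c :: "complex^'l"
  have "axis k 1 \<in> span {(\<chi> j. cinner (blinfun_apply (a j) z) w) | z w. True}"
    by (simp only: span_matrix_coefficients[OF a] UNIV_I)
  then have "good (axis k 1)"
  proof (induction rule: span_induct)
    case base
    show ?case
    proof (simp only: mem_Collect_eq subspace_def, intro conjI ballI allI)
      show "good 0"
        unfolding good_def by (rule exI[of _ 0]) simp
      fix x assume x: "x \<in> Collect good"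
      then obtain C where C: "C \<ge> 0" "\<And>\<epsilon> p. P \<epsilon> p \<Longrightarrow> cmod (\<Sum>j\<in>UNIV. x $ j * h p j) \<le> C * \<epsilon> * N p"
        unfolding good_def by blast
      show "good (r *\<^sub>R x)" for r
        unfolding good_def
      proof (intro exI[of _ "\<bar>r\<bar> * C"] conjI allI impI)
        fix \<epsilon> p assume "P \<epsilon> p"
        have "(\<Sum>j\<in>UNIV. (r *\<^sub>R x) $ j * h p j) = r *\<^sub>R (\<Sum>j\<in>UNIV. x $ j * h p j)"
          by (simp add: scaleR_sum_right)
        then show "cmod (\<Sum>j\<in>UNIV. (r *\<^sub>R x) $ j * h p j) \<le> \<bar>r\<bar> * C * \<epsilon> * N p"
          using mult_left_mono[OF C(2)[OF \<open>P \<epsilon> p\<close>], of "\<bar>r\<bar>"] by (simp add: mult.assoc)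
      qed (use C in simp)
      fix y assume y: "y \<in> Collect good"
      then obtain D where D: "D \<ge> 0" "\<And>\<epsilon> p. P \<epsilon> p \<Longrightarrow> cmod (\<Sum>j\<in>UNIV. y $ j * h p j) \<le> D * \<epsilon> * N p"
        unfolding good_def by blast
      show "good (x + y)"
        unfolding good_def
      proof (intro exI[of _ "C + D"] conjI allI impI)
        fix \<epsilon> p assume "P \<epsilon> p"
        have "(\<Sum>j\<in>UNIV. (x + y) $ j * h p j) = (\<Sum>j\<in>UNIV. x $ j * h p j) + (\<Sum>j\<in>UNIV. y $ j * h p j)"
          by (simp add: distrib_right sum.distrib)
        then show "cmod (\<Sum>j\<in>UNIV. (x + y) $ j * h p j) \<le> (C + D) * \<epsilon> * N p"
          using C(2)[OF \<open>P \<epsilon> p\<close>] D(2)[OF \<open>P \<epsilon> p\<close>]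
            norm_triangle_ineq[of "\<Sum>j\<in>UNIV. x $ j * h p j" "\<Sum>j\<in>UNIV. y $ j * h p j"]
          by (simp add: distrib_right)
      qed (use C D in simp)
    qed
  next
    case (step x)
    then obtain z w where x: "x = (\<chi> j. cinner (blinfun_apply (a j) z) w)" by blast
    show ?case
      unfolding good_def x
      using bound[of _ _ z w]
      by (intro exI[of _ "norm z * norm w"]) (simp add: mult.commute mult.left_commute)
  qed
  moreover have "(\<Sum>j\<in>UNIV. axis k 1 $ j * h p j) = h p k" for p
  proof -
    have "(\<Sum>j\<in>UNIV. axis k 1 $ j * h p j) = (\<Sum>j\<in>UNIV. if j = k then h p j else 0)"
      by (rule sum.cong) (auto simp: axis_def)
    then show ?thesis by simp
  qed
  ultimately show ?thesis
    unfolding good_def by simp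
qed

section \<open>Tightness of the image of the unit ball, compactness of the map and of its
  coefficients\<close>

context
  fixes a b :: "'l::finite \<Rightarrow> ('h::{complex_inner, complete_space} \<Rightarrow>\<^sub>L 'h)"
    and T :: "('h \<Rightarrow>\<^sub>L 'h) \<Rightarrow> ('h \<Rightarrow>\<^sub>L 'h)"
    and ball1 :: "('h \<Rightarrow>\<^sub>L 'h) set"
  assumes aB: "\<And>j. a j \<in> BH" and bB: "\<And>j. b j \<in> BH"
    and T_def: "\<And>x. T x = (\<Sum>j\<in>UNIV. a j o\<^sub>L x o\<^sub>L b j)"
  defines "ball1 \<equiv> {x \<in> BH. norm x \<le> 1}"
begin

lemma T_apply: "blinfun_apply (T x) v = (\<Sum>j\<in>UNIV. blinfun_apply (a j) (blinfun_apply x (blinfun_apply (b j) v)))"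
  by (simp add: T_def blinfun.sum_left)

lemma cinner_T: "cinner (blinfun_apply (T x) v) w
    = (\<Sum>j\<in>UNIV. cinner (blinfun_apply (a j) (blinfun_apply x (blinfun_apply (b j) v))) w)"
  by (simp add: T_apply cinner.sum_left)

lemma T_BH:
  assumes "x \<in> BH"
  shows "T x \<in> BH"
  by (subst BH_def) (simp add: T_apply BH_scaleC[OF aB] BH_scaleC[OF bB] BH_scaleC[OF assms] scaleC.sum_right)

lemma norm_T_le:
  assumes "norm x \<le> 1"
  shows "norm (T x) \<le> (\<Sum>j\<in>UNIV. norm (a j) * norm (b j))"
  unfolding T_def
proof (rule sum_norm_le)
  fix j
  have "norm (a j o\<^sub>L x o\<^sub>L b j) \<le> norm (a j) * norm x * norm (b j)"
    using norm_blinfun_compose[of "a j o\<^sub>L x" "b j"]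
      mult_right_mono[OF norm_blinfun_compose[of "a j" x], of "norm (b j)"] by simp
  also have "\<dots> \<le> norm (a j) * 1 * norm (b j)"
    using assms by (intro mult_right_mono mult_left_mono) auto
  finally show "norm (a j o\<^sub>L x o\<^sub>L b j) \<le> norm (a j) * norm (b j)" by simp
qed

text \<open>Each centre c of a finite net far from \<open>T x\<close> is shown to be far by one test
  vector. If \<open>T (q x)\<close> agrees with \<open>T x\<close> at all these vectors, then the
  centre near \<open>T (q x)\<close> cannot be far from \<open>T x\<close>, so the two images are
  close in norm.\<close>

lemma T_finite_rank_approximation:
  assumes T: "compact_map_BH T" and x: "x \<in> ball1" and \<epsilon>: "\<epsilon> > 0"
  obtains q E where "orthonormal E (\<lambda>e. e)" "blinfun_apply q = oproj E"
    "norm (T (q o\<^sub>L x) - T x) \<le> \<epsilon>"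
proof -
  define \<epsilon>1 where "\<epsilon>1 = \<epsilon> / 3"
  have \<epsilon>1: "\<epsilon>1 > 0" using \<epsilon> by (simp add: \<epsilon>1_def)
  have cl: "compact (closure (T ` ball1))"
    using T by (simp add: compact_map_BH_def ball1_def)
  obtain k where "finite k" "k \<subseteq> closure (T ` ball1)" and net: "\<forall>y\<in>T ` ball1. \<exists>c\<in>k. dist c y < \<epsilon>1"
    by (rule compact_closure_net[OF cl \<epsilon>1])
  note k = \<open>finite k\<close> net[rule_format]
  \<comment> \<open>A norm above 2 \<epsilon>1 is witnessed by a single vector; the implication lets
    one choice function cover all c.\<close>
  have "\<exists>v. norm (c - T x) > 2 * \<epsilon>1 \<longrightarrow> norm (blinfun_apply (c - T x) v) > 2 * \<epsilon>1 * norm v" for c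
  proof (rule ccontr)
    assume "\<not> ?thesis"
    then have far: "norm (c - T x) > 2 * \<epsilon>1"
      and "\<And>v. norm (blinfun_apply (c - T x) v) \<le> 2 * \<epsilon>1 * norm v" by (auto simp: not_less)
    then have "norm (c - T x) \<le> 2 * \<epsilon>1"
      using \<epsilon>1 by (intro norm_blinfun_bound) auto
    with far show False by simp
  qed
  then obtain v where v: "\<And>c. norm (c - T x) > 2 * \<epsilon>1 \<Longrightarrow> norm (blinfun_apply (c - T x) (v c)) > 2 * \<epsilon>1 * norm (v c)"
    by metis
  \<comment> \<open>The vectors that q has to fix so that \<open>T (q x)\<close> and
    \<open>T x\<close> agree at every test vector \<open>v c\<close>.\<close>
  define G where "G = (\<lambda>(j, c). blinfun_apply x (blinfun_apply (b j) (v c))) ` (UNIV \<times> k)"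
  have "finite G" using k(1) by (simp add: G_def)
  then obtain E where E: "orthonormal E (\<lambda>e. e)" "\<And>g. g \<in> G \<Longrightarrow> oproj E g = g"
    using Gram_Schmidt by blast
  obtain q where q: "q \<in> BH" "norm q \<le> 1" "blinfun_apply q = oproj E"
    by (rule oproj_operator[OF E(1)])
  have "q o\<^sub>L x \<in> ball1"
  proof -
    have "norm (q o\<^sub>L x) \<le> norm q * norm x"
      by (rule norm_blinfun_compose)
    also have "\<dots> \<le> 1 * 1"
      using q(2) x by (intro mult_mono) (auto simp: ball1_def)
    finally show ?thesis
      using q(1) x by (simp add: ball1_def BH_def)
  qed
  then obtain c where c: "c \<in> k" "dist c (T (q o\<^sub>L x)) < \<epsilon>1"
    using k(2) by blast
  have fix_v: "blinfun_apply (T (q o\<^sub>L x)) (v c) = blinfun_apply (T x) (v c)"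
    unfolding T_apply
  proof (rule sum.cong[OF refl])
    fix j
    have "blinfun_apply x (blinfun_apply (b j) (v c)) \<in> G"
      using c(1) by (auto simp: G_def)
    then show "blinfun_apply (a j) (blinfun_apply (q o\<^sub>L x) (blinfun_apply (b j) (v c)))
        = blinfun_apply (a j) (blinfun_apply x (blinfun_apply (b j) (v c)))"
      using E(2) by (simp add: q(3))
  qed
  have "norm (c - T x) \<le> 2 * \<epsilon>1"
  proof (rule ccontr)
    assume "\<not> ?thesis"
    then have "2 * \<epsilon>1 * norm (v c) < norm (blinfun_apply (c - T x) (v c))"
      by (intro v) simp
    also have "blinfun_apply (c - T x) (v c) = blinfun_apply (c - T (q o\<^sub>L x)) (v c)"
      by (simp add: blinfun.diff_left fix_v)
    also have "norm \<dots> \<le> norm (c - T (q o\<^sub>L x)) * norm (v c)"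
      by (rule norm_blinfun)
    also have "\<dots> \<le> 2 * \<epsilon>1 * norm (v c)"
      using c(2) \<epsilon>1 by (intro mult_right_mono) (auto simp: dist_norm)
    finally show False by simp
  qed
  then have "norm (T (q o\<^sub>L x) - T x) \<le> \<epsilon>"
    using norm_triangle_ineq4[of "c - T x" "c - T (q o\<^sub>L x)"] c(2)
    by (simp add: dist_norm \<epsilon>1_def)
  then show ?thesis by (rule that[OF E(1) q(3)])
qed

text \<open>A single \<open>T x\<close> has small tails, being close to some \<open>T (q x)\<close>
  whose tails vanish outside a finite set. A finite net makes the choice of the finite set
  uniform.\<close>

lemma tight_if_compact_map:
  assumes T: "compact_map_BH T"
  shows "tight (T ` ball1)"
proof -
  have single: "\<exists>F. finite F \<and> tail F \<epsilon> (T x)" if x: "x \<in> ball1" and \<epsilon>: "\<epsilon> > 0" for x \<epsilon>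
  proof -
    obtain q E where E: "orthonormal E (\<lambda>e. e)" and q: "blinfun_apply q = oproj E"
      and near: "norm (T (q o\<^sub>L x) - T x) \<le> \<epsilon>"
      by (rule T_finite_rank_approximation[OF T x \<epsilon>])
    have xB: "x \<in> BH" using x by (simp add: ball1_def)
    \<comment> \<open>The form of \<open>T (q x)\<close> is a sum of products <x (b j v), e> <a j e,
      w>; orthogonality of v to the first kind of vectors kills the first factors, orthogonality of
      w to the second kind the second factors.\<close>
    define F where "F = (\<Union>e\<in>E. \<Union>j. {cadjoint (b j) (cadjoint x e), blinfun_apply (a j) e})"
    have "tail F 0 (T (q o\<^sub>L x))"
      unfolding tail_def
    proof (intro allI impI)
      fix v w assume perp: "perp F v \<or> perp F w"
      have summand: "cinner (blinfun_apply x (blinfun_apply (b j) v)) e * cinner (blinfun_apply (a j) e) w = 0"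
        if e: "e \<in> E" for j e
        using perp
      proof
        assume "perp F v"
        then have "cinner v (cadjoint (b j) (cadjoint x e)) = 0"
          using e by (auto simp: perp_def F_def)
        then show ?thesis
          by (simp add: cinner_cadjoint[OF xB] cinner_cadjoint[OF bB])
      next
        assume "perp F w"
        then have "cinner w (blinfun_apply (a j) e) = 0"
          using e by (auto simp: perp_def F_def)
        then show ?thesis
          using cinner_commute[of "blinfun_apply (a j) e" w] by simp
      qed
      have "cinner (blinfun_apply (T (q o\<^sub>L x)) v) w = (\<Sum>j\<in>UNIV. \<Sum>e\<in>E.
          cinner (blinfun_apply x (blinfun_apply (b j) v)) e * cinner (blinfun_apply (a j) e) w)"
        unfolding cinner_T by (simp add: q BH_oproj[OF aB] cinner.sum_left cinner_scaleC_left)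
      also have "\<dots> = 0"
        by (intro sum.neutral ballI) (rule summand)
      finally show "cmod (cinner (blinfun_apply (T (q o\<^sub>L x)) v) w) \<le> 0 * norm v * norm w" by simp
    qed
    then have "tail F (0 + \<epsilon>) (T x)"
      by (rule tail_perturb) (use near in \<open>simp add: norm_minus_commute\<close>)
    moreover have "finite F"
      using orthonormal_finite[OF E] by (simp add: F_def)
    ultimately show ?thesis by auto
  qed
  show ?thesis
    unfolding tight_def
  proof (intro allI impI)
    fix \<epsilon> :: real assume \<epsilon>: "\<epsilon> > 0"
    \<comment> \<open>One third each for the tail of an image point near the centre, the distance
      from it to the centre, and the distance from the centre to y.\<close>
    define \<epsilon>1 where "\<epsilon>1 = \<epsilon> / 3"
    have \<epsilon>1: "\<epsilon>1 > 0" using \<epsilon> by (simp add: \<epsilon>1_def)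
    have cl: "compact (closure (T ` ball1))"
      using T by (simp add: compact_map_BH_def ball1_def)
    obtain k where k: "finite k" "k \<subseteq> closure (T ` ball1)" "\<forall>y\<in>T ` ball1. \<exists>c\<in>k. dist c y < \<epsilon>1"
      by (rule compact_closure_net[OF cl \<epsilon>1])
    have "\<exists>F. finite F \<and> tail F (\<epsilon>1 + \<epsilon>1) c" if ck: "c \<in> k" for c
    proof -
      obtain x where x: "x \<in> ball1" "dist (T x) c < \<epsilon>1"
        using k(2) ck \<epsilon>1 closure_approachable[of c "T ` ball1"] by blast
      obtain F where F: "finite F" "tail F \<epsilon>1 (T x)"
        using single[OF x(1) \<epsilon>1] by blast
      have "norm (c - T x) \<le> \<epsilon>1"
        using x(2) by (simp add: dist_norm norm_minus_commute)
      then show ?thesis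
        using tail_perturb[OF F(2)] F(1) by blast
    qed
    then obtain F where F: "\<And>c. c \<in> k \<Longrightarrow> finite (F c) \<and> tail (F c) (\<epsilon>1 + \<epsilon>1) c"
      by metis
    have "tail (\<Union>c\<in>k. F c) \<epsilon> y" if y: "y \<in> T ` ball1" for y
    proof -
      obtain c where c: "c \<in> k" "dist c y < \<epsilon>1" using bspec[OF k(3) y] by blast
      have "tail (F c) (\<epsilon>1 + \<epsilon>1 + \<epsilon>1) y"
        by (rule tail_perturb[OF conjunct2[OF F[OF c(1)]]]) (use c(2) in \<open>simp add: dist_norm norm_minus_commute\<close>)
      then have "tail (F c) \<epsilon> y" by (simp add: \<epsilon>1_def)
      then show ?thesis
        by (rule tail_mono) (use c(1) in blast)
    qed
    moreover have "finite (\<Union>c\<in>k. F c)"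
      using k(1) F by blast
    ultimately show "\<exists>F. finite F \<and> (\<forall>y\<in>T ` ball1. tail F \<epsilon> y)" by blast
  qed
qed

lemma compact_map_if_tight:
  assumes "tight (T ` ball1)"
  shows "compact_map_BH T"
  unfolding compact_map_BH_def ball1_def[symmetric]
proof (rule compact_closure_tight[OF assms])
  show "T ` ball1 \<subseteq> BH"
    using T_BH by (auto simp: ball1_def)
  show "norm y \<le> (\<Sum>j\<in>UNIV. norm (a j) * norm (b j))" if "y \<in> T ` ball1" for y
    using that norm_T_le by (auto simp: ball1_def)
qed

text \<open>In the term of index j, a tail vector v is absorbed by the compact \<open>b j\<close>, a
  tail vector w by the compact \<open>a j\<close>; the contraction between them does no harm. C
  collects the norms of the other factors.\<close>

lemma tight_if_compact_coefficients:
  assumes "\<And>j. compact_operator (a j)" and "\<And>j. compact_operator (b j)"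
  shows "tight (T ` ball1)"
  unfolding tight_def
proof (intro allI impI)
  fix \<epsilon> :: real assume \<epsilon>: "\<epsilon> > 0"
  define C where "C = (\<Sum>j\<in>UNIV. norm (a j) + norm (b j))"
  have C: "C \<ge> 0" by (simp add: C_def sum_nonneg)
  obtain \<delta> where \<delta>: "\<delta> > 0" "1 * (C * \<delta>) \<le> \<epsilon>"
    using small_multiple[of \<epsilon> C 1] \<epsilon> C by auto
  have "\<exists>F. finite F \<and> (\<forall>v w. perp F w \<longrightarrow> cmod (cinner (blinfun_apply (a j) v) w) \<le> \<delta> * norm v * norm w)" for j
    using compact_operator_left_tail[OF assms(1) \<delta>(1)] by metis
  then obtain F where F: "\<And>j. finite (F j)"
    "\<And>j v w. perp (F j) w \<Longrightarrow> cmod (cinner (blinfun_apply (a j) v) w) \<le> \<delta> * norm v * norm w"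
    by metis
  have "\<exists>F. finite F \<and> (\<forall>v. perp F v \<longrightarrow> norm (blinfun_apply (b j) v) \<le> \<delta> * norm v)" for j
    using compact_operator_right_tail[OF assms(2) bB \<delta>(1)] by metis
  then obtain G where G: "\<And>j. finite (G j)"
    "\<And>j v. perp (G j) v \<Longrightarrow> norm (blinfun_apply (b j) v) \<le> \<delta> * norm v"
    by metis
  define U where "U = (\<Union>j. F j \<union> G j)"
  have "tail U \<epsilon> (T x)" if x: "x \<in> ball1" for x
    unfolding tail_def
  proof (intro allI impI)
    fix v w assume perp: "perp U v \<or> perp U w"
    have xv: "norm (blinfun_apply x z) \<le> norm z" for z
    proof -
      have "norm (blinfun_apply x z) \<le> norm x * norm z" by (rule norm_blinfun)
      also have "\<dots> \<le> 1 * norm z"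
        using x by (intro mult_right_mono) (auto simp: ball1_def)
      finally show ?thesis by simp
    qed
    have "cmod (cinner (blinfun_apply (T x) v) w) \<le> (\<Sum>j\<in>UNIV. (norm (a j) + norm (b j)) * (\<delta> * norm v * norm w))"
      unfolding cinner_T
    proof (rule sum_norm_le)
      fix j
      define z where "z = blinfun_apply x (blinfun_apply (b j) v)"
      have zb: "norm z \<le> norm (blinfun_apply (b j) v)" unfolding z_def by (rule xv)
      have pos: "0 \<le> \<delta> * norm v * norm w" using \<delta> by simp
      have "cmod (cinner (blinfun_apply (a j) z) w) \<le> (norm (a j) + norm (b j)) * (\<delta> * norm v * norm w)"
        using perp
      proof
        assume "perp U v"
        then have "norm (blinfun_apply (b j) v) \<le> \<delta> * norm v"
          by (intro G perp_mono[of "G j" U]) (auto simp: U_def)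
        then have "norm (a j) * norm z * norm w \<le> norm (a j) * (\<delta> * norm v) * norm w"
          using zb by (intro mult_right_mono mult_left_mono) auto
        then have "cmod (cinner (blinfun_apply (a j) z) w) \<le> norm (a j) * (\<delta> * norm v * norm w)"
          using cmod_cinner_blinfun_le[of "a j" z w] by (simp add: mult.assoc)
        also have "\<dots> \<le> (norm (a j) + norm (b j)) * (\<delta> * norm v * norm w)"
          using pos by (intro mult_right_mono) auto
        finally show ?thesis .
      next
        assume "perp U w"
        then have "cmod (cinner (blinfun_apply (a j) z) w) \<le> \<delta> * norm z * norm w"
          by (intro F perp_mono[of "F j" U]) (auto simp: U_def)
        also have "\<dots> \<le> \<delta> * (norm (b j) * norm v) * norm w"
          using zb norm_blinfun[of "b j" v] \<delta>(1) by (intro mult_right_mono mult_left_mono) auto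
        also have "\<dots> = norm (b j) * (\<delta> * norm v * norm w)" by simp
        also have "\<dots> \<le> (norm (a j) + norm (b j)) * (\<delta> * norm v * norm w)"
          using pos by (intro mult_right_mono) auto
        finally show ?thesis .
      qed
      then show "cmod (cinner (blinfun_apply (a j) (blinfun_apply x (blinfun_apply (b j) v))) w)
          \<le> (norm (a j) + norm (b j)) * (\<delta> * norm v * norm w)"
        by (simp only: z_def)
    qed
    also have "\<dots> = (1 * (C * \<delta>)) * (norm v * norm w)"
      by (simp add: C_def sum_distrib_right[symmetric] mult.assoc)
    also have "\<dots> \<le> \<epsilon> * (norm v * norm w)"
      using \<delta>(2) by (intro mult_right_mono) auto
    finally show "cmod (cinner (blinfun_apply (T x) v) w) \<le> \<epsilon> * norm v * norm w"
      by (simp add: mult.assoc)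
  qed
  moreover have "finite U"
    using F(1) G(1) by (simp add: U_def)
  ultimately show "\<exists>F. finite F \<and> (\<forall>y\<in>T ` ball1. tail F \<epsilon> y)"
    by (intro exI[of _ U]) auto
qed

text \<open>Evaluates \<open>T\<close> at the contraction obtained by normalising the rank one
  operator <., p> z, which separates the forms of \<open>a j\<close> and \<open>b j\<close>;
  clearing the normalisation gives the factors ||z|| and ||p||.\<close>

lemma tail_T_rank_one:
  assumes tail: "\<And>y. y \<in> T ` ball1 \<Longrightarrow> tail F \<epsilon> y" and perp: "perp F v \<or> perp F w"
  shows "cmod (\<Sum>j\<in>UNIV. cinner (blinfun_apply (a j) z) w * cinner (blinfun_apply (b j) v) p)
    \<le> \<epsilon> * norm z * norm w * (norm v * norm p)"
proof (cases "z = 0 \<or> p = 0")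
  case True
  then show ?thesis
    by (auto simp: cinner_zero_left cinner_zero_right)
next
  case False
  define n where "n = norm z * norm p"
  have n: "n > 0" using False by (simp add: n_def)
  define z' where "z' = (1 / n) *\<^sub>R z"
  obtain x where x: "x \<in> BH" "norm x \<le> norm z' * norm p" "blinfun_apply x = (\<lambda>v. scaleC (cinner v p) z')"
    by (rule rank_one_operator[of z' p])
  have "norm z' * norm p = 1"
    using n False by (simp add: z'_def n_def)
  then have "x \<in> ball1" using x by (simp add: ball1_def)
  then have "cmod (cinner (blinfun_apply (T x) v) w) \<le> \<epsilon> * norm v * norm w"
    using tail[of "T x"] perp unfolding tail_def by blast
  moreover have "cinner (blinfun_apply (T x) v) w
      = (1 / n) *\<^sub>R (\<Sum>j\<in>UNIV. cinner (blinfun_apply (a j) z) w * cinner (blinfun_apply (b j) v) p)"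
    unfolding cinner_T x(3) BH_scaleC[OF aB] z'_def scaleR_sum_right
    by (simp add: blinfun.scaleR_right cinner_scaleC_left cinner.scaleR_left mult.commute)
  ultimately have "(1 / n) * cmod (\<Sum>j\<in>UNIV. cinner (blinfun_apply (a j) z) w * cinner (blinfun_apply (b j) v) p)
      \<le> \<epsilon> * norm v * norm w"
    using n by simp
  then show ?thesis
    using n by (simp add: n_def field_simps)
qed

text \<open>Independence of \<open>a\<close> isolates a single \<open>b k\<close> in the rank one
  tests, giving its right tail; independence of \<open>b\<close> isolates \<open>a k\<close>, giving
  its left tail.\<close>

lemma compact_coefficients_if_tight:
  assumes tight: "tight (T ` ball1)" and a: "clin_indep a" and b: "clin_indep b"
  shows "compact_operator (a k)" and "compact_operator (b k)"
proof -
  let ?P = "\<lambda>F \<epsilon>. \<forall>y\<in>T ` ball1. tail F \<epsilon> y"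
  \<comment> \<open>F is bound inside the hypothesis, so C depends on neither F nor \<epsilon>;
    afterwards \<delta> is chosen from C and F from \<delta>.\<close>
  have "\<exists>C\<ge>0. \<forall>\<epsilon> p. (\<exists>F. ?P F \<epsilon> \<and> perp F (fst p)) \<longrightarrow>
      cmod (cinner (blinfun_apply (b k) (fst p)) (snd p)) \<le> C * \<epsilon> * (norm (fst p) * norm (snd p))"
  proof (rule coefficient_functional_bound[OF a])
    fix z w :: 'h and q :: "'h \<times> 'h" and \<epsilon>
    assume "\<exists>F. ?P F \<epsilon> \<and> perp F (fst q)"
    then obtain F where F: "?P F \<epsilon>" "perp F (fst q)" by blast
    show "cmod (\<Sum>j\<in>UNIV. cinner (blinfun_apply (a j) z) w * cinner (blinfun_apply (b j) (fst q)) (snd q))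
        \<le> \<epsilon> * norm z * norm w * (norm (fst q) * norm (snd q))"
      by (rule tail_T_rank_one[OF bspec[OF F(1)]]) (use F(2) in simp_all)
  qed
  then obtain C where C: "C \<ge> 0" and Cb: "\<forall>\<epsilon> p. (\<exists>F. ?P F \<epsilon> \<and> perp F (fst p)) \<longrightarrow>
      cmod (cinner (blinfun_apply (b k) (fst p)) (snd p)) \<le> C * \<epsilon> * (norm (fst p) * norm (snd p))"
    by (elim exE conjE)
  show "compact_operator (b k)"
  proof (rule compact_operator_if_right_tail)
    fix \<epsilon> :: real assume "\<epsilon> > 0"
    then obtain \<delta> where \<delta>: "\<delta> > 0" "1 * (C * \<delta>) \<le> \<epsilon>"
      using small_multiple[of \<epsilon> C 1] C by auto
    obtain F where F: "finite F" "?P F \<delta>"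
      using tight \<delta>(1) unfolding tight_def by blast
    have "norm (blinfun_apply (b k) v) \<le> \<epsilon> * norm v" if "perp F v" for v
    proof (rule norm_le_if_cinner_le)
      fix w
      have "cmod (cinner (blinfun_apply (b k) v) w) \<le> C * \<delta> * (norm v * norm w)"
        using Cb[rule_format, of \<delta> "(v, w)"] F(2) that by auto
      also have "\<dots> \<le> \<epsilon> * (norm v * norm w)"
        using \<delta>(2) by (intro mult_right_mono) auto
      finally show "cmod (cinner (blinfun_apply (b k) v) w) \<le> \<epsilon> * norm v * norm w"
        by (simp add: mult.assoc)
    qed (use \<open>\<epsilon> > 0\<close> in simp)
    then show "\<exists>F. finite F \<and> (\<forall>v. perp F v \<longrightarrow> norm (blinfun_apply (b k) v) \<le> \<epsilon> * norm v)"
      using F(1) by blast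
  qed
  have "\<exists>D\<ge>0. \<forall>\<epsilon> p. (\<exists>F. ?P F \<epsilon> \<and> perp F (snd p)) \<longrightarrow>
      cmod (cinner (blinfun_apply (a k) (fst p)) (snd p)) \<le> D * \<epsilon> * (norm (fst p) * norm (snd p))"
  proof (rule coefficient_functional_bound[OF b])
    fix v p :: 'h and q :: "'h \<times> 'h" and \<epsilon>
    assume "\<exists>F. ?P F \<epsilon> \<and> perp F (snd q)"
    then obtain F where F: "?P F \<epsilon>" "perp F (snd q)" by blast
    have "cmod (\<Sum>j\<in>UNIV. cinner (blinfun_apply (a j) (fst q)) (snd q) * cinner (blinfun_apply (b j) v) p)
        \<le> \<epsilon> * norm (fst q) * norm (snd q) * (norm v * norm p)"
      by (rule tail_T_rank_one[OF bspec[OF F(1)]]) (use F(2) in simp_all)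
    then show "cmod (\<Sum>j\<in>UNIV. cinner (blinfun_apply (b j) v) p * cinner (blinfun_apply (a j) (fst q)) (snd q))
        \<le> \<epsilon> * norm v * norm p * (norm (fst q) * norm (snd q))"
      by (simp add: mult.commute mult.left_commute)
  qed
  then obtain D where D: "D \<ge> 0" and Db: "\<forall>\<epsilon> p. (\<exists>F. ?P F \<epsilon> \<and> perp F (snd p)) \<longrightarrow>
      cmod (cinner (blinfun_apply (a k) (fst p)) (snd p)) \<le> D * \<epsilon> * (norm (fst p) * norm (snd p))"
    by (elim exE conjE)
  show "compact_operator (a k)"
  proof (rule compact_operator_if_left_tail)
    fix \<epsilon> :: real assume "\<epsilon> > 0"
    then obtain \<delta> where \<delta>: "\<delta> > 0" "1 * (D * \<delta>) \<le> \<epsilon>"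
      using small_multiple[of \<epsilon> D 1] D by auto
    obtain F where F: "finite F" "?P F \<delta>"
      using tight \<delta>(1) unfolding tight_def by blast
    have "cmod (cinner (blinfun_apply (a k) v) w) \<le> \<epsilon> * norm v * norm w" if "perp F w" for v w
    proof -
      have "cmod (cinner (blinfun_apply (a k) v) w) \<le> D * \<delta> * (norm v * norm w)"
        using Db[rule_format, of \<delta> "(v, w)"] F(2) that by auto
      also have "\<dots> \<le> \<epsilon> * (norm v * norm w)"
        using \<delta>(2) by (intro mult_right_mono) auto
      finally show ?thesis by (simp add: mult.assoc)
    qed
    then show "\<exists>F. finite F \<and> (\<forall>v w. perp F w \<longrightarrow> cmod (cinner (blinfun_apply (a k) v) w) \<le> \<epsilon> * norm v * norm w)"
      using F(1) by blast
  qed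
qed

end

section \<open>Weak continuity\<close>

lemma continuous_at_in_if_continuous_map:
  assumes "continuous_map X Y f" and "p \<in> topspace X"
  shows "continuous_at_in X Y f p"
  unfolding continuous_at_in_def
proof (intro conjI allI impI)
  fix V assume V: "openin Y V \<and> f p \<in> V"
  show "\<exists>U. openin X U \<and> p \<in> U \<and> f ` U \<subseteq> V"
  proof (intro exI[of _ "{q \<in> topspace X. f q \<in> V}"] conjI)
    show "openin X {q \<in> topspace X. f q \<in> V}"
      using assms(1) V by (simp add: continuous_map)
  qed (use assms(2) V in auto)
qed (fact assms(2))

text \<open>Continuity on \<open>H1\<close> yields bounds only for vectors of the unit ball; this
  and its counterpart for the other slot restore the homogeneous bounds that \<open>tail\<close>
  requires.\<close>

lemma cinner_bound_scale_left:
  fixes y :: "'h::complex_inner \<Rightarrow>\<^sub>L 'h"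
  assumes bound: "\<And>v. norm v \<le> 1 \<Longrightarrow> perp F v \<Longrightarrow> cmod (cinner (blinfun_apply y v) w) \<le> c"
    and v: "perp F v"
  shows "cmod (cinner (blinfun_apply y v) w) \<le> c * norm v"
proof (cases "v = 0")
  case True
  then show ?thesis by (simp add: cinner_zero_left)
next
  case False
  define u where "u = (1 / norm v) *\<^sub>R v"
  have vu: "v = norm v *\<^sub>R u" and u: "norm u \<le> 1" using False by (simp_all add: u_def)
  have "perp F u"
    using v by (simp add: u_def perp_def cinner.scaleR_left)
  then have "norm v * cmod (cinner (blinfun_apply y u) w) \<le> norm v * c"
    by (intro mult_left_mono bound u) auto
  moreover have "cinner (blinfun_apply y v) w = norm v *\<^sub>R cinner (blinfun_apply y u) w"
    by (subst vu) (simp only: blinfun.scaleR_right cinner.scaleR_left)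
  ultimately show ?thesis by (simp add: mult.commute)
qed

lemma cinner_bound_scale_right:
  fixes z :: "'h::complex_inner"
  assumes bound: "\<And>w. norm w \<le> 1 \<Longrightarrow> perp F w \<Longrightarrow> cmod (cinner z w) \<le> c"
    and w: "perp F w"
  shows "cmod (cinner z w) \<le> c * norm w"
proof (cases "w = 0")
  case True
  then show ?thesis by (simp add: cinner_zero_right)
next
  case False
  define u where "u = (1 / norm w) *\<^sub>R w"
  have wu: "w = norm w *\<^sub>R u" and u: "norm u \<le> 1" using False by (simp_all add: u_def)
  have "perp F u"
    using w by (simp add: u_def perp_def cinner.scaleR_left)
  then have "norm w * cmod (cinner z u) \<le> norm w * c"
    by (intro mult_left_mono bound u) auto
  moreover have "cinner z w = norm w *\<^sub>R cinner z u"
    by (subst wu) (simp only: cinner.scaleR_right)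
  ultimately show ?thesis by (simp add: mult.commute)
qed

context
  fixes a b :: "'l::finite \<Rightarrow> ('h::{complex_inner, complete_space} \<Rightarrow>\<^sub>L 'h)"
    and T :: "('h \<Rightarrow>\<^sub>L 'h) \<Rightarrow> ('h \<Rightarrow>\<^sub>L 'h)"
    and f :: "'h \<times> 'h \<Rightarrow> complex"
    and ball1 :: "('h \<Rightarrow>\<^sub>L 'h) set"
    and H1 :: "'h set" and W :: "('h \<times> 'h) topology"
  assumes aB: "\<And>j. a j \<in> BH" and bB: "\<And>j. b j \<in> BH"
    and T_def: "\<And>x. T x = (\<Sum>j\<in>UNIV. a j o\<^sub>L x o\<^sub>L b j)"
    and f_def: "\<And>\<xi> \<eta>. f (\<xi>, \<eta>) =
                   tgm (Qmat (\<lambda>j. cadjoint (a j)) \<xi>) (Qmat (\<lambda>j. blinfun_apply (b j)) \<eta>)"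
  defines "ball1 \<equiv> {x \<in> BH. norm x \<le> 1}"
  defines "H1 \<equiv> cball 0 1"
  defines "W \<equiv> prod_topology (subtopology weak_topology H1) (subtopology weak_topology H1)"
begin

text \<open>The duality \<open>tgm_gram\<close> for the families \<open>cadjoint (a j) \<xi>\<close>
  and \<open>b j \<eta>\<close>: moving the adjoints across the inner product assembles the sum into
  <T x \<eta>, \<xi>>.\<close>

lemma f_eq_max:
  "\<exists>r. f (\<xi>, \<eta>) = of_real r \<and> (\<forall>x\<in>ball1. cmod (cinner (blinfun_apply (T x) \<eta>) \<xi>) \<le> r) \<and>
     (\<exists>x\<in>ball1. cmod (cinner (blinfun_apply (T x) \<eta>) \<xi>) = r)"
proof (rule tgm_gram[of "\<lambda>j. cadjoint (a j) \<xi>" "\<lambda>j. blinfun_apply (b j) \<eta>"])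
  fix r
  have eq: "(\<Sum>j\<in>UNIV. cinner (blinfun_apply x (blinfun_apply (b j) \<eta>)) (cadjoint (a j) \<xi>))
      = cinner (blinfun_apply (T x) \<eta>) \<xi>" for x
    by (simp add: cinner_T[OF aB bB T_def] cinner_cadjoint[OF aB])
  assume "tgm (gram (\<lambda>j. cadjoint (a j) \<xi>)) (gram (\<lambda>j. blinfun_apply (b j) \<eta>)) = of_real r"
    and le: "\<And>x. x \<in> BH \<Longrightarrow> norm x \<le> 1 \<Longrightarrow>
      cmod (\<Sum>j\<in>UNIV. cinner (blinfun_apply x (blinfun_apply (b j) \<eta>)) (cadjoint (a j) \<xi>)) \<le> r"
    and attained: "\<exists>x\<in>BH. norm x \<le> 1 \<and>
      cmod (\<Sum>j\<in>UNIV. cinner (blinfun_apply x (blinfun_apply (b j) \<eta>)) (cadjoint (a j) \<xi>)) = r"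
  then have "f (\<xi>, \<eta>) = of_real r"
    by (simp add: f_def Qmat_eq_gram)
  moreover have "\<forall>x\<in>ball1. cmod (cinner (blinfun_apply (T x) \<eta>) \<xi>) \<le> r"
    using le unfolding eq ball1_def by blast
  moreover have "\<exists>x\<in>ball1. cmod (cinner (blinfun_apply (T x) \<eta>) \<xi>) = r"
    using attained unfolding eq ball1_def by blast
  ultimately show ?thesis by blast
qed

lemma cinner_T_le_f: "x \<in> ball1 \<Longrightarrow> cmod (cinner (blinfun_apply (T x) \<eta>) \<xi>) \<le> cmod (f (\<xi>, \<eta>))"
proof -
  assume x: "x \<in> ball1"
  obtain r where r: "f (\<xi>, \<eta>) = of_real r" "\<forall>x\<in>ball1. cmod (cinner (blinfun_apply (T x) \<eta>) \<xi>) \<le> r"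
    using f_eq_max by blast
  have "cmod (cinner (blinfun_apply (T x) \<eta>) \<xi>) \<le> r"
    using r(2) x by (rule bspec)
  also have "r \<le> cmod (f (\<xi>, \<eta>))"
    by (simp add: r(1))
  finally show ?thesis .
qed

lemma f_zero:
  assumes "\<xi> = 0 \<or> \<eta> = 0"
  shows "f (\<xi>, \<eta>) = 0"
proof -
  obtain r where r: "f (\<xi>, \<eta>) = of_real r" "\<exists>x\<in>ball1. cmod (cinner (blinfun_apply (T x) \<eta>) \<xi>) = r"
    using f_eq_max by blast
  then have "r = 0"
    using assms by (auto simp: cinner_zero_left cinner_zero_right)
  then show ?thesis using r(1) by simp
qed

text \<open>Maxima over the same index set differ by no more than the indexed values do: evaluate
  both forms at a maximiser of the first, then at one of the second.\<close>

lemma f_diff_le: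
  assumes close: "\<And>x. x \<in> ball1 \<Longrightarrow>
    cmod (cinner (blinfun_apply (T x) \<eta>) \<xi> - cinner (blinfun_apply (T x) \<eta>') \<xi>') \<le> c"
  shows "cmod (f (\<xi>, \<eta>) - f (\<xi>', \<eta>')) \<le> c"
proof -
  obtain r x where r: "f (\<xi>, \<eta>) = of_real r" "\<forall>x\<in>ball1. cmod (cinner (blinfun_apply (T x) \<eta>) \<xi>) \<le> r"
    and x: "x \<in> ball1" "cmod (cinner (blinfun_apply (T x) \<eta>) \<xi>) = r"
    using f_eq_max[of \<xi> \<eta>] by blast
  obtain r' x' where r': "f (\<xi>', \<eta>') = of_real r'" "\<forall>x\<in>ball1. cmod (cinner (blinfun_apply (T x) \<eta>') \<xi>') \<le> r'"
    and x': "x' \<in> ball1" "cmod (cinner (blinfun_apply (T x') \<eta>') \<xi>') = r'"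
    using f_eq_max[of \<xi>' \<eta>'] by blast
  have "r - r' \<le> c"
    using close[OF x(1)] bspec[OF r'(2) x(1)] x(2)
      norm_triangle_ineq2[of "cinner (blinfun_apply (T x) \<eta>) \<xi>" "cinner (blinfun_apply (T x) \<eta>') \<xi>'"]
    by linarith
  moreover have "r' - r \<le> c"
    using close[OF x'(1)] bspec[OF r(2) x'(1)] x'(2)
      norm_triangle_ineq3[of "cinner (blinfun_apply (T x') \<eta>) \<xi>" "cinner (blinfun_apply (T x') \<eta>') \<xi>'"]
    by linarith
  ultimately have "\<bar>r - r'\<bar> \<le> c" by linarith
  then show ?thesis
    by (simp add: r(1) r'(1) flip: of_real_diff)
qed

text \<open>d stands for a difference of two vectors of \<open>H1\<close>, hence the bound 2. The
  part of d outside E is a tail and costs \<epsilon> / 4 times 2; the part along E is small in norm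
  and costs \<epsilon> / 2 by the uniform bound C on ||T x||.\<close>

lemma tight_weak_estimate:
  assumes tight: "tight (T ` ball1)" and \<epsilon>: "\<epsilon> > 0"
  obtains E \<delta> where "finite E" "\<delta> > 0"
    "\<forall>x\<in>ball1. \<forall>d z. norm d \<le> 2 \<longrightarrow> norm z \<le> 1 \<longrightarrow> (\<forall>e\<in>E. cmod (cinner d e) < \<delta>) \<longrightarrow>
       cmod (cinner (blinfun_apply (T x) d) z) \<le> \<epsilon> \<and> cmod (cinner (blinfun_apply (T x) z) d) \<le> \<epsilon>"
proof -
  have \<epsilon>4: "\<epsilon> / 4 > 0" using \<epsilon> by simp
  obtain F where F: "finite F" "\<forall>y\<in>T ` ball1. tail F (\<epsilon> / 4) y"
    using tight[unfolded tight_def, rule_format, OF \<epsilon>4] by (elim exE conjE)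
  obtain E where E: "orthonormal E (\<lambda>e. e)" and perp: "\<And>v. perp F (v - oproj E v)"
    using perp_decomposition[OF F(1)] by blast
  define C where "C = (\<Sum>j\<in>UNIV. norm (a j) * norm (b j))"
  have C: "C \<ge> 0" by (simp add: C_def sum_nonneg)
  obtain \<delta> where \<delta>: "\<delta> > 0" "C * (real (card E) * \<delta>) \<le> \<epsilon> / 2"
    using small_multiple[of "\<epsilon> / 2" "real (card E)" C] \<epsilon> C by auto
  show ?thesis
  proof (rule that[OF orthonormal_finite[OF E] \<delta>(1)], intro ballI allI impI)
    fix x and d z :: 'h
    assume x: "x \<in> ball1" and d: "norm d \<le> 2" and z: "norm z \<le> 1"
      and small: "\<forall>e\<in>E. cmod (cinner d e) < \<delta>"
    define d1 d2 where "d1 = oproj E d" and "d2 = d - oproj E d"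
    have dd: "d = d1 + d2" by (simp add: d1_def d2_def)
    have d2: "norm d2 \<le> 2"
      using norm_diff_oproj_le[OF E, of d] d by (simp add: d2_def)
    have "norm d1 \<le> (\<Sum>e\<in>E. cmod (cinner d e))"
      unfolding d1_def by (rule norm_oproj_le_sum[OF E])
    also have "\<dots> \<le> (\<Sum>e\<in>E. \<delta>)"
      using small by (intro sum_mono) (auto simp: less_imp_le)
    finally have d1: "norm d1 \<le> real (card E) * \<delta>" by simp
    have TC: "norm (T x) \<le> C"
      unfolding C_def using x by (intro norm_T_le[OF aB bB T_def]) (simp add: ball1_def)
    have head: "norm (T x) * (norm d1 * norm z) \<le> \<epsilon> / 2"
    proof -
      have "norm (T x) * (norm d1 * norm z) \<le> C * ((real (card E) * \<delta>) * 1)"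
        using TC d1 z C \<delta>(1) by (intro mult_mono) auto
      then show ?thesis using \<delta>(2) by simp
    qed
    have rest: "\<epsilon> / 4 * (norm d2 * norm z) \<le> \<epsilon> / 2"
    proof -
      have "\<epsilon> / 4 * (norm d2 * norm z) \<le> \<epsilon> / 4 * (2 * 1)"
        using d2 z \<epsilon> by (intro mult_left_mono mult_mono) auto
      then show ?thesis by simp
    qed
    have tail: "tail F (\<epsilon> / 4) (T x)" using F(2) x by blast
    have p: "perp F d2" unfolding d2_def by (rule perp)
    have "cmod (cinner (blinfun_apply (T x) d2) z) \<le> \<epsilon> / 4 * norm d2 * norm z"
      and "cmod (cinner (blinfun_apply (T x) z) d2) \<le> \<epsilon> / 4 * norm z * norm d2"
      using tail p unfolding tail_def by blast+
    then have t: "cmod (cinner (blinfun_apply (T x) d2) z) \<le> \<epsilon> / 2"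
      "cmod (cinner (blinfun_apply (T x) z) d2) \<le> \<epsilon> / 2"
      using rest by (simp_all add: mult.assoc mult.commute[of "norm z"])
    have h: "cmod (cinner (blinfun_apply (T x) d1) z) \<le> \<epsilon> / 2"
      "cmod (cinner (blinfun_apply (T x) z) d1) \<le> \<epsilon> / 2"
      using cmod_cinner_blinfun_le[of "T x" d1 z] cmod_cinner_blinfun_le[of "T x" z d1] head
      by (simp_all add: mult.assoc mult.commute[of "norm z"])
    have "cinner (blinfun_apply (T x) d) z = cinner (blinfun_apply (T x) d1) z + cinner (blinfun_apply (T x) d2) z"
      "cinner (blinfun_apply (T x) z) d = cinner (blinfun_apply (T x) z) d1 + cinner (blinfun_apply (T x) z) d2"
      by (simp_all add: dd blinfun.add_right cinner_add_left cinner_add_right)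
    then show "cmod (cinner (blinfun_apply (T x) d) z) \<le> \<epsilon> \<and> cmod (cinner (blinfun_apply (T x) z) d) \<le> \<epsilon>"
      using t h norm_triangle_ineq[of "cinner (blinfun_apply (T x) d1) z" "cinner (blinfun_apply (T x) d2) z"]
        norm_triangle_ineq[of "cinner (blinfun_apply (T x) z) d1" "cinner (blinfun_apply (T x) z) d2"]
      by simp
  qed
qed

text \<open>The increment of each form splits into one varying \<eta> with \<xi> fixed and one
  varying \<xi> with \<eta>0 fixed. Both are at most \<epsilon> / 3 uniformly in x, which leaves a
  strict bound below \<epsilon>.\<close>

lemma continuous_if_tight:
  assumes tight: "tight (T ` ball1)"
  shows "continuous_map W euclidean f"
  unfolding continuous_map
proof (intro conjI allI impI)
  fix V :: "complex set" assume "openin euclidean V"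
  then have V: "open V" by simp
  have top: "topspace W = H1 \<times> H1"
    unfolding W_def H1_def by (rule topspace_weak_prod)
  show "openin W {p \<in> topspace W. f p \<in> V}"
  proof (subst openin_subopen, intro ballI)
    fix p assume p: "p \<in> {p \<in> topspace W. f p \<in> V}"
    obtain \<xi>0 \<eta>0 where p0: "p = (\<xi>0, \<eta>0)" by (cases p)
    have H: "\<xi>0 \<in> H1" "\<eta>0 \<in> H1" and fV: "f (\<xi>0, \<eta>0) \<in> V"
      using p by (auto simp: p0 top)
    obtain \<epsilon> where \<epsilon>: "\<epsilon> > 0" "ball (f (\<xi>0, \<eta>0)) \<epsilon> \<subseteq> V"
      using V fV open_contains_ball by blast
    have \<epsilon>3: "\<epsilon> / 3 > 0" using \<epsilon>(1) by simp
    obtain E \<delta> where E: "finite E" and \<delta>: "\<delta> > 0" and est: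
      "\<forall>x\<in>ball1. \<forall>d z. norm d \<le> 2 \<longrightarrow> norm z \<le> 1 \<longrightarrow> (\<forall>e\<in>E. cmod (cinner d e) < \<delta>) \<longrightarrow>
         cmod (cinner (blinfun_apply (T x) d) z) \<le> \<epsilon> / 3 \<and> cmod (cinner (blinfun_apply (T x) z) d) \<le> \<epsilon> / 3"
      by (rule tight_weak_estimate[OF tight \<epsilon>3])
    define N where "N = (H1 \<inter> {x. \<forall>e\<in>E. cmod (cinner (x - \<xi>0) e) < \<delta>})
      \<times> (H1 \<inter> {y. \<forall>e\<in>E. cmod (cinner (y - \<eta>0) e) < \<delta>})"
    have "openin W N"
      unfolding N_def W_def H1_def by (rule weak_prod_open[OF E])
    moreover have "p \<in> N"
      using H \<delta> by (simp add: p0 N_def cinner_zero_left)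
    moreover have "N \<subseteq> {p \<in> topspace W. f p \<in> V}"
    proof
      fix s assume s: "s \<in> N"
      obtain \<xi> \<eta> where s0: "s = (\<xi>, \<eta>)" by (cases s)
      have sH: "\<xi> \<in> H1" "\<eta> \<in> H1"
        and sE: "\<forall>e\<in>E. cmod (cinner (\<xi> - \<xi>0) e) < \<delta>" "\<forall>e\<in>E. cmod (cinner (\<eta> - \<eta>0) e) < \<delta>"
        using s by (simp_all add: s0 N_def)
      have n: "norm \<xi> \<le> 1" "norm \<eta>0 \<le> 1" "norm (\<xi> - \<xi>0) \<le> 2" "norm (\<eta> - \<eta>0) \<le> 2"
        using sH H norm_triangle_ineq4[of \<xi> \<xi>0] norm_triangle_ineq4[of \<eta> \<eta>0] by (auto simp: H1_def)
      have "cmod (f (\<xi>, \<eta>) - f (\<xi>0, \<eta>0)) \<le> \<epsilon> / 3 + \<epsilon> / 3"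
      proof (rule f_diff_le)
        fix x assume x: "x \<in> ball1"
        have 1: "cmod (cinner (blinfun_apply (T x) (\<eta> - \<eta>0)) \<xi>) \<le> \<epsilon> / 3"
          using est[rule_format, OF x n(4) n(1)] sE(2) by blast
        have 2: "cmod (cinner (blinfun_apply (T x) \<eta>0) (\<xi> - \<xi>0)) \<le> \<epsilon> / 3"
          using est[rule_format, OF x n(3) n(2)] sE(1) by blast
        have eq: "cinner (blinfun_apply (T x) \<eta>) \<xi> - cinner (blinfun_apply (T x) \<eta>0) \<xi>0
            = cinner (blinfun_apply (T x) (\<eta> - \<eta>0)) \<xi> + cinner (blinfun_apply (T x) \<eta>0) (\<xi> - \<xi>0)"
          by (simp add: blinfun.diff_right cinner_diff_left cinner_diff_right)
        show "cmod (cinner (blinfun_apply (T x) \<eta>) \<xi> - cinner (blinfun_apply (T x) \<eta>0) \<xi>0) \<le> \<epsilon> / 3 + \<epsilon> / 3"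
          unfolding eq by (rule norm_triangle_mono[OF 1 2])
      qed
      then have "f (\<xi>, \<eta>) \<in> ball (f (\<xi>0, \<eta>0)) \<epsilon>"
        using \<epsilon>(1) by (simp add: dist_norm norm_minus_commute)
      then show "s \<in> {p \<in> topspace W. f p \<in> V}"
        using \<epsilon>(2) sH by (auto simp: s0 top)
    qed
    ultimately show "\<exists>N. openin W N \<and> p \<in> N \<and> N \<subseteq> {p \<in> topspace W. f p \<in> V}" by blast
  qed
qed simp

text \<open>A vector differing from the base point by something orthogonal to F satisfies every weak
  condition tested on F, whatever the radius. Near a zero of \<open>f\<close>, continuity therefore
  bounds all forms at once on such vectors.\<close>

lemma continuous_at_zero_bound:
  assumes cont: "continuous_at_in W euclidean f (\<xi>0, \<eta>0)" and zero: "f (\<xi>0, \<eta>0) = 0" and \<epsilon>: "\<epsilon> > 0"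
  shows "\<exists>F. finite F \<and> (\<forall>\<xi> \<eta>. norm \<xi> \<le> 1 \<longrightarrow> norm \<eta> \<le> 1 \<longrightarrow> perp F (\<xi> - \<xi>0) \<longrightarrow> perp F (\<eta> - \<eta>0) \<longrightarrow>
     (\<forall>x\<in>ball1. cmod (cinner (blinfun_apply (T x) \<eta>) \<xi>) \<le> \<epsilon>))"
proof -
  have "openin euclidean (ball (0::complex) \<epsilon>) \<and> f (\<xi>0, \<eta>0) \<in> ball 0 \<epsilon>"
    using zero \<epsilon> by simp
  then obtain U where U: "openin W U" "(\<xi>0, \<eta>0) \<in> U" "f ` U \<subseteq> ball 0 \<epsilon>"
    using cont[unfolded continuous_at_in_def, THEN conjunct2, rule_format, of "ball 0 \<epsilon>"] by blast
  show ?thesis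
  proof (rule weak_prod_nbhd[OF U(1,2)[unfolded W_def H1_def]])
    fix F \<delta>
    assume F: "finite F" "\<delta> > 0" and sub: "\<And>x y. x \<in> cball 0 1 \<Longrightarrow> y \<in> cball 0 1 \<Longrightarrow>
      (\<And>f. f \<in> F \<Longrightarrow> cmod (cinner (x - \<xi>0) f) < \<delta> \<and> cmod (cinner (y - \<eta>0) f) < \<delta>) \<Longrightarrow> (x, y) \<in> U"
    show ?thesis
    proof (intro exI[of _ F] conjI allI impI ballI)
      fix \<xi> \<eta> x assume "norm \<xi> \<le> 1" "norm \<eta> \<le> 1" and p: "perp F (\<xi> - \<xi>0)" "perp F (\<eta> - \<eta>0)"
        and x: "x \<in> ball1"
      then have "(\<xi>, \<eta>) \<in> U"
        using F(2) by (intro sub) (auto simp: perp_def)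
      then have "cmod (f (\<xi>, \<eta>)) < \<epsilon>"
        using U(3) by (auto simp: image_subset_iff)
      then show "cmod (cinner (blinfun_apply (T x) \<eta>) \<xi>) \<le> \<epsilon>"
        using cinner_T_le_f[OF x, of \<eta> \<xi>] by linarith
    qed (fact F(1))
  qed
qed

text \<open>If only v is a tail vector, w is split along E: its remainder is orthogonal to F and
  falls under the bound from the origin, while its components along E fall under the bounds from the
  points (e, 0). The other side uses (0, e).\<close>

lemma tight_if_continuous_on_axes:
  assumes cont: "\<forall>p \<in> (H1 \<times> {0}) \<union> ({0} \<times> H1). continuous_at_in W euclidean f p"
  shows "tight (T ` ball1)"
  unfolding tight_def
proof (intro allI impI)
  fix \<epsilon> :: real assume \<epsilon>: "\<epsilon> > 0"
  have \<epsilon>2: "\<epsilon> / 2 > 0" using \<epsilon> by simp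
  have "continuous_at_in W euclidean f (0, 0)"
    using cont by (simp add: H1_def)
  from continuous_at_zero_bound[OF this f_zero \<epsilon>2]
  obtain F where F: "finite F" and Fb: "\<forall>\<xi> \<eta>. norm \<xi> \<le> 1 \<longrightarrow> norm \<eta> \<le> 1 \<longrightarrow> perp F \<xi> \<longrightarrow> perp F \<eta> \<longrightarrow>
      (\<forall>x\<in>ball1. cmod (cinner (blinfun_apply (T x) \<eta>) \<xi>) \<le> \<epsilon> / 2)"
    by auto
  obtain E where E: "orthonormal E (\<lambda>e. e)" and perp: "\<And>v. perp F (v - oproj E v)"
    using perp_decomposition[OF F] by blast
  note fin = orthonormal_finite[OF E]
  \<comment> \<open>The bound demanded at each axis point: the \<open>card E\<close> mixed terms
    then cost \<epsilon> / 2, and the bound from the origin costs the other half.\<close>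
  obtain \<delta> where \<delta>: "\<delta> > 0" "1 * (real (card E) * \<delta>) \<le> \<epsilon> / 2"
    using small_multiple[of "\<epsilon> / 2" "real (card E)" 1] \<epsilon> by auto
  have perp0: "perp G (0 :: 'h)" for G by (simp add: perp_def cinner_zero_left)
  have "\<exists>G. finite G \<and> (\<forall>\<eta>. norm \<eta> \<le> 1 \<longrightarrow> perp G \<eta> \<longrightarrow> (\<forall>x\<in>ball1. cmod (cinner (blinfun_apply (T x) \<eta>) e) \<le> \<delta>))"
    if e: "e \<in> E" for e
  proof -
    \<comment> \<open>\<open>f\<close> vanishes at (e, 0), and \<xi> = e itself is admissible in the
      resulting bound because e - e is orthogonal to everything.\<close>
    have "continuous_at_in W euclidean f (e, 0)"
      using cont orthonormal_norm[OF E e] by (simp add: H1_def)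
    from continuous_at_zero_bound[OF this f_zero \<delta>(1)]
    obtain G where "finite G" and G: "\<forall>\<xi> \<eta>. norm \<xi> \<le> 1 \<longrightarrow> norm \<eta> \<le> 1 \<longrightarrow> perp G (\<xi> - e) \<longrightarrow> perp G (\<eta> - 0) \<longrightarrow>
        (\<forall>x\<in>ball1. cmod (cinner (blinfun_apply (T x) \<eta>) \<xi>) \<le> \<delta>)"
      by auto
    then show ?thesis
      using G[rule_format, of e] orthonormal_norm[OF E e] perp0 by (intro exI[of _ G]) simp
  qed
  then obtain L where L: "\<forall>e\<in>E. finite (L e) \<and> (\<forall>\<eta>. norm \<eta> \<le> 1 \<longrightarrow> perp (L e) \<eta> \<longrightarrow>
      (\<forall>x\<in>ball1. cmod (cinner (blinfun_apply (T x) \<eta>) e) \<le> \<delta>))"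
    by metis
  have "\<exists>G. finite G \<and> (\<forall>\<xi>. norm \<xi> \<le> 1 \<longrightarrow> perp G \<xi> \<longrightarrow> (\<forall>x\<in>ball1. cmod (cinner (blinfun_apply (T x) e) \<xi>) \<le> \<delta>))"
    if e: "e \<in> E" for e
  proof -
    have "continuous_at_in W euclidean f (0, e)"
      using cont orthonormal_norm[OF E e] by (simp add: H1_def)
    from continuous_at_zero_bound[OF this f_zero \<delta>(1)]
    obtain G where "finite G" and G: "\<forall>\<xi> \<eta>. norm \<xi> \<le> 1 \<longrightarrow> norm \<eta> \<le> 1 \<longrightarrow> perp G (\<xi> - 0) \<longrightarrow> perp G (\<eta> - e) \<longrightarrow>
        (\<forall>x\<in>ball1. cmod (cinner (blinfun_apply (T x) \<eta>) \<xi>) \<le> \<delta>)"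
      by auto
    then show ?thesis
      using G[rule_format, of _ e] orthonormal_norm[OF E e] perp0 by (intro exI[of _ G]) simp
  qed
  then obtain R where R: "\<forall>e\<in>E. finite (R e) \<and> (\<forall>\<xi>. norm \<xi> \<le> 1 \<longrightarrow> perp (R e) \<xi> \<longrightarrow>
      (\<forall>x\<in>ball1. cmod (cinner (blinfun_apply (T x) e) \<xi>) \<le> \<delta>))"
    by metis
  define U where "U = F \<union> (\<Union>e\<in>E. L e \<union> R e)"
  have "finite U"
    using F fin L R by (auto simp: U_def)
  moreover have "tail U \<epsilon> (T x)" if x: "x \<in> ball1" for x
    unfolding tail_def
  proof (intro allI impI)
    fix v w assume "perp U v \<or> perp U w"
    define y where "y = T x"
    have yB: "y \<in> BH"
      using T_BH[OF aB bB T_def, of x] x by (simp add: y_def ball1_def)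
    have FF: "cmod (cinner (blinfun_apply y v) w) \<le> \<epsilon> / 2 * norm v * norm w" if "perp F v" "perp F w" for v w
    proof -
      have "cmod (cinner (blinfun_apply y v) w) \<le> \<epsilon> / 2 * norm v" if "norm w \<le> 1" "perp F w" for w
        by (rule cinner_bound_scale_left[OF _ \<open>perp F v\<close>]) (use Fb x that in \<open>simp add: y_def\<close>)
      from cinner_bound_scale_right[OF this \<open>perp F w\<close>] show ?thesis by simp
    qed
    have ce: "cmod (cinner z e) \<le> norm z" if "e \<in> E" for z e
      using Cauchy_Schwarz_cinner[of z e] orthonormal_norm[OF E that] by simp
    have card: "(\<Sum>e\<in>E. norm p * (\<delta> * norm q)) \<le> \<epsilon> / 2 * norm p * norm q" for p q :: 'h
    proof -
      have "(\<Sum>e\<in>E. norm p * (\<delta> * norm q)) = (1 * (real (card E) * \<delta>)) * (norm p * norm q)" by simp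
      also have "\<dots> \<le> \<epsilon> / 2 * (norm p * norm q)"
        using \<delta>(2) by (intro mult_right_mono) auto
      finally show ?thesis by (simp add: mult.assoc)
    qed
    have "cmod (cinner (blinfun_apply y v) w) \<le> \<epsilon> * norm v * norm w"
      using \<open>perp U v \<or> perp U w\<close>
    proof
      assume v: "perp U v"
      have "perp F v" by (rule perp_mono[OF _ v]) (auto simp: U_def)
      have "cmod (cinner (blinfun_apply y v) (w - oproj E w)) \<le> \<epsilon> / 2 * norm v * norm (w - oproj E w)"
        by (rule FF[OF \<open>perp F v\<close> perp])
      also have "\<dots> \<le> \<epsilon> / 2 * norm v * norm w"
        using \<epsilon> norm_diff_oproj_le[OF E, of w] by (intro mult_left_mono) auto
      finally have 1: "cmod (cinner (blinfun_apply y v) (w - oproj E w)) \<le> \<epsilon> / 2 * norm v * norm w" .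
      have "cmod (cinner (blinfun_apply y v) (oproj E w)) \<le> (\<Sum>e\<in>E. norm w * (\<delta> * norm v))"
        unfolding oproj_def cinner.sum_right cinner_scaleC_right
      proof (rule sum_norm_le)
        fix e assume e: "e \<in> E"
        have "perp (L e) v" by (rule perp_mono[OF _ v]) (use e in \<open>auto simp: U_def\<close>)
        then have "cmod (cinner (blinfun_apply y v) e) \<le> \<delta> * norm v"
          by (rule cinner_bound_scale_left[rotated]) (use L e x in \<open>simp add: y_def\<close>)
        then show "cmod (cnj (cinner w e) * cinner (blinfun_apply y v) e) \<le> norm w * (\<delta> * norm v)"
          using ce[OF e, of w] by (simp add: norm_mult mult_mono)
      qed
      also note card[of w v]
      finally have 2: "cmod (cinner (blinfun_apply y v) (oproj E w)) \<le> \<epsilon> / 2 * norm v * norm w"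
        by (simp add: mult.commute mult.left_commute)
      have eq: "cinner (blinfun_apply y v) w
          = cinner (blinfun_apply y v) (w - oproj E w) + cinner (blinfun_apply y v) (oproj E w)"
        by (simp add: cinner_diff_right)
      have "cmod (cinner (blinfun_apply y v) w) \<le> \<epsilon> / 2 * norm v * norm w + \<epsilon> / 2 * norm v * norm w"
        unfolding eq by (rule norm_triangle_mono[OF 1 2])
      then show ?thesis by simp
    next
      assume w: "perp U w"
      have "perp F w" by (rule perp_mono[OF _ w]) (auto simp: U_def)
      have "cmod (cinner (blinfun_apply y (v - oproj E v)) w) \<le> \<epsilon> / 2 * norm (v - oproj E v) * norm w"
        by (rule FF[OF perp \<open>perp F w\<close>])
      also have "\<dots> \<le> \<epsilon> / 2 * norm v * norm w"
        using \<epsilon> norm_diff_oproj_le[OF E, of v] by (intro mult_right_mono mult_left_mono) auto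
      finally have 1: "cmod (cinner (blinfun_apply y (v - oproj E v)) w) \<le> \<epsilon> / 2 * norm v * norm w" .
      have "cmod (cinner (blinfun_apply y (oproj E v)) w) \<le> (\<Sum>e\<in>E. norm v * (\<delta> * norm w))"
        unfolding BH_oproj[OF yB] cinner.sum_left cinner_scaleC_left
      proof (rule sum_norm_le)
        fix e assume e: "e \<in> E"
        have "perp (R e) w" by (rule perp_mono[OF _ w]) (use e in \<open>auto simp: U_def\<close>)
        then have "cmod (cinner (blinfun_apply y e) w) \<le> \<delta> * norm w"
          by (rule cinner_bound_scale_right[rotated]) (use R e x in \<open>simp add: y_def\<close>)
        then show "cmod (cinner v e * cinner (blinfun_apply y e) w) \<le> norm v * (\<delta> * norm w)"
          using ce[OF e, of v] by (simp add: norm_mult mult_mono)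
      qed
      also note card[of v w]
      finally have 2: "cmod (cinner (blinfun_apply y (oproj E v)) w) \<le> \<epsilon> / 2 * norm v * norm w" .
      have eq: "cinner (blinfun_apply y v) w
          = cinner (blinfun_apply y (v - oproj E v)) w + cinner (blinfun_apply y (oproj E v)) w"
        by (simp add: blinfun.diff_right cinner_diff_left)
      have "cmod (cinner (blinfun_apply y v) w) \<le> \<epsilon> / 2 * norm v * norm w + \<epsilon> / 2 * norm v * norm w"
        unfolding eq by (rule norm_triangle_mono[OF 1 2])
      then show ?thesis by simp
    qed
    then show "cmod (cinner (blinfun_apply (T x) v) w) \<le> \<epsilon> * norm v * norm w"
      by (simp only: y_def)
  qed
  ultimately show "\<exists>F. finite F \<and> (\<forall>y\<in>T ` ball1. tail F \<epsilon> y)"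
    by (intro exI[of _ U]) auto
qed

end

theorem theorem1p12:
  fixes a b :: "'l::finite \<Rightarrow> ('h::{complex_inner, complete_space} \<Rightarrow>\<^sub>L 'h)"
    and T :: "('h \<Rightarrow>\<^sub>L 'h) \<Rightarrow> ('h \<Rightarrow>\<^sub>L 'h)"
    and f :: "'h \<times> 'h \<Rightarrow> complex"
  assumes aB: "\<And>j. a j \<in> BH" and bB: "\<And>j. b j \<in> BH"
    and T_def: "\<And>x. T x = (\<Sum>j\<in>UNIV. a j o\<^sub>L x o\<^sub>L b j)"
    and f_def: "\<And>\<xi> \<eta>. f (\<xi>, \<eta>) =
                   tgm (Qmat (\<lambda>j. cadjoint (a j)) \<xi>) (Qmat (\<lambda>j. blinfun_apply (b j)) \<eta>)"
  defines "H1 \<equiv> cball (0::'h) 1"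
  defines "W \<equiv> prod_topology (subtopology weak_topology H1) (subtopology weak_topology H1)"
  shows "(compact_map_BH T \<longleftrightarrow> continuous_map W euclidean f)
       \<and> (compact_map_BH T \<longleftrightarrow>
            (\<forall>p \<in> (H1 \<times> {0}) \<union> ({0} \<times> H1). continuous_at_in W euclidean f p))
       \<and> (clin_indep a \<and> clin_indep b \<longrightarrow>
            (compact_map_BH T \<longleftrightarrow> (\<forall>j. compact_operator (a j) \<and> compact_operator (b j))))"
proof -
  let ?C = "tight (T ` {x \<in> BH. norm x \<le> 1})"
  have i: "compact_map_BH T \<longleftrightarrow> ?C"
    using tight_if_compact_map[OF aB bB T_def] compact_map_if_tight[OF aB bB T_def] by blast
  have ii: "?C \<Longrightarrow> continuous_map W euclidean f"
    unfolding W_def H1_def by (rule continuous_if_tight[OF aB bB T_def f_def])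
  have top: "topspace W = H1 \<times> H1"
    unfolding W_def H1_def by (rule topspace_weak_prod)
  have iii: "\<forall>p \<in> (H1 \<times> {0}) \<union> ({0} \<times> H1). continuous_at_in W euclidean f p"
    if "continuous_map W euclidean f"
  proof
    fix p assume "p \<in> (H1 \<times> {0}) \<union> ({0} \<times> H1)"
    then have "p \<in> topspace W" by (auto simp: top H1_def)
    then show "continuous_at_in W euclidean f p"
      by (rule continuous_at_in_if_continuous_map[OF that])
  qed
  have hub: "(\<forall>p \<in> (H1 \<times> {0}) \<union> ({0} \<times> H1). continuous_at_in W euclidean f p) \<Longrightarrow> ?C"
    unfolding W_def H1_def by (rule tight_if_continuous_on_axes[OF aB bB T_def f_def])
  have iv: "?C \<longleftrightarrow> (\<forall>j. compact_operator (a j) \<and> compact_operator (b j))" if "clin_indep a \<and> clin_indep b"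
  proof
    assume ?C
    then show "\<forall>j. compact_operator (a j) \<and> compact_operator (b j)"
      using compact_coefficients_if_tight[OF aB bB T_def] that by blast
  next
    assume "\<forall>j. compact_operator (a j) \<and> compact_operator (b j)"
    then show ?C
      using tight_if_compact_coefficients[OF aB bB T_def] by blast
  qed
  show ?thesis
    using i ii iii hub iv by argo
qed

end
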